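(* Let the MPSC feasible set $M$ be compact and connected, let LICQ hold at all points of $M$, and let all W-stationary points of MPSC be nondegenerate. Then $r_s\ge r-1$, where $r$ is the number of local minimizers of MPSC and $r_s$ is the number of W-stationary (saddle) points of MPSC with W-index equal to one.
   Context: Setting. Let $I,J$ be finite index sets, and let $f\in C^2(\mathbb{R}^n,\mathbb{R})$, $h\in C^2(\mathbb{R}^n,\mathbb{R}^{|I|})$, $g\in C^2(\mathbb{R}^n,\mathbb{R}^{|J|})$, $F_1,F_2\in C^2(\mathbb{R}^n,\mathbb{R}^k)$. The mathematical program with switching constraints (MPSC) is to minimize $f(x)$ subject to $x\in M$, where $M=\{x\in\mathbb{R}^n \mid h_i(x)=0\ (i\in I),\ g_j(x)\ge 0\ (j\in J),\ F_{1,m}(x)F_{2,m}(x)=0\ (m=1,\dots,k)\}$. Index sets at $\bar x\in M$: $J_0(\bar x)=\{j\in J\mid g_j(\bar x)=0\}$; $\alpha(\bar x)=\{m\mid F_{1,m}(\bar x)=0, F_{2,m}(\bar x)\ne 0\}$; $\beta(\bar x)=\{m\mid F_{1,m}(\bar x)=F_{2,m}(\bar x)=0\}$; $\gamma(\bar x)=\{m\mid F_{1,m}(\bar x)\ne 0, F_{2,m}(\bar x)=0\}$. LICQ holds at $\bar x\in M$ if the vectors $Dh_i(\bar x)$ ($i\in I$), $DF_{1,m}(\bar x)$ ($m\in\alpha(\bar x)$), $DF_{2,m}(\bar x)$ ($m\in\gamma(\bar x)$), $Dg_j(\bar x)$ ($j\in J_0(\bar x)$), $DF_{1,m}(\bar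 x), DF_{2,m}(\bar x)$ ($m\in\beta(\bar x)$) are linearly independent. W-stationarity: $\bar x\in M$ is W-stationary if there are real multipliers $\bar\lambda_i$ ($i\in I$), $\bar\mu_j$ ($j\in J$), $\bar\sigma_{1,m},\bar\sigma_{2,m}$ ($m=1,\dots,k$) such that $Df(\bar x)=\sum_{i\in I}\bar\lambda_i Dh_i(\bar x)+\sum_{j\in J}\bar\mu_j Dg_j(\bar x)+\sum_{m=1}^k(\bar\sigma_{1,m}DF_{1,m}(\bar x)+\bar\sigma_{2,m}DF_{2,m}(\bar x))$, $\bar\mu_j g_j(\bar x)=0$ and $\bar\mu_j\ge 0$ for all $j\in J$, and $\bar\sigma_{l,m}F_{l,m}(\bar x)=0$ for $l=1,2$, $m=1,\dots,k$. Under LICQ the multipliers are unique. Lagrange function: $L(x,\lambda,\mu,\sigma)=f(x)-\sum_{i\in I}\lambda_i h_i(x)-\sum_{j\in J}\mu_j g_j(x)-\sum_{m=1}^k(\sigma_{1,m}F_{1,m}(x)+\sigma_{2,m}F_{2,m}(x))$. Tangent space: $T_{\bar x}M_0(\bar x)=\{\xi\in\mathbb{R}^n\mid Dh_i(\bar x)\xi=0\ (i\in I),\ Dg_j(\bar x)\xi=0\ (j\in J_0(\bar x)),\ DF_{1,m}(\bar x)\xi=0\ (m\in\alpha(\bar x)),\ DF_{2,m}(\bar x)\xi=0\ (m\in\gamma(\bar x)),\ DF_{1,m}(\bar x)\xi=DF_{2,m}(\bar x)\xi=0\ (m\in\beta(\bar x))\}$. The restriction of $D^2_{xx}L$ to this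 space means $V^T D^2_{xx}L\,V$, where the columns of $V$ form a basis of the space. Nondegeneracy: a W-stationary point $\bar x$ with multipliers $(\bar\lambda,\bar\mu,\bar\sigma)$ is nondegenerate if ND1: LICQ holds at $\bar x$; ND2: $\bar\mu_j>0$ for all $j\in J_0(\bar x)$; ND3: $\bar\sigma_{1,m}\bar\sigma_{2,m}\ne 0$ for all $m\in\beta(\bar x)$; ND4: $D^2_{xx}L(\bar x,\bar\lambda,\bar\mu,\bar\sigma)$ restricted to $T_{\bar x}M_0(\bar x)$ is nonsingular. W-index of a nondegenerate W-stationary point $\bar x$: $QI+BI$, where the quadratic index $QI$ is the number of negative eigenvalues of $D^2_{xx}L(\bar x,\bar\lambda,\bar\mu,\bar\sigma)$ restricted to $T_{\bar x}M_0(\bar x)$ and the bi-active index is $BI=|\beta(\bar x)|$. A local minimizer of MPSC is a local minimizer of $f$ restricted to $M$. *)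

theory Defs
  imports "HOL-Analysis.Analysis" "Jordan_Normal_Form.Char_Poly"
begin

section \<open>Twice continuously differentiable functions\<close>

definition grad :: "(real ^ 'n \<Rightarrow> real) \<Rightarrow> real ^ 'n \<Rightarrow> real ^ ('n::finite)" where
  "grad f x = (\<chi> i. frechet_derivative f (at x) (axis i 1))"

definition hessian :: "(real ^ 'n \<Rightarrow> real) \<Rightarrow> real ^ 'n \<Rightarrow> real ^ 'n ^ ('n::finite)" where
  "hessian f x = jacobian (grad f) (at x)"

definition C2 :: "(real ^ 'n \<Rightarrow> real) \<Rightarrow> bool" where
  "C2 f \<longleftrightarrow> (\<forall>x. f differentiable (at x)) \<and> (\<forall>x. grad f differentiable (at x))
     \<and> continuous_on UNIV (hessian f)"


section \<open>Mathematical programs with switching constraints\<close>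

text \<open>The constraint maps are given by their components: only \<open>eq_con P i\<close> with
  \<open>i \<in> eq_idx P\<close>, \<open>ineq_con P j\<close> with \<open>j \<in> ineq_idx P\<close>, and \<open>sw1 P m\<close>, \<open>sw2 P m\<close> with
  \<open>m \<in> {1..sw_num P}\<close> matter. The index sets are sets rather than types so that they may be
  empty.\<close>

record ('n, 'i, 'j) mpsc =
  objective :: "real ^ 'n \<Rightarrow> real"
  eq_idx :: "'i set"
  eq_con :: "'i \<Rightarrow> real ^ 'n \<Rightarrow> real"
  ineq_idx :: "'j set"
  ineq_con :: "'j \<Rightarrow> real ^ 'n \<Rightarrow> real"
  sw_num :: nat
  sw1 :: "nat \<Rightarrow> real ^ 'n \<Rightarrow> real"
  sw2 :: "nat \<Rightarrow> real ^ 'n \<Rightarrow> real"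

definition C2_mpsc :: "('n::finite, 'i, 'j) mpsc \<Rightarrow> bool" where
  "C2_mpsc P \<longleftrightarrow> C2 (objective P)
     \<and> (\<forall>i\<in>eq_idx P. C2 (eq_con P i)) \<and> (\<forall>j\<in>ineq_idx P. C2 (ineq_con P j))
     \<and> (\<forall>m\<in>{1..sw_num P}. C2 (sw1 P m) \<and> C2 (sw2 P m))"

definition feasible :: "('n::finite, 'i, 'j) mpsc \<Rightarrow> (real ^ 'n) set" where
  "feasible P = {x. (\<forall>i\<in>eq_idx P. eq_con P i x = 0) \<and> (\<forall>j\<in>ineq_idx P. ineq_con P j x \<ge> 0)
     \<and> (\<forall>m\<in>{1..sw_num P}. sw1 P m x * sw2 P m x = 0)}"

definition local_minimizer :: "('n::finite, 'i, 'j) mpsc \<Rightarrow> real ^ 'n \<Rightarrow> bool" where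
  "local_minimizer P x \<longleftrightarrow> x \<in> feasible P
     \<and> (\<exists>e>0. \<forall>y\<in>feasible P. dist y x < e \<longrightarrow> objective P x \<le> objective P y)"

definition active_ineq :: "('n::finite, 'i, 'j) mpsc \<Rightarrow> real ^ 'n \<Rightarrow> 'j set" where
  "active_ineq P x = {j \<in> ineq_idx P. ineq_con P j x = 0}"

definition alpha_idx :: "('n::finite, 'i, 'j) mpsc \<Rightarrow> real ^ 'n \<Rightarrow> nat set" where
  "alpha_idx P x = {m \<in> {1..sw_num P}. sw1 P m x = 0 \<and> sw2 P m x \<noteq> 0}"

definition beta_idx :: "('n::finite, 'i, 'j) mpsc \<Rightarrow> real ^ 'n \<Rightarrow> nat set" where
  "beta_idx P x = {m \<in> {1..sw_num P}. sw1 P m x = 0 \<and> sw2 P m x = 0}"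

definition gamma_idx :: "('n::finite, 'i, 'j) mpsc \<Rightarrow> real ^ 'n \<Rightarrow> nat set" where
  "gamma_idx P x = {m \<in> {1..sw_num P}. sw1 P m x \<noteq> 0 \<and> sw2 P m x = 0}"


subsection \<open>Linear independence constraint qualification\<close>

text \<open>The gradients occurring in LICQ form a family, so their labels are kept apart and two
  constraints with the same gradient count as linearly dependent.\<close>

datatype ('i, 'j) constr = Eq_C 'i | Ineq_C 'j | Sw1_C nat | Sw2_C nat

fun constr_fun :: "('n::finite, 'i, 'j) mpsc \<Rightarrow> ('i, 'j) constr \<Rightarrow> real ^ 'n \<Rightarrow> real" where
  "constr_fun P (Eq_C i) = eq_con P i"
| "constr_fun P (Ineq_C j) = ineq_con P j"
| "constr_fun P (Sw1_C m) = sw1 P m"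
| "constr_fun P (Sw2_C m) = sw2 P m"

definition active_constr :: "('n::finite, 'i, 'j) mpsc \<Rightarrow> real ^ 'n \<Rightarrow> ('i, 'j) constr set" where
  "active_constr P x = Eq_C ` eq_idx P \<union> Ineq_C ` active_ineq P x
     \<union> Sw1_C ` (alpha_idx P x \<union> beta_idx P x) \<union> Sw2_C ` (gamma_idx P x \<union> beta_idx P x)"

definition LICQ :: "('n::finite, 'i, 'j) mpsc \<Rightarrow> real ^ 'n \<Rightarrow> bool" where
  "LICQ P x \<longleftrightarrow> inj_on (\<lambda>c. grad (constr_fun P c) x) (active_constr P x)
     \<and> independent ((\<lambda>c. grad (constr_fun P c) x) ` active_constr P x)"

definition tangent_space :: "('n::finite, 'i, 'j) mpsc \<Rightarrow> real ^ 'n \<Rightarrow> (real ^ 'n) set" where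
  "tangent_space P x =
     {\<xi>. \<forall>c\<in>active_constr P x. frechet_derivative (constr_fun P c) (at x) \<xi> = 0}"


subsection \<open>W-stationary points\<close>

record ('i, 'j) multipliers =
  lam :: "'i \<Rightarrow> real"
  mu :: "'j \<Rightarrow> real"
  sig1 :: "nat \<Rightarrow> real"
  sig2 :: "nat \<Rightarrow> real"

definition W_stationary_with ::
    "('n::finite, 'i, 'j) mpsc \<Rightarrow> real ^ 'n \<Rightarrow> ('i, 'j) multipliers \<Rightarrow> bool" where
  "W_stationary_with P x w \<longleftrightarrow> x \<in> feasible P
     \<and> grad (objective P) x =
         (\<Sum>i\<in>eq_idx P. lam w i *\<^sub>R grad (eq_con P i) x)
       + (\<Sum>j\<in>ineq_idx P. mu w j *\<^sub>R grad (ineq_con P j) x)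
       + (\<Sum>m\<in>{1..sw_num P}. sig1 w m *\<^sub>R grad (sw1 P m) x + sig2 w m *\<^sub>R grad (sw2 P m) x)
     \<and> (\<forall>j\<in>ineq_idx P. mu w j * ineq_con P j x = 0 \<and> mu w j \<ge> 0)
     \<and> (\<forall>m\<in>{1..sw_num P}. sig1 w m * sw1 P m x = 0 \<and> sig2 w m * sw2 P m x = 0)"

definition lagrangian ::
    "('n::finite, 'i, 'j) mpsc \<Rightarrow> ('i, 'j) multipliers \<Rightarrow> real ^ 'n \<Rightarrow> real" where
  "lagrangian P w x = objective P x
     - (\<Sum>i\<in>eq_idx P. lam w i * eq_con P i x)
     - (\<Sum>j\<in>ineq_idx P. mu w j * ineq_con P j x)
     - (\<Sum>m\<in>{1..sw_num P}. sig1 w m * sw1 P m x + sig2 w m * sw2 P m x)"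


subsection \<open>Restriction of a quadratic form to a subspace\<close>

definition basis_list :: "(real ^ 'n) set \<Rightarrow> (real ^ ('n::finite)) list \<Rightarrow> bool" where
  "basis_list T vs \<longleftrightarrow> distinct vs \<and> independent (set vs) \<and> span (set vs) = T"

text \<open>If \<open>V\<close> has the columns \<open>vs\<close>, this is the matrix \<open>V\<^sup>T H V\<close>. Its size is the dimension
  of the subspace, hence the matrix type whose dimensions are values.\<close>

definition congruence_mat :: "real ^ 'n ^ 'n \<Rightarrow> (real ^ ('n::finite)) list \<Rightarrow> real mat" where
  "congruence_mat H vs =
     Matrix.mat (length vs) (length vs) (\<lambda>(a, b). inner (vs ! a) (H *v (vs ! b)))"

text \<open>The basis is chosen arbitrarily; regularity and, for symmetric \<open>H\<close>, the number of
  negative eigenvalues do not depend on it.\<close>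

definition restrict_mat :: "real ^ 'n ^ 'n \<Rightarrow> (real ^ ('n::finite)) set \<Rightarrow> real mat" where
  "restrict_mat H T = congruence_mat H (SOME vs. basis_list T vs)"

lemma basis_list_exists:
  assumes "subspace T"
  shows "\<exists>vs. basis_list T vs"
proof -
  obtain B where B: "B \<subseteq> T" "independent B" "T \<subseteq> span B"
    by (rule basis_exists[of T])
  have "span B = T"
    using B assms by (simp add: span_minimal subset_antisym)
  moreover obtain vs where "set vs = B" "distinct vs"
    using finite_distinct_list[OF independent_imp_finite[OF B(2)]] by auto
  ultimately show ?thesis
    using B(2) unfolding basis_list_def by auto
qed

text \<open>Eigenvalues are counted with multiplicity.\<close>

definition num_neg_eigenvalues :: "real mat \<Rightarrow> nat" where
  "num_neg_eigenvalues A = (\<Sum>e | eigenvalue A e \<and> e < 0. Polynomial.order e (char_poly A))"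


subsection \<open>Nondegeneracy and W-index\<close>

definition restricted_hessian ::
    "('n::finite, 'i, 'j) mpsc \<Rightarrow> real ^ 'n \<Rightarrow> ('i, 'j) multipliers \<Rightarrow> real mat" where
  "restricted_hessian P x w = restrict_mat (hessian (lagrangian P w) x) (tangent_space P x)"

definition nondegenerate ::
    "('n::finite, 'i, 'j) mpsc \<Rightarrow> real ^ 'n \<Rightarrow> ('i, 'j) multipliers \<Rightarrow> bool" where
  "nondegenerate P x w \<longleftrightarrow> LICQ P x
     \<and> (\<forall>j\<in>active_ineq P x. mu w j > 0)
     \<and> (\<forall>m\<in>beta_idx P x. sig1 w m * sig2 w m \<noteq> 0)
     \<and> invertible_mat (restricted_hessian P x w)"

definition quadratic_index ::
    "('n::finite, 'i, 'j) mpsc \<Rightarrow> real ^ 'n \<Rightarrow> ('i, 'j) multipliers \<Rightarrow> nat" where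
  "quadratic_index P x w = num_neg_eigenvalues (restricted_hessian P x w)"

definition W_index ::
    "('n::finite, 'i, 'j) mpsc \<Rightarrow> real ^ 'n \<Rightarrow> ('i, 'j) multipliers \<Rightarrow> nat" where
  "W_index P x w = quadratic_index P x w + card (beta_idx P x)"

text \<open>Under LICQ the multipliers of a W-stationary point are unique on the index sets, so the
  existential quantifier is harmless there.\<close>

definition W_saddles :: "('n::finite, 'i, 'j) mpsc \<Rightarrow> (real ^ 'n) set" where
  "W_saddles P = {x. \<exists>w. W_stationary_with P x w \<and> W_index P x w = 1}"

end

theory Submission
  imports Defs
begin

text \<open>The inequality counts the edges of a connected graph whose vertices are the local minimizers. Write
\<open>M\<close> for the feasible set and \<open>f\<close> for the objective. Suppose that the points of \<open>M\<close> near \<open>z\<close> with a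
value below \<open>f z\<close> lie in at most two path components of \<open>{x \<in> M. f x < f z}\<close>. A path component of a
sublevel set contains a local minimizer, since \<open>M\<close> is compact and locally path connected; choosing one
in each of the two components gives an edge for \<open>z\<close>. A connected graph with \<open>r\<close> vertices has at least
\<open>r - 1\<close> edges, so it suffices that the edges of the W-saddles cross every cut of the vertex set
(\<open>card_le_Suc_card_if_cuts_crossed\<close>).

Given a cut into \<open>X\<close> and \<open>Y\<close>, let \<open>c\<close> be the lowest level at which a minimizer in \<open>X\<close> and one in \<open>Y\<close>
lie in the same component of \<open>{x \<in> M. f x \<le> c}\<close>. It exists because \<open>M\<close> is connected, and it is
attained because a decreasing intersection of compact connected sets is connected. If every point of
level \<open>c\<close> had lower points of one side only nearby, the closures of the two sides would be disjoint and
would disconnect that component. Hence some \<open>z\<close> of level \<open>c\<close> has lower points of both sides arbitrarily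
close to it, and if \<open>z\<close> is a W-saddle its edge crosses the cut (\<open>mountain_pass_crosses_cut\<close>).

What remains is local: unless \<open>z\<close> is W-stationary with W-index one, the lower points near \<open>z\<close> lie in one
path component, and for W-index one they lie in at most two. By LICQ the active constraints are part of
a coordinate system \<open>\<Psi>\<close> around \<open>z\<close> that is tangent to the identity and in which \<open>M\<close> is a product of a
linear space, half-lines and crosses (\<open>chart\<close>, \<open>straightening\<close>).

\<^item> If \<open>z\<close> is not W-stationary, some direction \<open>y\<close> preserves this cone and \<open>f\<close> decreases along \<open>y\<close> at a
  uniform rate. Pushing all lower points along \<open>y\<close> and then shrinking the cone joins them
  (\<open>nonstationary_lower_joined\<close>).

\<^item> If \<open>z\<close> is W-stationary, the Lagrange function has gradient zero at \<open>z\<close>, so \<open>f\<close> is a linear form in the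
  constraint coordinates plus a quadratic form in the tangent directions, up to a small error. By
  nondegeneracy the linear form has nonzero coefficients on the half-lines and crosses and the
  quadratic form can be made diagonal with nonzero entries. Every coordinate then either raises or
  lowers \<open>f\<close>, and shrinking the former while stretching the latter lowers \<open>f\<close> (\<open>flip_descent\<close>). This
  carries the lower points into the set of nonzero vectors having only lowering coordinates. A half-line
  contributes nothing to that set, a negative direction of the quadratic form contributes a line, and
  a cross contributes one ray on each of its two axes, again a line after folding. So the set is a
  copy of a punctured linear space whose dimension is the W-index. It is path connected unless the
  dimension is one, when it consists of two rays (\<open>lower_points_joined\<close>, \<open>lower_points_two_classes\<close>).

The direction used in the second case decreases \<open>f\<close> to first order at every nearby point of \<open>M\<close> other than
\<open>z\<close>, which is impossible at a W-stationary point. Likewise \<open>y\<close> rules out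
W-stationary points near a point that is not W-stationary. Hence W-stationary points do not accumulate
in \<open>M\<close> and, as \<open>M\<close> is compact, are finite in number.\<close>

section \<open>Connecting local minimizers through sublevel sets\<close>

text \<open>Grow a set \<open>X\<close> of vertices from a single one. While \<open>X \<noteq>
  V\<close>, an edge crossing the cut adds one vertex. It is a new edge, because both ends of the
  edges used before already lie in \<open>X\<close>.\<close>

lemma card_le_Suc_card_if_cuts_crossed:
  fixes V :: "'a set" and S :: "'b set" and a b :: "'b \<Rightarrow> 'a"
  assumes "finite V" and "finite S"
    and cross: "\<And>X. X \<subseteq> V \<Longrightarrow> X \<noteq> {} \<Longrightarrow> X \<noteq> V \<Longrightarrow>
      \<exists>s\<in>S. (a s \<in> X \<and> b s \<in> V - X) \<or> (b s \<in> X \<and> a s \<in> V - X)"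
  shows "card V \<le> card S + 1"
proof (cases "V = {}")
  case False
  have grow: "\<exists>X T. X \<subseteq> V \<and> card X = k + 1 \<and> T \<subseteq> S \<and> card T = k \<and> (\<forall>s\<in>T. a s \<in> X \<and> b s \<in> X)"
    if "k + 1 \<le> card V" for k
    using that
  proof (induction k)
    case 0
    obtain v where "v \<in> V" using False by blast
    then show ?case by (intro exI[of _ "{v}"] exI[of _ "{}"]) auto
  next
    case (Suc k)
    then obtain X T where XT: "X \<subseteq> V" "card X = k + 1" "T \<subseteq> S" "card T = k"
      "\<forall>s\<in>T. a s \<in> X \<and> b s \<in> X"
      by auto
    have "X \<noteq> {}" "X \<noteq> V" using XT Suc.prems by auto
    from cross[OF XT(1) this] obtain s v where s: "s \<in> S" "v \<in> V - X"
      "(a s \<in> X \<and> b s = v) \<or> (b s \<in> X \<and> a s = v)"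
      by blast
    have "s \<notin> T" using s XT(5) by auto
    moreover have "finite X" "finite T"
      using XT(1,3) assms(1,2) finite_subset by blast+
    ultimately have "card (insert v X) = Suc k + 1" "card (insert s T) = Suc k"
      using s XT by auto
    moreover have "\<forall>t\<in>insert s T. a t \<in> insert v X \<and> b t \<in> insert v X"
      using s XT(5) by auto
    ultimately show ?case
      using s XT by (intro exI[of _ "insert v X"] exI[of _ "insert s T"]) auto
  qed
  have "card V > 0" using False assms(1) by (simp add: card_gt_0_iff)
  then obtain T where "T \<subseteq> S" "card T = card V - 1"
    using grow[of "card V - 1"] by auto
  then show ?thesis using card_mono[OF assms(2), of T] by linarith
qed simp

definition local_mins :: "('a::metric_space \<Rightarrow> real) \<Rightarrow> 'a set \<Rightarrow> 'a set" where
  "local_mins f M = {x\<in>M. \<exists>e>0. \<forall>y\<in>M. dist y x < e \<longrightarrow> f x \<le> f y}"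

text \<open>The two possibilities for the lower points near \<open>z\<close>. The paths are confined
  to the sublevel set and may leave the neighbourhood of \<open>z\<close>.\<close>

definition lower_joined :: "('a::metric_space \<Rightarrow> real) \<Rightarrow> 'a set \<Rightarrow> 'a \<Rightarrow> bool" where
  "lower_joined f M z \<longleftrightarrow> (\<exists>d>0. \<forall>x\<in>M. \<forall>y\<in>M. dist x z < d \<longrightarrow> dist y z < d \<longrightarrow>
     f x < f z \<longrightarrow> f y < f z \<longrightarrow> path_component {y\<in>M. f y < f z} x y)"

definition lower_reached_from :: "('a::metric_space \<Rightarrow> real) \<Rightarrow> 'a set \<Rightarrow> 'a \<Rightarrow> 'a \<Rightarrow> 'a \<Rightarrow> bool" where
  "lower_reached_from f M z p q \<longleftrightarrow> (\<exists>d>0. \<forall>x\<in>M. dist x z < d \<longrightarrow> f x < f z \<longrightarrow>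
     path_component {y\<in>M. f y < f z} p x \<or> path_component {y\<in>M. f y < f z} q x)"

lemma openin_sublevel:
  fixes f :: "'a::topological_space \<Rightarrow> real"
  assumes "continuous_on M f"
  shows "openin (top_of_set M) {x\<in>M. f x < c}"
proof -
  have "{x\<in>M. f x < c} = M \<inter> f -` {..<c}" by auto
  then show ?thesis using continuous_openin_preimage_gen[OF assms, of "{..<c}"] by simp
qed

lemma openin_path_component_sublevel:
  fixes f :: "'a::real_normed_vector \<Rightarrow> real"
  assumes "locally path_connected M" "continuous_on M f"
  shows "openin (top_of_set M) (path_component_set {x\<in>M. f x < c} x)"
  using openin_path_component_locally_path_connected[OF locally_open_subset[OF assms(1) openin_sublevel[OF assms(2)]]]
    openin_trans openin_sublevel[OF assms(2)] by blast

text \<open>Minimize \<open>f\<close> over the closure of the path component. The minimizer has a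
  value below \<open>c\<close>, hence lies in the component itself, and the component is open in
  \<open>M\<close>.\<close>

lemma local_min_in_path_component_sublevel:
  fixes f :: "'a::real_normed_vector \<Rightarrow> real"
  assumes M: "compact M" "locally path_connected M" "continuous_on M f"
    and x: "x \<in> M" "f x < c"
  obtains m where "m \<in> local_mins f M" "path_component {y\<in>M. f y < c} x m"
proof -
  let ?L = "{y\<in>M. f y < c}"
  define K where "K = path_component_set ?L x"
  have xK: "x \<in> K" unfolding K_def using x by (simp add: path_component_refl)
  have KL: "K \<subseteq> ?L" unfolding K_def by (rule path_component_subset)
  have clM: "closure K \<subseteq> M"
    using KL by (intro closure_minimal compact_imp_closed[OF M(1)]) auto
  have "compact (closure K)"
    using clM M(1) by (metis closed_closure compact_Int_closed inf.absorb_iff2)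
  then obtain m where m: "m \<in> closure K" "\<And>y. y \<in> closure K \<Longrightarrow> f m \<le> f y"
    using continuous_attains_inf[of "closure K" f] xK closure_subset[of K]
      continuous_on_subset[OF M(3) clM] by blast
  have mL: "m \<in> ?L" using m(1) m(2)[of x] xK closure_subset[of K] x clM by fastforce
  define N where "N = path_component_set ?L m"
  have "openin (top_of_set M) N" unfolding N_def by (rule openin_path_component_sublevel[OF M(2,3)])
  moreover have mN: "m \<in> N" unfolding N_def using mL by (simp add: path_component_refl)
  ultimately obtain e where e: "e > 0" "ball m e \<inter> M \<subseteq> N"
    unfolding openin_contains_ball by blast
  obtain k where k: "k \<in> K" "dist k m < e"
    using m(1) e(1) unfolding closure_approachable by blast
  then have "k \<in> N" using e(2) KL by (auto simp: dist_commute)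
  then have "path_component ?L x m"
    using k(1) unfolding K_def N_def by (meson mem_Collect_eq path_component_sym path_component_trans)
  moreover have "m \<in> local_mins f M"
    unfolding local_mins_def
  proof (safe)
    show "m \<in> M" using mL by simp
    have "f m \<le> f y" if "y \<in> M" "dist y m < e" for y
    proof -
      have "y \<in> N" using that e(2) by (auto simp: dist_commute)
      then have "path_component ?L x y"
        using \<open>path_component ?L x m\<close> unfolding N_def by (meson mem_Collect_eq path_component_trans)
      then have "y \<in> K" unfolding K_def by simp
      then show ?thesis using m(2) closure_subset by blast
    qed
    then show "\<exists>e>0. \<forall>y\<in>M. dist y m < e \<longrightarrow> f m \<le> f y" using e(1) by blast
  qed
  ultimately show ?thesis using that by blast
qed

text \<open>The image of a path is compact, so \<open>f\<close> has a maximum below \<open>c\<close>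
  on it.\<close>

lemma path_component_sublevel_imp_lower_level:
  fixes f :: "'a::real_normed_vector \<Rightarrow> real"
  assumes "continuous_on M f" "path_component {y\<in>M. f y < c} p q"
  obtains c' where "c' < c" "connected_component {y\<in>M. f y \<le> c'} p q"
proof -
  obtain g where g: "path g" "path_image g \<subseteq> {y\<in>M. f y < c}" "pathstart g = p" "pathfinish g = q"
    using assms(2) unfolding path_component_def by blast
  have "continuous_on (path_image g) f"
    by (rule continuous_on_subset[OF assms(1)]) (use g in auto)
  then obtain w where w: "w \<in> path_image g" "\<And>y. y \<in> path_image g \<Longrightarrow> f y \<le> f w"
    using continuous_attains_sup[OF compact_path_image[OF g(1)]] by (metis path_image_nonempty)
  have "path_image g \<subseteq> {y\<in>M. f y \<le> f w}" using w g by auto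
  moreover have "p \<in> path_image g" "q \<in> path_image g" using g by auto
  ultimately have "connected_component {y\<in>M. f y \<le> f w} p q"
    unfolding connected_component_def using connected_path_image[OF g(1)] by blast
  then show ?thesis using that[of "f w"] w(1) g(2) by auto
qed

text \<open>The components of \<open>p\<close> at the levels above \<open>c\<close> are nested,
  compact and connected. Closed sublevel sets are treated with connected components because path
  components do not pass to this limit.\<close>

lemma connected_component_sublevel_limit:
  fixes f :: "'a::euclidean_space \<Rightarrow> real"
  assumes M: "compact M" "continuous_on M f"
    and conn: "\<And>n. connected_component {y\<in>M. f y \<le> c + 1 / real (Suc n)} p q"
  shows "connected_component {y\<in>M. f y \<le> c} p q"
proof -
  define K where "K n = connected_component_set {y\<in>M. f y \<le> c + 1 / real (Suc n)} p" for n
  have sub: "K n \<subseteq> {y\<in>M. f y \<le> c + 1 / real (Suc n)}" for n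
    unfolding K_def by (rule connected_component_subset)
  have "closed {y\<in>M. f y \<le> d}" for d
    using continuous_on_closed_Collect_le[OF M(2) continuous_on_const compact_imp_closed[OF M(1)]] .
  then have "closed (K n)" for n
    unfolding K_def by (intro closed_connected_component)
  then have "compact (K n)" for n
    using sub[of n] M(1) by (metis (no_types, lifting) Int_absorb1 compact_Int_closed mem_Collect_eq subset_iff)
  moreover have "connected (K n)" for n unfolding K_def by simp
  moreover have "K n \<subseteq> K m" if "m \<le> n" for m n
    unfolding K_def
  proof (rule connected_component_mono)
    have "1 / real (Suc n) \<le> 1 / real (Suc m)" using that by (simp add: frac_le)
    then show "{y\<in>M. f y \<le> c + 1 / real (Suc n)} \<subseteq> {y\<in>M. f y \<le> c + 1 / real (Suc m)}"
      by auto
  qed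
  ultimately have "connected (\<Inter> (range K))" by (rule connected_nest)
  moreover have "p \<in> K n" "q \<in> K n" for n
    using conn[of n] unfolding K_def
    by (auto intro: connected_component_refl dest: connected_component_in)
  moreover have "\<Inter> (range K) \<subseteq> {y\<in>M. f y \<le> c}"
  proof
    fix y assume y: "y \<in> \<Inter> (range K)"
    then have yn: "y \<in> M" "f y \<le> c + 1 / real (Suc n)" for n using sub[of n] by auto
    have "f y \<le> c"
    proof (rule field_le_epsilon)
      fix e :: real assume "e > 0"
      then obtain n where "1 / real (Suc n) < e" using nat_approx_posE by blast
      then show "f y \<le> c + e" using yn(2)[of n] by linarith
    qed
    then show "y \<in> {y\<in>M. f y \<le> c}" using yn by auto
  qed
  ultimately show ?thesis unfolding connected_component_def by blast
qed

text \<open>Just above the infimum of the connecting levels one of the finitely many pairs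
  \<open>(p, q)\<close> is connected at levels arbitrarily close to it, so the infimum is
  attained.\<close>

lemma lowest_connecting_level:
  fixes f :: "'a::euclidean_space \<Rightarrow> real"
  assumes M: "compact M" "connected M" "continuous_on M f"
    and XY: "finite X" "finite Y" "X \<noteq> {}" "Y \<noteq> {}" "X \<subseteq> M" "Y \<subseteq> M"
  obtains c p q where "p \<in> X" "q \<in> Y" "connected_component {y\<in>M. f y \<le> c} p q"
    "\<And>c' p q. c' < c \<Longrightarrow> p \<in> X \<Longrightarrow> q \<in> Y \<Longrightarrow> \<not> connected_component {y\<in>M. f y \<le> c'} p q"
proof -
  let ?C = "\<lambda>c. connected_component {y\<in>M. f y \<le> c}"
  define J where "J = {c. \<exists>p\<in>X. \<exists>q\<in>Y. ?C c p q}"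
  define c where "c = Inf J"
  have mono: "?C d p q" if "?C c p q" "c \<le> d" for c d p q
    using connected_component_of_subset[OF that(1), of "{y\<in>M. f y \<le> d}"] that(2) by force
  have "M \<noteq> {}" using XY by blast
  obtain w where w: "w \<in> M" "\<And>y. y \<in> M \<Longrightarrow> f y \<le> f w"
    using continuous_attains_sup[OF M(1) \<open>M \<noteq> {}\<close> M(3)] by blast
  obtain v where v: "v \<in> M" "\<And>y. y \<in> M \<Longrightarrow> f v \<le> f y"
    using continuous_attains_inf[OF M(1) \<open>M \<noteq> {}\<close> M(3)] by blast
  have "{y\<in>M. f y \<le> f w} = M" using w by auto
  moreover obtain p0 q0 where "p0 \<in> X" "q0 \<in> Y" using XY(3,4) by blast
  moreover have "connected_component M p0 q0"
    unfolding connected_component_def using M(2) XY(5,6) \<open>p0 \<in> X\<close> \<open>q0 \<in> Y\<close> by blast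
  ultimately have "f w \<in> J"
    unfolding J_def by auto
  have "f v \<le> d" if "d \<in> J" for d
    using that v unfolding J_def by (force dest!: connected_component_in)
  then have bdd: "bdd_below J" by (intro bdd_belowI)
  have above: "\<exists>p\<in>X. \<exists>q\<in>Y. ?C d p q" if "d > c" for d
  proof -
    have "J \<noteq> {}" "Inf J < d" using \<open>f w \<in> J\<close> that unfolding c_def by auto
    from cInf_lessD[OF this] obtain d' p q where "d' < d" "p \<in> X" "q \<in> Y" "?C d' p q"
      unfolding J_def by auto
    then show ?thesis using mono[of d' p q d] by auto
  qed
  have "\<exists>p\<in>X. \<exists>q\<in>Y. \<forall>n. ?C (c + 1 / real (Suc n)) p q"
  proof (rule ccontr)
    assume "\<not> ?thesis"
    then have "\<forall>z\<in>X\<times>Y. \<exists>n. \<not> ?C (c + 1 / real (Suc n)) (fst z) (snd z)" by auto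
    then obtain n where n: "\<And>z. z \<in> X\<times>Y \<Longrightarrow> \<not> ?C (c + 1 / real (Suc (n z))) (fst z) (snd z)"
      by metis
    define N where "N = Max (n ` (X\<times>Y))"
    obtain p q where pq: "p \<in> X" "q \<in> Y" "?C (c + 1 / real (Suc N)) p q"
      using above[of "c + 1 / real (Suc N)"] by auto
    have "n (p, q) \<le> N" unfolding N_def using XY pq by (intro Max_ge) auto
    then have "?C (c + 1 / real (Suc (n (p,q)))) p q"
      by (intro mono[OF pq(3)]) (simp add: frac_le)
    then show False using n[of "(p,q)"] pq by auto
  qed
  then obtain p q where pq: "p \<in> X" "q \<in> Y" "\<And>n. ?C (c + 1 / real (Suc n)) p q" by blast
  show ?thesis
  proof (rule that[OF pq(1,2)])
    show "?C c p q" using connected_component_sublevel_limit[OF M(1,3) pq(3)] .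
    show "\<not> ?C c' p q" if "c' < c" "p \<in> X" "q \<in> Y" for c' p q
      using that cInf_lower[OF _ bdd, of c'] unfolding c_def J_def by fastforce
  qed
qed

text \<open>If no edge of \<open>S\<close> crosses the cut, the lower points near any point of the
  lowest connecting level \<open>c\<close> belong to one side. Then the closures of the two sides of
  \<open>{y\<in>M. f y < c}\<close>, enlarged by the local minimizers of level \<open>c\<close>,
  separate \<open>{y\<in>M. f y \<le> c}\<close>.\<close>

lemma mountain_pass_crosses_cut:
  fixes f :: "'a::euclidean_space \<Rightarrow> real"
  assumes M: "compact M" "connected M" "locally path_connected M" "continuous_on M f"
    and fin: "finite (local_mins f M)"
    and reg: "\<And>z. z \<in> M - S \<Longrightarrow> lower_joined f M z"
    and ab: "\<And>z. z \<in> S \<Longrightarrow> a z \<in> local_mins f M \<and> b z \<in> local_mins f M \<and>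
        lower_reached_from f M z (a z) (b z)"
    and X: "X \<subseteq> local_mins f M" "X \<noteq> {}" "X \<noteq> local_mins f M"
  shows "\<exists>s\<in>S. (a s \<in> X \<and> b s \<in> local_mins f M - X) \<or> (b s \<in> X \<and> a s \<in> local_mins f M - X)"
proof (rule ccontr)
  assume contra: "\<not> ?thesis"
  define V where "V = local_mins f M"
  define Y where "Y = V - X"
  have VM: "V \<subseteq> M" unfolding V_def local_mins_def by auto
  have XY: "finite X" "finite Y" "X \<noteq> {}" "Y \<noteq> {}" "X \<subseteq> M" "Y \<subseteq> M" "X \<inter> Y = {}" "X \<union> Y = V"
    using X fin VM unfolding Y_def V_def by (auto intro: finite_subset)
  obtain c p q where c: "p \<in> X" "q \<in> Y" "connected_component {y\<in>M. f y \<le> c} p q"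
    "\<And>c' p q. c' < c \<Longrightarrow> p \<in> X \<Longrightarrow> q \<in> Y \<Longrightarrow> \<not> connected_component {y\<in>M. f y \<le> c'} p q"
    by (rule lowest_connecting_level[OF M(1,2,4) XY(1-6)]) (rule that)
  let ?L = "{y\<in>M. f y < c}"
  have nopath: "\<not> path_component ?L p q" if "p \<in> X" "q \<in> Y" for p q
  proof
    assume "path_component ?L p q"
    from path_component_sublevel_imp_lower_level[OF M(4) this] obtain c'
      where "c' < c" "connected_component {y\<in>M. f y \<le> c'} p q" .
    with c(4)[of c' p q] that show False by simp
  qed
  define U where "U Z = (\<Union>z\<in>Z. path_component_set ?L z)" for Z
  have UL: "U Z \<subseteq> ?L" for Z unfolding U_def using path_component_subset by blast
  have cover: "?L \<subseteq> U X \<union> U Y"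
  proof
    fix x assume "x \<in> ?L"
    then obtain m where "m \<in> V" "path_component ?L x m"
      using local_min_in_path_component_sublevel[OF M(1,3,4), of x c] unfolding V_def by blast
    then show "x \<in> U X \<union> U Y" unfolding U_def using XY(8) path_component_sym by fastforce
  qed
  have disj: "U X \<inter> U Y = {}"
  proof (rule ccontr)
    assume "\<not> ?thesis"
    then obtain x p q where pq: "p \<in> X" "q \<in> Y" "path_component ?L p x" "path_component ?L q x"
      unfolding U_def by auto
    show False
      using nopath[OF pq(1,2)] path_component_trans[OF pq(3) path_component_sym[OF pq(4)]] by simp
  qed
  have openU: "openin (top_of_set M) (U Z)" for Z
    unfolding U_def by (intro openin_Union) (auto simp: openin_path_component_sublevel[OF M(3,4)])
  have near: "\<exists>d>0. \<forall>y\<in>M. dist y x < d \<longrightarrow> y \<in> U Z" if "x \<in> U Z" for x Z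
  proof -
    have "\<forall>x\<in>U Z. \<exists>d>0. ball x d \<inter> M \<subseteq> U Z"
      using openU[of Z] by (simp add: openin_contains_ball)
    from bspec[OF this that] obtain d where "d > 0" "ball x d \<inter> M \<subseteq> U Z" by (elim exE conjE)
    then show ?thesis by (intro exI[of _ d]) (auto simp: dist_commute)
  qed
  \<comment> \<open>Near a point of level \<open>c\<close> the lower points all lie on one side of the cut.\<close>
  have oneside: "\<exists>d>0. (\<forall>y\<in>M. dist y z < d \<longrightarrow> f y < c \<longrightarrow> y \<in> U X) \<or>
                     (\<forall>y\<in>M. dist y z < d \<longrightarrow> f y < c \<longrightarrow> y \<in> U Y)"
    if z: "z \<in> M" "f z = c" for z
  proof (cases "z \<in> S")
    case True
    have "\<exists>d>0. \<forall>x\<in>M. dist x z < d \<longrightarrow> f x < c \<longrightarrow>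
        path_component ?L (a z) x \<or> path_component ?L (b z) x"
      using ab[OF True, THEN conjunct2, THEN conjunct2] unfolding lower_reached_from_def z(2) .
    then obtain d where d: "d > 0" "\<forall>x\<in>M. dist x z < d \<longrightarrow> f x < c \<longrightarrow>
        path_component ?L (a z) x \<or> path_component ?L (b z) x" by (elim exE conjE)
    have "(a z \<in> X \<and> b z \<in> X) \<or> (a z \<in> Y \<and> b z \<in> Y)"
      using contra True ab[OF True] unfolding Y_def V_def by blast
    then show ?thesis
    proof
      assume "a z \<in> X \<and> b z \<in> X"
      then have "\<forall>y\<in>M. dist y z < d \<longrightarrow> f y < c \<longrightarrow> y \<in> U X"
        using d(2) unfolding U_def by auto
      then show ?thesis using d(1) by blast
    next
      assume "a z \<in> Y \<and> b z \<in> Y"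
      then have "\<forall>y\<in>M. dist y z < d \<longrightarrow> f y < c \<longrightarrow> y \<in> U Y"
        using d(2) unfolding U_def by auto
      then show ?thesis using d(1) by blast
    qed
  next
    case False
    then have "\<exists>d>0. \<forall>x\<in>M. \<forall>y\<in>M. dist x z < d \<longrightarrow> dist y z < d \<longrightarrow>
        f x < c \<longrightarrow> f y < c \<longrightarrow> path_component ?L x y"
      using reg[of z] z(1) unfolding lower_joined_def z(2) by simp
    then obtain d where d: "d > 0" "\<forall>x\<in>M. \<forall>y\<in>M. dist x z < d \<longrightarrow> dist y z < d \<longrightarrow>
        f x < c \<longrightarrow> f y < c \<longrightarrow> path_component ?L x y" by (elim exE conjE)
    have trans: "y \<in> U Z" if "x \<in> U Z" "path_component ?L x y" for x y Z
      using that unfolding U_def by (auto intro: path_component_trans)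
    show ?thesis
    proof (cases "\<exists>x\<in>M. dist x z < d \<and> f x < c \<and> x \<in> U X")
      case True
      then obtain x where x: "x \<in> M" "dist x z < d" "f x < c" "x \<in> U X" by blast
      have "\<forall>y\<in>M. dist y z < d \<longrightarrow> f y < c \<longrightarrow> y \<in> U X"
        using d(2) x trans[OF x(4)] by simp
      then show ?thesis using d(1) by blast
    next
      case False
      then have "\<forall>y\<in>M. dist y z < d \<longrightarrow> f y < c \<longrightarrow> y \<in> U Y" using cover by auto
      then show ?thesis using d(1) by blast
    qed
  qed
  \<comment> \<open>A local minimizer of level \<open>c\<close> is in neither closure and is added to its own side of the cut.\<close>
  define D where "D = {z\<in>V. f z = c}"
  have notD: "z \<notin> D" if zU: "z \<in> closure (U Z)" for z Z
  proof
    assume "z \<in> D"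
    then obtain e where "e > 0" "\<forall>y\<in>M. dist y z < e \<longrightarrow> c \<le> f y"
      unfolding D_def V_def local_mins_def by auto
    moreover obtain y where "y \<in> U Z" "dist y z < e"
      using zU \<open>e > 0\<close> unfolding closure_approachable by blast
    ultimately show False using UL by force
  qed
  have clsub: "closure (U Z) \<subseteq> {y\<in>M. f y \<le> c}" for Z
  proof (rule closure_minimal)
    show "U Z \<subseteq> {y\<in>M. f y \<le> c}" using UL[of Z] by auto
    show "closed {y\<in>M. f y \<le> c}"
      using continuous_on_closed_Collect_le[OF M(4) continuous_on_const compact_imp_closed[OF M(1)]] .
  qed
  have meet: "\<exists>y\<in>U Z. dist y z < d" if "z \<in> closure (U Z)" "d > 0" for z Z d
    using that unfolding closure_approachable by blast
  have cldisj: "closure (U X) \<inter> closure (U Y) = {}"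
  proof (rule ccontr)
    assume "\<not> ?thesis"
    then obtain z where z: "z \<in> closure (U X)" "z \<in> closure (U Y)" by blast
    have zM: "z \<in> M" "f z \<le> c" using clsub z by auto
    have "\<exists>d>0. (\<forall>y\<in>M. dist y z < d \<longrightarrow> f y < c \<longrightarrow> y \<in> U X) \<or>
               (\<forall>y\<in>M. dist y z < d \<longrightarrow> f y < c \<longrightarrow> y \<in> U Y)"
    proof (cases "f z < c")
      case True
      then have "z \<in> U X \<or> z \<in> U Y" using cover zM by auto
      then show ?thesis using near by metis
    qed (use oneside zM in force)
    then obtain d where d: "d > 0" "(\<forall>y\<in>M. dist y z < d \<longrightarrow> f y < c \<longrightarrow> y \<in> U X) \<or>
                     (\<forall>y\<in>M. dist y z < d \<longrightarrow> f y < c \<longrightarrow> y \<in> U Y)" by blast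
    obtain x y where xy: "x \<in> U X" "dist x z < d" "y \<in> U Y" "dist y z < d"
      using meet z d(1) by metis
    have "x \<in> ?L" "y \<in> ?L" using xy UL by blast+
    then show False using d(2) xy disj by blast
  qed
  define A where "A = closure (U X) \<union> (D \<inter> X)"
  define B where "B = closure (U Y) \<union> (D \<inter> Y)"
  have closedAB: "closed A" "closed B"
    unfolding A_def B_def
    by (intro closed_Un closed_closure finite_imp_closed finite_Int disjI2 XY(1,2))+
  have coverAB: "{y\<in>M. f y \<le> c} \<subseteq> A \<union> B"
  proof
    fix z assume z: "z \<in> {y\<in>M. f y \<le> c}"
    show "z \<in> A \<union> B"
    proof (cases "f z < c")
      case True
      then show ?thesis using cover z closure_subset unfolding A_def B_def by blast
    next
      case False
      then have fz: "f z = c" using z by auto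
      show ?thesis
      proof (cases "z \<in> V")
        case True
        then show ?thesis using fz XY(8) unfolding A_def B_def D_def by auto
      next
        case False
        then have "\<exists>y\<in>M. dist y z < e \<and> f y < c" if "e > 0" for e
          using z fz that unfolding V_def local_mins_def by force
        then have "\<exists>y\<in>U X \<union> U Y. dist y z < e" if "e > 0" for e
          using that cover by blast
        then have "z \<in> closure (U X \<union> U Y)" unfolding closure_approachable by blast
        then show ?thesis unfolding A_def B_def by auto
      qed
    qed
  qed
  have disjAB: "A \<inter> B = {}"
    unfolding A_def B_def using cldisj notD XY(7) by blast
  have self: "z \<in> closure (U Z) \<or> z \<in> D" if "z \<in> Z" "z \<in> V" "f z \<le> c" for z Z
  proof (cases "f z < c")
    case True
    then have "z \<in> U Z" unfolding U_def using that VM by (auto intro!: bexI[of _ z] path_component_refl)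
    then show ?thesis using closure_subset by blast
  qed (use that in \<open>auto simp: D_def\<close>)
  obtain K where K: "connected K" "K \<subseteq> {y\<in>M. f y \<le> c}" "p \<in> K" "q \<in> K"
    using c(3) unfolding connected_component_def by blast
  have "p \<in> A" unfolding A_def using self[of p X] c(1) K XY(8) by auto
  moreover have "q \<in> B" unfolding B_def using self[of q Y] c(2) K XY(8) by auto
  ultimately show False
    using K closedAB coverAB disjAB unfolding connected_closed by blast
qed

text \<open>The edge of \<open>z \<in> S\<close> joins local minimizers of the two path components
  that its lower points meet.\<close>

lemma mountain_pass_count:
  fixes f :: "'a::euclidean_space \<Rightarrow> real"
  assumes M: "compact M" "connected M" "locally path_connected M" "continuous_on M f"
    and fin: "finite (local_mins f M)" "finite S"
    and reg: "\<And>z. z \<in> M - S \<Longrightarrow> lower_joined f M z"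
    and sad: "\<And>z. z \<in> S \<Longrightarrow> \<exists>p q. p \<in> M \<and> f p < f z \<and> q \<in> M \<and> f q < f z \<and>
        lower_reached_from f M z p q"
  shows "card (local_mins f M) \<le> card S + 1"
proof -
  define Q where "Q z v w \<longleftrightarrow> v \<in> local_mins f M \<and> w \<in> local_mins f M \<and> lower_reached_from f M z v w" for z v w
  have "\<exists>v w. Q z v w" if z: "z \<in> S" for z
  proof -
    obtain p q d where pq: "p \<in> M" "f p < f z" "q \<in> M" "f q < f z" and d: "d > 0"
      "\<And>x. x \<in> M \<Longrightarrow> dist x z < d \<Longrightarrow> f x < f z \<Longrightarrow>
         path_component {y\<in>M. f y < f z} p x \<or> path_component {y\<in>M. f y < f z} q x"
      using sad[OF z] unfolding lower_reached_from_def by blast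
    obtain v where v: "v \<in> local_mins f M" "path_component {y\<in>M. f y < f z} p v"
      using local_min_in_path_component_sublevel[OF M(1,3,4) pq(1,2)] by blast
    obtain w where w: "w \<in> local_mins f M" "path_component {y\<in>M. f y < f z} q w"
      using local_min_in_path_component_sublevel[OF M(1,3,4) pq(3,4)] by blast
    show ?thesis
      unfolding Q_def lower_reached_from_def using v w d by (meson path_component_sym path_component_trans)
  qed
  then obtain a b where "\<And>z. z \<in> S \<Longrightarrow> Q z (a z) (b z)" by metis
  note ab = this[unfolded Q_def]
  show ?thesis
  proof (rule card_le_Suc_card_if_cuts_crossed[OF fin, of a b])
    fix X assume X: "X \<subseteq> local_mins f M" "X \<noteq> {}" "X \<noteq> local_mins f M"
    show "\<exists>s\<in>S. (a s \<in> X \<and> b s \<in> local_mins f M - X) \<or> (b s \<in> X \<and> a s \<in> local_mins f M - X)"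
      by (rule mountain_pass_crosses_cut[where S = S and a = a and b = b]) (fact M fin(1) reg ab X)+
  qed
qed

section \<open>Inertia of a symmetric form on a subspace\<close>

text \<open>The spectral theorem for the symmetric form of \<open>h\<close> restricted to
  \<open>S\<close>; the operator \<open>h\<close> itself may leave \<open>S\<close>. A maximizer
  \<open>x\<close> of the form on the unit sphere of \<open>S\<close> satisfies \<open>inner (h x) y
  = 0\<close> for all \<open>y \<in> S\<close> orthogonal to \<open>x\<close>, and the induction
  continues in the orthogonal complement of \<open>x\<close> in \<open>S\<close>.\<close>

lemma orthonormal_diagonalization:
  fixes h :: "'a::euclidean_space \<Rightarrow> 'a"
  assumes h: "linear h" "\<And>x y. inner (h x) y = inner x (h y)"
    and S: "subspace S"
  shows "\<exists>B\<subseteq>S. pairwise Linear_Algebra.orthogonal B \<and> (\<forall>b\<in>B. norm b = 1) \<and> span B = S \<and>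
           (\<forall>b\<in>B. \<forall>c\<in>B. b \<noteq> c \<longrightarrow> inner (h b) c = 0)"
  using S
proof (induction "dim S" arbitrary: S rule: less_induct)
  case less
  show ?case
  proof (cases "S \<subseteq> {0}")
    case True
    then have "S = {0}" using less.prems subspace_0 by blast
    then show ?thesis by (intro exI[of _ "{}"]) simp
  next
    case False
    then obtain w where w: "w \<in> S" "w \<noteq> 0" by blast
    define K where "K = S \<inter> sphere 0 1"
    have "compact K" unfolding K_def
      using closed_subspace[OF less.prems] by (simp add: closed_Int_compact)
    moreover have "w /\<^sub>R norm w \<in> K"
      unfolding K_def using w less.prems by (simp add: subspace_scale)
    then have "K \<noteq> {}" by blast
    moreover have "continuous_on K (\<lambda>x. inner (h x) x)"
      using h(1) by (intro continuous_intros linear_continuous_on linear_linear[THEN iffD2])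
    ultimately have "\<exists>x\<in>K. \<forall>y\<in>K. inner (h y) y \<le> inner (h x) x"
      by (rule continuous_attains_sup)
    then obtain x where x: "x \<in> K" "\<And>y. y \<in> K \<Longrightarrow> inner (h y) y \<le> inner (h x) x" by blast
    have xS: "x \<in> S" "norm x = 1" "inner x x = 1"
      using x(1) unfolding K_def by (auto simp: dot_square_norm)
    define l where "l = inner (h x) x"
    have hom: "inner (h y) y \<le> l * (norm y)\<^sup>2" if "y \<in> S" for y
    proof (cases "y = 0")
      case True
      then show ?thesis by simp
    next
      case False
      have "y /\<^sub>R norm y \<in> K" unfolding K_def using that False less.prems by (simp add: subspace_scale)
      from x(2)[OF this] have "inner (h y) y / (norm y)\<^sup>2 \<le> l"
        unfolding l_def using h(1) by (simp add: linear_scale power2_eq_square field_simps)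
      then show ?thesis using False by (simp add: field_simps)
    qed
    have ortho: "inner (h x) y = 0" if y: "y \<in> S" "inner x y = 0" for y
    proof (rule ccontr)
      define a where "a = inner (h x) y"
      define C where "C = l * (norm y)\<^sup>2 - inner (h y) y"
      \<comment> \<open>For this \<open>t\<close> the linear term \<open>2 * t * a\<close> exceeds the quadratic term \<open>t\<^sup>2 * C\<close>.\<close>
      define t where "t = a / (\<bar>C\<bar> + 1)"
      assume "inner (h x) y \<noteq> 0"
      then have a: "a \<noteq> 0" unfolding a_def .
      have "inner (h y) x = a" unfolding a_def using h(2)[of y x] by (simp add: inner_commute)
      then have "inner (h (x + t *\<^sub>R y)) (x + t *\<^sub>R y) = l + 2 * t * a + t\<^sup>2 * inner (h y) y"
        using h(1) unfolding l_def a_def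
        by (simp add: linear_add linear_scale inner_add_left inner_add_right power2_eq_square algebra_simps)
      moreover have "(norm (x + t *\<^sub>R y))\<^sup>2 = 1 + t\<^sup>2 * (norm y)\<^sup>2"
        unfolding power2_norm_eq_inner using y(2) xS(3)
        by (simp add: inner_add_left inner_add_right inner_commute power2_eq_square)
      moreover have "x + t *\<^sub>R y \<in> S" using less.prems xS y by (simp add: subspace_add subspace_scale)
      ultimately have "l + 2 * t * a + t\<^sup>2 * inner (h y) y \<le> l * (1 + t\<^sup>2 * (norm y)\<^sup>2)"
        using hom by metis
      then have le: "2 * t * a \<le> t\<^sup>2 * C" unfolding C_def by (simp add: algebra_simps)
      have pos: "\<bar>C\<bar> + 1 > 0" by simp
      have "t * (\<bar>C\<bar> + 1) = a" unfolding t_def using pos by simp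
      then have "t * a = t\<^sup>2 * (\<bar>C\<bar> + 1)" by (metis mult.assoc power2_eq_square)
      moreover have "t\<^sup>2 > 0" unfolding t_def using a pos by simp
      moreover have "t\<^sup>2 * C \<le> t\<^sup>2 * (\<bar>C\<bar> + 1)" by (intro mult_left_mono) auto
      moreover have "0 < t\<^sup>2 * (\<bar>C\<bar> + 1)" using pos \<open>t\<^sup>2 > 0\<close> by simp
      ultimately show False using le by linarith
    qed
    define S' where "S' = {y\<in>S. inner x y = 0}"
    have S': "subspace S'" unfolding S'_def using less.prems
      by (auto simp: subspace_def inner_add_right)
    have "S' \<subset> S" unfolding S'_def using xS by force
    then have "dim S' < dim S"
      using dim_psubset[of S' S] S' less.prems by (metis span_eq_iff)
    from less.hyps[OF this S'] obtain B where B: "B \<subseteq> S'" "pairwise Linear_Algebra.orthogonal B"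
      "\<forall>b\<in>B. norm b = 1" "span B = S'" "\<forall>b\<in>B. \<forall>c\<in>B. b \<noteq> c \<longrightarrow> inner (h b) c = 0"
      by blast
    have xB: "inner x b = 0" "inner (h x) b = 0" "inner (h b) x = 0" if "b \<in> B" for b
    proof -
      have b: "b \<in> S" "inner x b = 0" using that B(1) unfolding S'_def by auto
      show "inner x b = 0" "inner (h x) b = 0" using b ortho by auto
      then show "inner (h b) x = 0" using h(2)[of b x] by (simp add: inner_commute)
    qed
    have "span (insert x B) = S"
    proof
      show "span (insert x B) \<subseteq> S"
        using xS B(1) less.prems unfolding S'_def by (intro span_minimal) auto
      show "S \<subseteq> span (insert x B)"
      proof
        fix y assume y: "y \<in> S"
        have "y - inner x y *\<^sub>R x \<in> S'"
          unfolding S'_def using y xS less.prems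
          by (simp add: subspace_diff subspace_scale inner_diff_right)
        then have "y - inner x y *\<^sub>R x \<in> span B" using B(4) by simp
        then show "y \<in> span (insert x B)" unfolding span_insert by blast
      qed
    qed
    moreover have "pairwise Linear_Algebra.orthogonal (insert x B)"
      using B(2) xB(1) by (auto simp: pairwise_insert Linear_Algebra.orthogonal_def inner_commute)
    ultimately show ?thesis
      using B xB xS unfolding S'_def by (intro exI[of _ "insert x B"]) auto
  qed
qed

lemma num_neg_eigenvalues_of_factorization:
  fixes A :: "real mat"
  assumes A: "A \<in> carrier_mat p p"
    and cp: "char_poly A = (\<Prod>k\<leftarrow>[0..<p]. [:- d k, 1:])"
  shows "num_neg_eigenvalues A = card {k. k < p \<and> d k < 0}"
proof -
  have "poly (char_poly A) e = (\<Prod>k\<leftarrow>[0..<p]. e - d k)" for e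
    unfolding cp poly_prod_list by (simp add: o_def)
  then have ev: "eigenvalue A e \<longleftrightarrow> e \<in> d ` {..<p}" for e
    unfolding eigenvalue_root_char_poly[OF A] by (auto simp: prod_list_zero_iff)
  have ord: "Polynomial.order e (char_poly A) = card {k. k < p \<and> d k = e}" for e
  proof -
    have "Polynomial.order e (char_poly A) = (\<Sum>k\<leftarrow>[0..<p]. Polynomial.order e [:- d k, 1:])"
      unfolding cp by (subst order_prod_list) (auto simp: o_def)
    also have "\<dots> = (\<Sum>k\<leftarrow>[0..<p]. if d k = e then 1 else 0)"
      by (intro arg_cong[where f = sum_list] map_cong refl) (simp add: order_linear')
    also have "\<dots> = (\<Sum>k\<in>{0..<p}. if d k = e then 1 else 0)"
      by (simp add: sum_list_distinct_conv_sum_set)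
    also have "\<dots> = card {k. k < p \<and> d k = e}"
      by (subst sum.inter_filter[symmetric]) (auto intro!: arg_cong[where f = card])
    finally show ?thesis .
  qed
  have "{k. k < p \<and> d k < 0} = (\<Union>e\<in>{e. eigenvalue A e \<and> e < 0}. {k. k < p \<and> d k = e})"
    unfolding ev by auto
  also have "card \<dots> = (\<Sum>e | eigenvalue A e \<and> e < 0. card {k. k < p \<and> d k = e})"
  proof (rule card_UN_disjoint)
    have "{e. eigenvalue A e \<and> e < 0} \<subseteq> d ` {..<p}" using ev by auto
    then show "finite {e. eigenvalue A e \<and> e < 0}" by (rule finite_subset) simp
  qed auto
  finally show ?thesis unfolding num_neg_eigenvalues_def ord by simp
qed

text \<open>Matrix entries are indexed by numbers, so orthonormal bases are listed.\<close>

lemma orthonormal_list: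
  assumes "subspace T" "pairwise Linear_Algebra.orthogonal B" "\<forall>b\<in>B. norm b = 1" "span B = T"
  obtains bs where "set bs = B" "distinct bs" "length bs = dim T"
    "\<And>i j. i < dim T \<Longrightarrow> j < dim T \<Longrightarrow> inner (bs ! i) (bs ! j) = (if i = j then 1 else 0)"
    "\<And>x. x \<in> T \<Longrightarrow> (\<Sum>i<dim T. inner (bs ! i) x *\<^sub>R bs ! i) = (x::'a::euclidean_space)"
proof -
  have "0 \<notin> B" using assms(3) by force
  then have ind: "independent B" using assms(2) pairwise_orthogonal_independent by blast
  then have fin: "finite B" by (rule independent_imp_finite)
  obtain bs where bs: "set bs = B" "distinct bs" using finite_distinct_list[OF fin] by blast
  have len: "length bs = dim T"
    using distinct_card[OF bs(2)] bs(1) dim_eq_card_independent[OF ind] assms(4) by (metis dim_span)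
  have orth: "inner (bs ! i) (bs ! j) = (if i = j then 1 else 0)" if "i < dim T" "j < dim T" for i j
  proof (cases "i = j")
    case True
    have "bs ! j \<in> B" using bs(1) that len nth_mem by metis
    then have "norm (bs ! j) = 1" using assms(3) by blast
    then show ?thesis using True by (simp add: norm_eq_1)
  next
    case False
    then have "bs ! i \<noteq> bs ! j" "bs ! i \<in> B" "bs ! j \<in> B"
      using bs that len by (auto simp: nth_eq_iff_index_eq)
    then show ?thesis using assms(2) False by (auto simp: pairwise_def Linear_Algebra.orthogonal_def)
  qed
  have lin: "linear (\<lambda>x. (\<Sum>i<dim T. inner (bs ! i) x *\<^sub>R bs ! i))"
    by (auto intro!: linearI simp: inner_add_right scaleR_add_left sum.distrib scaleR_sum_right)
  have "(\<Sum>i<dim T. inner (bs ! i) x *\<^sub>R bs ! i) = id x" if "x \<in> T" for x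
  proof (rule linear_eq_on_span[OF lin linear_id])
    show "x \<in> span B" using that assms(4) by simp
    fix b assume "b \<in> B"
    then obtain j where j: "j < dim T" "b = bs ! j" using bs(1) len by (metis in_set_conv_nth)
    have "(\<Sum>i<dim T. inner (bs ! i) b *\<^sub>R bs ! i) = (\<Sum>i<dim T. if i = j then bs ! j else 0)"
      unfolding j(2) by (intro sum.cong refl) (use orth j(1) in auto)
    then show "(\<Sum>i<dim T. inner (bs ! i) b *\<^sub>R bs ! i) = id b" using j by simp
  qed
  then show ?thesis using that[OF bs len orth] by simp
qed

text \<open>The basis \<open>vs\<close> behind \<open>restrict_mat H T\<close> is arbitrary, so the
  eigenvalues of this matrix are not those of \<open>H\<close> compressed to \<open>T\<close>. Let
  \<open>J\<close> map an orthonormal basis \<open>es\<close> of \<open>T\<close> to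
  \<open>vs\<close>. In the basis \<open>es\<close> the matrix represents the symmetric operator
  \<open>J' H J\<close>, where \<open>J'\<close> is the adjoint of \<open>J\<close>. An orthonormal
  basis diagonalizing that operator has the eigenvalues on the diagonal, and its image under
  \<open>J\<close> is an \<open>H\<close>-orthogonal basis of \<open>T\<close> with the same values
  of the form.\<close>

lemma restrict_mat_signature:
  fixes H :: "real ^ 'n ^ ('n::finite)"
  assumes sym: "\<And>x y. inner x (H *v y) = inner (H *v x) y"
    and T: "subspace T"
    and inv: "invertible_mat (restrict_mat H T)"
  obtains B where "finite B" "independent B" "span B = T"
    "\<And>b c. b \<in> B \<Longrightarrow> c \<in> B \<Longrightarrow> b \<noteq> c \<Longrightarrow> inner b (H *v c) = 0"
    "\<And>b. b \<in> B \<Longrightarrow> inner b (H *v b) \<noteq> 0"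
    "num_neg_eigenvalues (restrict_mat H T) = card {b\<in>B. inner b (H *v b) < 0}"
proof -
  define vs where "vs = (SOME vs. basis_list T vs)"
  have vs: "distinct vs" "independent (set vs)" "span (set vs) = T"
    using someI_ex[OF basis_list_exists[OF T]] unfolding vs_def basis_list_def by auto
  define p where "p = dim T"
  have lenv: "length vs = p"
    using distinct_card[OF vs(1)] dim_eq_card_independent[OF vs(2)] vs(3)
    unfolding p_def by (metis dim_span)
  define A where "A = restrict_mat H T"
  have A: "A = Matrix.mat p p (\<lambda>(a, b). inner (vs ! a) (H *v (vs ! b)))"
    unfolding A_def restrict_mat_def congruence_mat_def vs_def[symmetric] lenv ..
  have Ac: "A \<in> carrier_mat p p" unfolding A by simp
  have vT: "vs ! i \<in> T" if "i < p" for i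
    using that lenv vs(3) span_base[of "vs ! i" "set vs"] by simp
  obtain E where E: "E \<subseteq> T" "pairwise Linear_Algebra.orthogonal E" "\<forall>b\<in>E. norm b = 1" "span E = T"
    using orthonormal_diagonalization[of "\<lambda>_. 0" T] T by (auto simp: linear_zero)
  obtain es where es: "set es = E" "distinct es" "length es = p"
    "\<And>i j. i < p \<Longrightarrow> j < p \<Longrightarrow> inner (es ! i) (es ! j) = (if i = j then 1 else 0)"
    "\<And>x. x \<in> T \<Longrightarrow> (\<Sum>i<p. inner (es ! i) x *\<^sub>R es ! i) = x"
    unfolding p_def by (rule orthonormal_list[OF T E(2-4)]) (rule that[unfolded p_def])
  define J where "J x = (\<Sum>i<p. inner (es ! i) x *\<^sub>R vs ! i)" for x
  define J' where "J' y = (\<Sum>i<p. inner (vs ! i) y *\<^sub>R es ! i)" for y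
  define h where "h x = J' (H *v J x)" for x
  have lJ: "linear J" "linear J'"
    unfolding J_def[abs_def] J'_def[abs_def]
    by (auto intro!: linearI simp: inner_add_right scaleR_add_left sum.distrib scaleR_sum_right)
  have adj: "inner (J' y) x = inner y (J x)" for x y
    unfolding J_def J'_def inner_sum_left inner_sum_right
    by (intro sum.cong refl) (simp add: inner_commute)
  have hh: "inner (h x) y = inner (J x) (H *v J y)" for x y
    unfolding h_def adj using sym by (metis inner_commute)
  have "linear h" unfolding h_def[abs_def]
    using linear_compose[OF linear_compose[OF lJ(1) matrix_vector_mul_linear[of H]] lJ(2)] by (simp add: o_def)
  moreover have "inner (h x) y = inner x (h y)" for x y
    using hh sym by (metis inner_commute)
  ultimately have "\<exists>Q\<subseteq>T. pairwise Linear_Algebra.orthogonal Q \<and> (\<forall>b\<in>Q. norm b = 1) \<and> span Q = T \<and>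
      (\<forall>b\<in>Q. \<forall>c\<in>Q. b \<noteq> c \<longrightarrow> inner (h b) c = 0)"
    using orthonormal_diagonalization[of h T] T by simp
  then obtain Q where Q: "Q \<subseteq> T" "pairwise Linear_Algebra.orthogonal Q" "\<forall>b\<in>Q. norm b = 1" "span Q = T"
    and diag: "\<forall>b\<in>Q. \<forall>c\<in>Q. b \<noteq> c \<longrightarrow> inner (h b) c = 0"
    by (elim exE conjE)
  obtain qs where qs: "set qs = Q" "distinct qs" "length qs = p"
    "\<And>i j. i < p \<Longrightarrow> j < p \<Longrightarrow> inner (qs ! i) (qs ! j) = (if i = j then 1 else 0)"
    unfolding p_def by (rule orthonormal_list[OF T Q(2-4)]) (rule that[unfolded p_def])
  have qT: "qs ! k \<in> T" if "k < p" for k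
    using that qs Q(1) by (metis nth_mem subsetD)
  define d where "d k = inner (h (qs ! k)) (qs ! k)" for k
  have hd: "inner (h (qs ! k)) (qs ! l) = (if k = l then d k else 0)" if "k < p" "l < p" for k l
    using diag qs that unfolding d_def by (metis nth_eq_iff_index_eq nth_mem)
  \<comment> \<open>\<open>U\<close> is the orthogonal change of coordinates from \<open>qs\<close> to \<open>es\<close>.\<close>
  define U where "U = Matrix.mat p p (\<lambda>(i, k). inner (es ! i) (qs ! k))"
  define D where "D = Matrix.mat p p (\<lambda>(k, l). if k = l then d k else 0)"
  have Uc: "U \<in> carrier_mat p p" "transpose_mat U \<in> carrier_mat p p" "D \<in> carrier_mat p p"
    unfolding U_def D_def by auto
  have UU: "transpose_mat U * U = 1\<^sub>m p"
  proof (rule eq_matI)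
    fix k l assume kl: "k < dim_row (1\<^sub>m p)" "l < dim_col (1\<^sub>m p)"
    have "(transpose_mat U * U) $$ (k, l) = (\<Sum>i<p. inner (es ! i) (qs ! k) * inner (es ! i) (qs ! l))"
      using kl unfolding U_def by (simp add: scalar_prod_def atLeast0LessThan)
    also have "\<dots> = inner (\<Sum>i<p. inner (es ! i) (qs ! k) *\<^sub>R es ! i) (qs ! l)"
      by (simp add: inner_sum_left)
    also have "\<dots> = (1\<^sub>m p) $$ (k, l)" using kl qT es(5) qs(4) by simp
    finally show "(transpose_mat U * U) $$ (k, l) = (1\<^sub>m p) $$ (k, l)" .
  qed (auto simp: U_def)
  have UU': "U * transpose_mat U = 1\<^sub>m p"
    using mat_mult_left_right_inverse[OF Uc(2,1) UU] .
  have Jq: "J (qs ! k) = (\<Sum>i<p. U $$ (i,k) *\<^sub>R vs ! i)" if "k < p" for k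
    unfolding J_def U_def using that by simp
  have "transpose_mat U * A * U = D"
  proof (rule eq_matI)
    fix k l assume "k < dim_row D" "l < dim_col D"
    then have kl: "k < p" "l < p" unfolding D_def by auto
    have HJ: "H *v J (qs ! l) = (\<Sum>j<p. U $$ (j,l) *\<^sub>R (H *v vs ! j))"
      unfolding Jq[OF kl(2)]
      by (simp add: linear_sum[OF matrix_vector_mul_linear] linear_scale[OF matrix_vector_mul_linear])
    have "(transpose_mat U * A * U) $$ (k, l)
        = (\<Sum>i<p. U $$ (i,k) * (\<Sum>j<p. A $$ (i,j) * U $$ (j,l)))"
      using kl Uc Ac by (simp add: scalar_prod_def atLeast0LessThan)
    also have "\<dots> = (\<Sum>i<p. \<Sum>j<p. U $$ (i,k) * (U $$ (j,l) * inner (vs ! i) (H *v (vs ! j))))"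
      unfolding A sum_distrib_left by (intro sum.cong refl) simp
    also have "\<dots> = inner (J (qs ! k)) (H *v J (qs ! l))"
      unfolding HJ Jq[OF kl(1)] inner_sum_left
      by (intro sum.cong refl) (simp add: inner_sum_right sum_distrib_left mult.left_commute)
    also have "\<dots> = D $$ (k, l)" using hd[OF kl] kl unfolding hh D_def by simp
    finally show "(transpose_mat U * A * U) $$ (k, l) = D $$ (k, l)" .
  qed (use Uc Ac in \<open>auto simp: D_def\<close>)
  then have "similar_mat_wit D A (transpose_mat U) U"
    using UU UU' Uc Ac by (intro similar_mat_witI[where n = p]) auto
  then have sim: "similar_mat A D"
    by (metis similar_mat_def similar_mat_sym)
  have ut: "upper_triangular D" unfolding D_def by auto
  have dm: "diag_mat D = map d [0..<p]" unfolding diag_mat_def D_def by auto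
  have cp: "char_poly A = (\<Prod>k\<leftarrow>[0..<p]. [:- d k, 1:])"
    unfolding char_poly_similar[OF sim] char_poly_upper_triangular[OF Uc(3) ut] dm by (simp add: o_def)
  have d0: "d k \<noteq> 0" if "k < p" for k
  proof
    assume "d k = 0"
    then have "Determinant.det D = 0"
      unfolding det_upper_triangular[OF ut Uc(3)] dm using that by (auto simp: prod_list_zero_iff)
    then have "Determinant.det A = 0" using det_similar[OF sim] by simp
    moreover obtain C where C: "inverts_mat A C" "inverts_mat C A"
      using inv unfolding A_def invertible_mat_def by blast
    have "C \<in> carrier_mat p p"
      using C Ac unfolding inverts_mat_def
      by (metis carrier_matD(1) carrier_matD(2) carrier_mat_triv index_mult_mat(2) index_mult_mat(3) index_one_mat(2) index_one_mat(3))
    then have "Determinant.det A * Determinant.det C = 1"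
      using C(1) Ac det_mult[OF Ac, of C] unfolding inverts_mat_def by simp
    ultimately show False by simp
  qed
  define b where "b k = J (qs ! k)" for k
  have Hb: "inner (b k) (H *v b l) = (if k = l then d k else 0)" if "k < p" "l < p" for k l
    using hd[OF that] unfolding hh b_def .
  have inj: "inj_on b {..<p}"
  proof (rule inj_onI)
    fix k l assume kl: "k \<in> {..<p}" "l \<in> {..<p}" "b k = b l"
    then have "inner (b k) (H *v b l) \<noteq> 0" using Hb[of k k] d0 by auto
    then show "k = l" using Hb[of k l] kl by (auto split: if_splits)
  qed
  define B where "B = b ` {..<p}"
  have fin: "finite B" unfolding B_def by simp
  have BH: "inner x (H *v y) = 0" if "x \<in> B" "y \<in> B" "x \<noteq> y" for x y
    using that Hb unfolding B_def by auto
  have BH0: "inner x (H *v x) \<noteq> 0" if "x \<in> B" for x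
    using that Hb d0 unfolding B_def by auto
  have ind: "independent B"
    unfolding independent_explicit
  proof (intro conjI fin allI impI ballI)
    fix u y assume u: "(\<Sum>v\<in>B. u v *\<^sub>R v) = 0" and y: "y \<in> B"
    have "0 = inner y (H *v (\<Sum>v\<in>B. u v *\<^sub>R v))" unfolding u by simp
    also have "\<dots> = (\<Sum>v\<in>B. u v * inner y (H *v v))"
      by (simp add: linear_sum[OF matrix_vector_mul_linear] linear_scale[OF matrix_vector_mul_linear] inner_sum_right)
    also have "\<dots> = (\<Sum>v\<in>B. if v = y then u y * inner y (H *v y) else 0)"
      by (intro sum.cong refl) (use BH y in auto)
    also have "\<dots> = u y * inner y (H *v y)" using fin y by simp
    finally show "u y = 0" using BH0[OF y] by simp
  qed
  have "B \<subseteq> T"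
    unfolding B_def b_def J_def using vT T by (auto intro!: subspace_sum subspace_scale)
  moreover have "card B = dim T" unfolding B_def p_def[symmetric] using card_image[OF inj] by simp
  ultimately have "span B = T"
    using card_eq_dim[of B T] ind fin T by (metis span_eq_iff order_class.order_eq_iff span_minimal)
  moreover have "{x\<in>B. inner x (H *v x) < 0} = b ` {k. k < p \<and> d k < 0}"
    unfolding B_def using Hb by auto
  then have "card {x\<in>B. inner x (H *v x) < 0} = card {k. k < p \<and> d k < 0}"
    using card_image[of b "{k. k < p \<and> d k < 0}"] inj by (simp add: inj_on_def)
  then have "num_neg_eigenvalues (restrict_mat H T) = card {x\<in>B. inner x (H *v x) < 0}"
    using num_neg_eigenvalues_of_factorization[OF Ac cp] unfolding A_def by simp
  ultimately show ?thesis using that[OF fin ind _ BH BH0] by blast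
qed

section \<open>Strict expansions and straightening of functions\<close>

lemma has_real_derivative_along_line:
  fixes f :: "'a::real_inner \<Rightarrow> real"
  assumes "\<And>x. (f has_derivative (\<lambda>v. inner (g x) v)) (at x)"
  shows "((\<lambda>t. f (a + t *\<^sub>R v)) has_real_derivative inner (g (a + t *\<^sub>R v)) v) (at t)"
proof -
  have "((\<lambda>t. a + t *\<^sub>R v) has_derivative (\<lambda>t. t *\<^sub>R v)) (at t)"
    by (auto intro!: derivative_eq_intros)
  from has_derivative_compose[OF this assms]
  have "((\<lambda>t. f (a + t *\<^sub>R v)) has_derivative (\<lambda>s. inner (g (a + t *\<^sub>R v)) (s *\<^sub>R v))) (at t)" .
  moreover have "(\<lambda>s. inner (g (a + t *\<^sub>R v)) (s *\<^sub>R v)) = (*) (inner (g (a + t *\<^sub>R v)) v)"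
    by (rule ext) simp
  ultimately show ?thesis unfolding has_field_derivative_def by simp
qed

text \<open>Apply the mean value theorem to \<open>t \<mapsto> f (z + s *\<^sub>R u + t *\<^sub>R v)
  - f (z + t *\<^sub>R v)\<close> and expand the gradient at \<open>z\<close>.\<close>

lemma second_difference_estimate:
  fixes f :: "'a::real_inner \<Rightarrow> real"
  assumes f: "\<And>x. (f has_derivative (\<lambda>v. inner (g x) v)) (at x)"
    and A: "linear A"
    and est: "\<And>y. norm y < d \<Longrightarrow> norm (g (z + y) - g z - A y) \<le> e * norm y"
    and s: "s > 0" "s * (norm u + norm v) < d" and e: "e \<ge> 0"
  shows "\<bar>f (z + s *\<^sub>R u + s *\<^sub>R v) - f (z + s *\<^sub>R u) - f (z + s *\<^sub>R v) + f z - s\<^sup>2 * inner (A u) v\<bar>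
           \<le> 2 * e * s\<^sup>2 * (norm u + norm v) * norm v"
proof -
  define p where "p t = f ((z + s *\<^sub>R u) + t *\<^sub>R v) - f (z + t *\<^sub>R v)" for t
  define p' where "p' t = inner (g ((z + s *\<^sub>R u) + t *\<^sub>R v)) v - inner (g (z + t *\<^sub>R v)) v" for t
  have "(p has_real_derivative p' t) (at t)" for t
    unfolding p_def[abs_def] p'_def
    by (intro DERIV_diff has_real_derivative_along_line[OF f])
  then obtain t where t: "0 < t" "t < s" "p s - p 0 = (s - 0) * p' t"
    using MVT2[OF s(1), of p p'] by blast
  have n: "norm (s *\<^sub>R u + t *\<^sub>R v) \<le> s * (norm u + norm v)" "norm (t *\<^sub>R v) \<le> s * (norm u + norm v)"
  proof -
    have "norm (s *\<^sub>R u + t *\<^sub>R v) \<le> s * norm u + t * norm v"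
      using norm_triangle_ineq[of "s *\<^sub>R u" "t *\<^sub>R v"] s t by simp
    also have "\<dots> \<le> s * norm u + s * norm v" using t by (simp add: mult_right_mono)
    finally show "norm (s *\<^sub>R u + t *\<^sub>R v) \<le> s * (norm u + norm v)" by (simp add: algebra_simps)
    have "norm (t *\<^sub>R v) \<le> s * norm v" using t by (simp add: mult_right_mono)
    also have "\<dots> \<le> s * (norm u + norm v)" using s by (simp add: mult_left_mono)
    finally show "norm (t *\<^sub>R v) \<le> s * (norm u + norm v)" .
  qed
  define r where "r = (g (z + (s *\<^sub>R u + t *\<^sub>R v)) - g z - A (s *\<^sub>R u + t *\<^sub>R v)) - (g (z + t *\<^sub>R v) - g z - A (t *\<^sub>R v))"
  have "norm r \<le> e * norm (s *\<^sub>R u + t *\<^sub>R v) + e * norm (t *\<^sub>R v)"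
    unfolding r_def
    by (rule order_trans[OF norm_triangle_ineq4]) (intro add_mono est, (use n s in linarith)+)
  also have "\<dots> \<le> e * (s * (norm u + norm v)) + e * (s * (norm u + norm v))"
    by (intro add_mono mult_left_mono n e)
  finally have r: "norm r \<le> 2 * e * s * (norm u + norm v)" by (simp add: algebra_simps)
  have "p' t = inner r v + s * inner (A u) v"
    unfolding p'_def r_def
    by (simp add: linear_add[OF A] linear_scale[OF A] inner_diff_left inner_add_left algebra_simps)
  then have "p s - p 0 - s\<^sup>2 * inner (A u) v = s * inner r v"
    using t(3) by (simp add: algebra_simps power2_eq_square)
  also have "\<bar>\<dots>\<bar> \<le> s * (norm r * norm v)"
    using Cauchy_Schwarz_ineq2[of r v] s by (simp add: abs_mult mult_left_mono)
  also have "\<dots> \<le> s * ((2 * e * s * (norm u + norm v)) * norm v)"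
    using r s by (intro mult_left_mono mult_right_mono) auto
  finally show ?thesis unfolding p_def by (simp add: algebra_simps power2_eq_square)
qed

text \<open>The second difference of \<open>f\<close> is symmetric in the two increments
  \<open>u\<close> and \<open>v\<close>, and it approximates both \<open>s\<^sup>2 * inner (A u)
  v\<close> and \<open>s\<^sup>2 * inner (A v) u\<close>.\<close>

lemma gradient_derivative_symmetric:
  fixes f :: "'a::real_inner \<Rightarrow> real"
  assumes f: "\<And>x. (f has_derivative (\<lambda>v. inner (g x) v)) (at x)"
    and g: "(g has_derivative A) (at z)"
  shows "inner (A u) v = inner u (A v)"
proof (rule ccontr)
  assume neq: "inner (A u) v \<noteq> inner u (A v)"
  define K where "K = norm u + norm v"
  define m where "m = \<bar>inner (A u) v - inner u (A v)\<bar>"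
  \<comment> \<open>The two second difference estimates add up to an error of \<open>2 * e * K\<^sup>2 * s\<^sup>2\<close>, which is below \<open>m * s\<^sup>2\<close>.\<close>
  define e where "e = m / (5 * (K\<^sup>2 + 1))"
  have pos: "m > 0" "K \<ge> 0" "K\<^sup>2 + 1 > 0" using neq unfolding m_def K_def by (auto intro: add_nonneg_pos)
  then have e: "e > 0" unfolding e_def by simp
  have A: "linear A" using g has_derivative_linear by blast
  obtain d where d: "d > 0" "\<And>y. norm (y - z) < d \<Longrightarrow> norm (g y - g z - A (y - z)) \<le> e * norm (y - z)"
    using g e unfolding has_derivative_at_alt by blast
  have est: "norm (g (z + y) - g z - A y) \<le> e * norm y" if "norm y < d" for y
    using d(2)[of "z + y"] that by simp
  define s where "s = d / (2 * (K + 1))"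
  have s: "s > 0" unfolding s_def using d pos by simp
  have "s * K < d" unfolding s_def using d pos by (simp add: field_simps add_strict_increasing2)
  then have sd: "s * (norm u + norm v) < d" "s * (norm v + norm u) < d" unfolding K_def by (simp_all add: add.commute)
  define D where "D = f (z + s *\<^sub>R u + s *\<^sub>R v) - f (z + s *\<^sub>R u) - f (z + s *\<^sub>R v) + f z"
  have 1: "\<bar>D - s\<^sup>2 * inner (A u) v\<bar> \<le> 2 * e * s\<^sup>2 * K * norm v"
    using second_difference_estimate[OF f A est s sd(1)] e unfolding D_def K_def by simp
  have 2: "\<bar>D - s\<^sup>2 * inner (A v) u\<bar> \<le> 2 * e * s\<^sup>2 * K * norm u"
    using second_difference_estimate[OF f A est s sd(2)] e unfolding D_def K_def
    by (simp add: algebra_simps)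
  have "s\<^sup>2 * m = \<bar>s\<^sup>2 * inner (A u) v - s\<^sup>2 * inner (A v) u\<bar>"
    unfolding m_def by (simp add: abs_mult right_diff_distrib[symmetric] inner_commute)
  also have "\<dots> \<le> 2 * e * s\<^sup>2 * K * norm v + 2 * e * s\<^sup>2 * K * norm u" using 1 2 by linarith
  also have "\<dots> = s\<^sup>2 * (2 * e * K\<^sup>2)" unfolding K_def by (simp add: algebra_simps power2_eq_square)
  finally have "m \<le> 2 * e * K\<^sup>2" using s by simp
  moreover have "e * (5 * (K\<^sup>2 + 1)) = m" unfolding e_def using pos by simp
  moreover have "0 \<le> e * K\<^sup>2" using e by simp
  ultimately show False using e by (simp add: algebra_simps)
qed

lemma onorm_inner_le: "norm a \<le> b \<Longrightarrow> onorm (\<lambda>v. inner a v) \<le> b"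
  by (rule onorm_bound)
    (use norm_ge_zero[of a] in linarith,
     metis Cauchy_Schwarz_ineq2 mult_right_mono norm_ge_zero order_trans real_norm_def)

text \<open>The estimate is uniform in both points. This is what survives composition with a merely
  Lipschitz change of coordinates and what controls \<open>f\<close> along segments that do not
  start at \<open>z\<close>.\<close>

lemma strict_differentiability:
  fixes f :: "'a::real_inner \<Rightarrow> real"
  assumes f: "\<And>x. (f has_derivative (\<lambda>v. inner (g x) v)) (at x)"
    and g: "isCont g z" and e: "e > 0"
  shows "\<exists>d>0. \<forall>x y. norm (x - z) < d \<longrightarrow> norm (y - z) < d \<longrightarrow>
           \<bar>f y - f x - inner (g z) (y - x)\<bar> \<le> e * norm (y - x)"
proof -
  obtain d where d: "d > 0" "\<And>x. dist x z < d \<Longrightarrow> dist (g x) (g z) < e"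
    using g e unfolding continuous_at_eps_delta by blast
  have "\<bar>f y - f x - inner (g z) (y - x)\<bar> \<le> e * norm (y - x)"
    if "norm (x - z) < d" "norm (y - z) < d" for x y
  proof -
    have "norm ((f y - inner (g z) y) - (f x - inner (g z) x)) \<le> e * norm (y - x)"
    proof (rule differentiable_bound[where S = "ball z d" and f' = "\<lambda>w v. inner (g w - g z) v"])
      fix w assume w: "w \<in> ball z d"
      show "((\<lambda>x. f x - inner (g z) x) has_derivative (\<lambda>v. inner (g w - g z) v)) (at w within ball z d)"
        unfolding inner_diff_left
        by (intro has_derivative_diff has_derivative_at_withinI[OF f] derivative_intros)
      have "norm (g w - g z) \<le> e" using d(2)[of w] w by (simp add: dist_norm norm_minus_commute dist_commute)
      then show "onorm (\<lambda>v. inner (g w - g z) v) \<le> e"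
        by (rule onorm_inner_le)
    qed (use that in \<open>auto simp: dist_norm norm_minus_commute\<close>)
    then show ?thesis by (simp add: inner_diff_right algebra_simps)
  qed
  then show ?thesis using d(1) by blast
qed

text \<open>Subtracting the quadratic part leaves a function whose gradient is at most \<open>e *
  norm (w - z)\<close>, to which the mean value inequality applies. By symmetry of \<open>A\<close>,
  \<open>inner (A (y + x)) (y - x)\<close> is the increment of the quadratic form from
  \<open>x\<close> to \<open>y\<close>.\<close>

lemma strict_second_order_expansion:
  fixes f :: "'a::real_inner \<Rightarrow> real"
  assumes f: "\<And>x. (f has_derivative (\<lambda>v. inner (g x) v)) (at x)"
    and g: "(g has_derivative A) (at z)" and g0: "g z = 0" and e: "e > 0"
  shows "\<exists>d>0. \<forall>x y. norm x < d \<longrightarrow> norm y < d \<longrightarrow>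
     \<bar>f (z + y) - f (z + x) - inner (A (y + x)) (y - x) / 2\<bar> \<le> e * (norm x + norm y) * norm (y - x)"
proof -
  have A: "bounded_linear A" using g has_derivative_bounded_linear by blast
  then have lA: "linear A" by (rule bounded_linear.linear)
  have sym: "inner (A u) v = inner u (A v)" for u v by (rule gradient_derivative_symmetric[OF f g])
  obtain d where d: "d > 0" "\<And>y. norm (y - z) < d \<Longrightarrow> norm (g y - g z - A (y - z)) \<le> e * norm (y - z)"
    using g e unfolding has_derivative_at_alt by blast
  define S where "S w = f w - inner (A (w - z)) (w - z) / 2" for w
  have "\<bar>f (z + y) - f (z + x) - inner (A (y + x)) (y - x) / 2\<bar> \<le> e * (norm x + norm y) * norm (y - x)"
    if xy: "norm x < d" "norm y < d" for x y
  proof -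
    define m where "m = max (norm x) (norm y)"
    have m: "m < d" "norm x \<le> m" "norm y \<le> m" "m \<le> norm x + norm y" using xy unfolding m_def by auto
    have "norm (S (z + y) - S (z + x)) \<le> (e * m) * norm ((z + y) - (z + x))"
    proof (rule differentiable_bound[where S = "cball z m" and f' = "\<lambda>w v. inner (g w - A (w - z)) v"])
      fix w assume "w \<in> cball z m"
      then have w: "norm (w - z) \<le> m" by (simp add: dist_norm norm_minus_commute)
      have "((\<lambda>w. A (w - z)) has_derivative A) (at w)"
        using has_derivative_compose[OF has_derivative_diff[OF has_derivative_ident has_derivative_const[of z]]
            bounded_linear_imp_has_derivative[OF A]] by simp
      then have "((\<lambda>w. inner (A (w - z)) (w - z)) has_derivative
          (\<lambda>v. inner (A (w - z)) v + inner (A v) (w - z))) (at w)"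
        by (intro has_derivative_inner) (auto intro!: derivative_eq_intros)
      then have "(S has_derivative (\<lambda>v. inner (g w) v - (inner (A (w - z)) v + inner (A v) (w - z)) / 2)) (at w)"
        unfolding S_def[abs_def]
        by (intro has_derivative_diff f bounded_linear.has_derivative[OF bounded_linear_divide])
      moreover have "inner (g w) v - (inner (A (w - z)) v + inner (A v) (w - z)) / 2 = inner (g w - A (w - z)) v" for v
        using sym[of v "w - z"] by (simp add: inner_diff_left inner_diff_right inner_commute)
      ultimately show "(S has_derivative (\<lambda>v. inner (g w - A (w - z)) v)) (at w within cball z m)"
        by (simp add: has_derivative_at_withinI)
      have "norm (g w - A (w - z)) \<le> e * norm (w - z)" using d(2)[of w] w m g0 by simp
      also have "\<dots> \<le> e * m" using w e by simp
      finally show "onorm (\<lambda>v. inner (g w - A (w - z)) v) \<le> e * m"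
        by (rule onorm_inner_le)
    qed (use m in \<open>auto simp: dist_norm\<close>)
    also have "\<dots> \<le> (e * (norm x + norm y)) * norm (y - x)"
      using m e by (intro mult_mono mult_left_mono) auto
    finally have "\<bar>S (z + y) - S (z + x)\<bar> \<le> e * (norm x + norm y) * norm (y - x)" by simp
    moreover have "inner (A (y + x)) (y - x) = inner (A y) y - inner (A x) x"
      using sym[of x y] by (simp add: linear_add[OF lA] inner_add_left inner_add_right inner_diff_left inner_diff_right inner_commute)
    ultimately show ?thesis unfolding S_def by (simp add: algebra_simps diff_divide_distrib)
  qed
  then show ?thesis using d(1) by blast
qed

text \<open>Near 0 the map differs from the identity by a map of arbitrarily small Lipschitz
  constant. This form of differentiability at 0 passes from a map to its inverse by a direct
  estimate, and it suffices to transport first and second order expansions.\<close>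

definition strictly_near_id :: "('a::real_normed_vector \<Rightarrow> 'a) \<Rightarrow> bool" where
  "strictly_near_id \<Psi> \<longleftrightarrow> (\<forall>e>0. \<exists>d>0. \<forall>v w. norm v < d \<longrightarrow> norm w < d \<longrightarrow>
      norm (\<Psi> w - \<Psi> v - (w - v)) \<le> e * norm (w - v))"

text \<open>The map \<open>x \<mapsto> (x - z) + k x\<close> with \<open>k x = (\<Sum>c\<in>C.
  (\<phi> c x - inner (G c) (x - z)) *\<^sub>R D c)\<close> has the inner product \<open>\<phi> c
  x\<close> with \<open>G c\<close>, by duality of \<open>D\<close> and \<open>G\<close>, and
  \<open>k\<close> has a small Lipschitz constant near \<open>z\<close>. Its inverse
  \<open>\<Psi>\<close> therefore turns each \<open>\<phi> c\<close> into a linear function. It is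
  found as the fixed point of \<open>x \<mapsto> z + v - k x\<close>.\<close>

lemma straightening:
  fixes \<phi> :: "'c \<Rightarrow> 'a::euclidean_space \<Rightarrow> real" and G D :: "'c \<Rightarrow> 'a"
  assumes fin: "finite C"
    and dual: "\<And>c b. c \<in> C \<Longrightarrow> b \<in> C \<Longrightarrow> inner (G c) (D b) = (if c = b then 1 else 0)"
    and zero: "\<And>c. c \<in> C \<Longrightarrow> \<phi> c z = 0"
    and strict: "\<And>c e. c \<in> C \<Longrightarrow> e > 0 \<Longrightarrow> \<exists>d>0. \<forall>x y. norm (x - z) < d \<longrightarrow> norm (y - z) < d \<longrightarrow>
           \<bar>\<phi> c y - \<phi> c x - inner (G c) (y - x)\<bar> \<le> e * norm (y - x)"
  obtains \<Psi> r \<rho> where "r > 0" "\<rho> > 0" "\<Psi> 0 = z" "strictly_near_id \<Psi>"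
    "\<And>v w. norm v < r \<Longrightarrow> norm w < r \<Longrightarrow> norm (\<Psi> w - \<Psi> v - (w - v)) \<le> norm (w - v) / 2"
    "\<And>v c. norm v < r \<Longrightarrow> c \<in> C \<Longrightarrow> \<phi> c (\<Psi> v) = inner (G c) v"
    "\<And>x. norm (x - z) < \<rho> \<Longrightarrow> \<exists>v. norm v < r \<and> \<Psi> v = x"
proof -
  define k where "k x = (\<Sum>c\<in>C. (\<phi> c x - inner (G c) (x - z)) *\<^sub>R D c)" for x
  have kz: "k z = 0" unfolding k_def using zero by simp
  have ksmall: "\<exists>d>0. \<forall>x y. norm (x - z) < d \<longrightarrow> norm (y - z) < d \<longrightarrow> norm (k y - k x) \<le> e * norm (y - x)"
    if e: "e > 0" for e
  proof -
    define K where "K = (\<Sum>c\<in>C. norm (D c)) + 1"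
    have K: "K > 0" unfolding K_def by (intro add_nonneg_pos sum_nonneg) auto
    then have "e / K > 0" using e by simp
    then have "\<forall>c\<in>C. \<exists>d>0. \<forall>x y. norm (x - z) < d \<longrightarrow> norm (y - z) < d \<longrightarrow>
           \<bar>\<phi> c y - \<phi> c x - inner (G c) (y - x)\<bar> \<le> e / K * norm (y - x)"
      using strict by blast
    then obtain d where d: "\<And>c. c \<in> C \<Longrightarrow> d c > 0" "\<And>c x y. c \<in> C \<Longrightarrow> norm (x - z) < d c \<Longrightarrow>
        norm (y - z) < d c \<Longrightarrow> \<bar>\<phi> c y - \<phi> c x - inner (G c) (y - x)\<bar> \<le> e / K * norm (y - x)"
      by metis
    define m where "m = Min (insert 1 (d ` C))"
    have m: "m > 0" "\<And>c. c \<in> C \<Longrightarrow> m \<le> d c" unfolding m_def using fin d(1) by auto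
    have "norm (k y - k x) \<le> e * norm (y - x)" if xy: "norm (x - z) < m" "norm (y - z) < m" for x y
    proof -
      have "k y - k x = (\<Sum>c\<in>C. (\<phi> c y - \<phi> c x - inner (G c) (y - x)) *\<^sub>R D c)"
        unfolding k_def sum_subtractf[symmetric]
        by (intro sum.cong refl) (simp add: inner_diff_right algebra_simps)
      also have "norm \<dots> \<le> (\<Sum>c\<in>C. (e / K * norm (y - x)) * norm (D c))"
      proof (rule order_trans[OF norm_sum], rule sum_mono)
        fix c assume c: "c \<in> C"
        have "\<bar>\<phi> c y - \<phi> c x - inner (G c) (y - x)\<bar> \<le> e / K * norm (y - x)"
          using d(2)[OF c, of x y] m(2)[OF c] xy by simp
        then show "norm ((\<phi> c y - \<phi> c x - inner (G c) (y - x)) *\<^sub>R D c) \<le> (e / K * norm (y - x)) * norm (D c)"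
          unfolding norm_scaleR real_norm_def by (rule mult_right_mono) simp
      qed
      also have "\<dots> = (e / K * norm (y - x)) * (K - 1)" unfolding K_def by (simp add: sum_distrib_left)
      also have "\<dots> \<le> (e / K * norm (y - x)) * K" using e K by (intro mult_left_mono) auto
      also have "\<dots> = e * norm (y - x)" using K by simp
      finally show ?thesis .
    qed
    then show ?thesis using m(1) by blast
  qed
  obtain d where d: "d > 0" "\<And>x y. norm (x - z) < d \<Longrightarrow> norm (y - z) < d \<Longrightarrow> norm (k y - k x) \<le> 1/3 * norm (y - x)"
    using ksmall[of "1/3"] by auto
  define r where "r = d / 3"
  define \<rho> where "\<rho> = d / 4"
  have r: "r > 0" "\<rho> > 0" unfolding r_def \<rho>_def using d by auto
  have ex: "\<exists>!x\<in>cball z (d/2). z + v - k x = x" if v: "norm v < r" for v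
  proof (rule Banach_fix[where c = "1/3"])
    show "(\<lambda>x. z + v - k x) ` cball z (d/2) \<subseteq> cball z (d/2)"
    proof clarify
      fix x assume "x \<in> cball z (d/2)"
      then have x: "norm (x - z) \<le> d/2" by (simp add: dist_norm norm_minus_commute)
      then have "norm (k x) \<le> 1/3 * (d/2)" using d(2)[of z x] d(1) kz by simp
      then have "norm (v - k x) \<le> d/2" using norm_triangle_ineq4[of v "k x"] v unfolding r_def by simp
      moreover have "z - (z + v - k x) = - (v - k x)" by simp
      ultimately show "z + v - k x \<in> cball z (d/2)" by (simp add: dist_norm del: minus_diff_eq)
    qed
    fix x y assume "x \<in> cball z (d/2)" "y \<in> cball z (d/2)"
    then have "norm (k y - k x) \<le> 1/3 * norm (y - x)"
      using d by (intro d(2)) (auto simp: dist_norm norm_minus_commute)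
    then show "dist (z + v - k x) (z + v - k y) \<le> 1/3 * dist x y"
      by (simp add: dist_norm norm_minus_commute)
  qed (use d in \<open>auto simp: complete_eq_closed\<close>)
  have uniq: "x = y" if "norm v < r" "x \<in> cball z (d/2)" "y \<in> cball z (d/2)" "z + v - k x = x" "z + v - k y = y"
    for v x y using ex[OF that(1)] that(2-5) by (metis (no_types))
  from ex obtain \<Psi> where \<Psi>: "\<And>v. norm v < r \<Longrightarrow> \<Psi> v \<in> cball z (d/2) \<and> z + v - k (\<Psi> v) = \<Psi> v" by metis
  have near: "norm (\<Psi> v - z) < d" if "norm v < r" for v
    using \<Psi>[OF that] d(1) by (simp add: dist_norm norm_minus_commute)
  have diff: "\<Psi> w - \<Psi> v - (w - v) = - (k (\<Psi> w) - k (\<Psi> v))" if "norm v < r" "norm w < r" for v w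
  proof -
    have "\<Psi> w - \<Psi> v = (z + w - k (\<Psi> w)) - (z + v - k (\<Psi> v))"
      using \<Psi>[OF that(1)] \<Psi>[OF that(2)] by simp
    then show ?thesis by (simp add: algebra_simps)
  qed
  have lip: "norm (\<Psi> w - \<Psi> v) \<le> 3/2 * norm (w - v)" if "norm v < r" "norm w < r" for v w
  proof -
    have "norm (\<Psi> w - \<Psi> v - (w - v)) \<le> 1/3 * norm (\<Psi> w - \<Psi> v)"
      unfolding diff[OF that] norm_minus_cancel using that by (intro d(2) near)
    then show ?thesis using norm_triangle_sub[of "\<Psi> w - \<Psi> v" "w - v"] by linarith
  qed
  have half: "norm (\<Psi> w - \<Psi> v - (w - v)) \<le> norm (w - v) / 2" if "norm v < r" "norm w < r" for v w
  proof -
    have "norm (\<Psi> w - \<Psi> v - (w - v)) \<le> 1/3 * norm (\<Psi> w - \<Psi> v)"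
      unfolding diff[OF that] norm_minus_cancel using that by (intro d(2) near)
    then show ?thesis using lip[OF that] by linarith
  qed
  have \<Psi>0: "\<Psi> 0 = z"
  proof -
    have "z + 0 - k z = z" "z \<in> cball z (d/2)" using kz d by auto
    moreover have "norm (0::'a) < r" using r by simp
    ultimately show ?thesis using uniq[of 0 "\<Psi> 0" z] \<Psi>[of 0] by blast
  qed
  have "strictly_near_id \<Psi>" unfolding strictly_near_id_def
  proof (intro allI impI)
    fix e :: real assume e: "e > 0"
    then obtain d' where d': "d' > 0" "\<And>x y. norm (x - z) < d' \<Longrightarrow> norm (y - z) < d' \<Longrightarrow> norm (k y - k x) \<le> e/2 * norm (y - x)"
      using ksmall[of "e/2"] by auto
    define m where "m = min r (d'/2)"
    have "norm (\<Psi> w - \<Psi> v - (w - v)) \<le> e * norm (w - v)" if vw: "norm v < m" "norm w < m" for v w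
    proof -
      have r': "norm v < r" "norm w < r" "norm v < d'/2" "norm w < d'/2" using vw unfolding m_def by auto
      have "norm (\<Psi> v - z) < d'" "norm (\<Psi> w - z) < d'"
        using lip[of 0 v] lip[of 0 w] r r' \<Psi>0 norm_ge_zero[of v] norm_ge_zero[of w]
        by (simp_all, linarith+)
      then have "norm (\<Psi> w - \<Psi> v - (w - v)) \<le> e/2 * norm (\<Psi> w - \<Psi> v)"
        unfolding diff[OF r'(1,2)] norm_minus_cancel by (rule d'(2))
      also have "\<dots> \<le> e/2 * (2 * norm (w - v))"
      proof (rule mult_left_mono)
        show "norm (\<Psi> w - \<Psi> v) \<le> 2 * norm (w - v)"
          using lip[OF r'(1,2)] norm_ge_zero[of "w - v"] by linarith
      qed (use e in simp)
      finally show ?thesis by simp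
    qed
    moreover have "m > 0" unfolding m_def using r d' by simp
    ultimately show "\<exists>d>0. \<forall>v w. norm v < d \<longrightarrow> norm w < d \<longrightarrow> norm (\<Psi> w - \<Psi> v - (w - v)) \<le> e * norm (w - v)"
      by blast
  qed
  moreover have "\<phi> c (\<Psi> v) = inner (G c) v" if "norm v < r" "c \<in> C" for v c
  proof -
    have "inner (G c) (k (\<Psi> v)) = (\<Sum>b\<in>C. (\<phi> b (\<Psi> v) - inner (G b) (\<Psi> v - z)) * inner (G c) (D b))"
      unfolding k_def by (simp add: inner_sum_right)
    also have "\<dots> = (\<Sum>b\<in>C. if b = c then \<phi> c (\<Psi> v) - inner (G c) (\<Psi> v - z) else 0)"
      using dual that(2) by (intro sum.cong refl) auto
    also have "\<dots> = \<phi> c (\<Psi> v) - inner (G c) (\<Psi> v - z)" using that(2) fin by simp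
    finally have "inner (G c) (k (\<Psi> v)) + inner (G c) (\<Psi> v - z) = \<phi> c (\<Psi> v)" by simp
    moreover have "k (\<Psi> v) = z + v - \<Psi> v" using \<Psi>[OF that(1), THEN conjunct2] by (simp add: algebra_simps)
    ultimately show ?thesis by (simp add: inner_diff_right inner_add_right)
  qed
  moreover have "\<exists>v. norm v < r \<and> \<Psi> v = x" if x: "norm (x - z) < \<rho>" for x
  proof -
    define v where "v = x - z + k x"
    have xd: "norm (x - z) < d" "x \<in> cball z (d/2)"
      using x d(1) unfolding \<rho>_def by (auto simp: dist_norm norm_minus_commute)
    have "norm (k x) \<le> 1/3 * norm (x - z)" using d(2)[of z x] xd d(1) kz by simp
    then have v: "norm v < r" unfolding v_def r_def
      using norm_triangle_ineq[of "x - z" "k x"] x unfolding \<rho>_def by linarith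
    have "z + v - k x = x" unfolding v_def by simp
    then have "\<Psi> v = x" using uniq[OF v _ xd(2)] \<Psi>[OF v] by blast
    then show ?thesis using v by blast
  qed
  ultimately show ?thesis using that[OF r \<Psi>0 _ half] by blast
qed

lemma strict_expansion_first_order_compose:
  fixes f :: "'a::real_inner \<Rightarrow> real"
  assumes f: "\<And>x. (f has_derivative (\<lambda>v. inner (g x) v)) (at x)"
    and g: "isCont g z" and \<Psi>: "strictly_near_id \<Psi>" "\<Psi> 0 = z" and e: "e > 0"
  shows "\<exists>d>0. \<forall>v w. norm v < d \<longrightarrow> norm w < d \<longrightarrow>
     \<bar>f (\<Psi> w) - f (\<Psi> v) - inner (g z) (w - v)\<bar> \<le> e * norm (w - v)"
proof -
  define K where "K = norm (g z) + 1"
  have K: "K > 0" unfolding K_def by (simp add: add_nonneg_pos)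
  have "min 1 (e / (2 * K)) > 0" using e K by simp
  then obtain d1 where d1: "d1 > 0" "\<And>v w. norm v < d1 \<Longrightarrow> norm w < d1 \<Longrightarrow>
      norm (\<Psi> w - \<Psi> v - (w - v)) \<le> min 1 (e / (2 * K)) * norm (w - v)"
    using \<Psi>(1) unfolding strictly_near_id_def by blast
  obtain d2 where d2: "d2 > 0" "\<And>x y. norm (x - z) < d2 \<Longrightarrow> norm (y - z) < d2 \<Longrightarrow>
      \<bar>f y - f x - inner (g z) (y - x)\<bar> \<le> e / 4 * norm (y - x)"
    using strict_differentiability[OF f g, of "e/4"] e by auto
  define d where "d = min d1 (d2 / 2)"
  have "\<bar>f (\<Psi> w) - f (\<Psi> v) - inner (g z) (w - v)\<bar> \<le> e * norm (w - v)"
    if vw: "norm v < d" "norm w < d" for v w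
  proof -
    have vw1: "norm v < d1" "norm w < d1" "norm v < d2/2" "norm w < d2/2" using vw unfolding d_def by auto
    have lip: "norm (\<Psi> w - \<Psi> v) \<le> 2 * norm (w - v)" if "norm v < d1" "norm w < d1" for v w
    proof -
      have "min 1 (e / (2 * K)) * norm (w - v) \<le> 1 * norm (w - v)" by (intro mult_right_mono) auto
      then show ?thesis using d1(2)[OF that] norm_triangle_sub[of "\<Psi> w - \<Psi> v" "w - v"] by linarith
    qed
    have "norm (\<Psi> v - z) < d2" "norm (\<Psi> w - z) < d2"
      using lip[of 0 v] lip[of 0 w] vw1 d1(1) \<Psi>(2) by auto
    from d2(2)[OF this] have "\<bar>f (\<Psi> w) - f (\<Psi> v) - inner (g z) (\<Psi> w - \<Psi> v)\<bar> \<le> e / 4 * norm (\<Psi> w - \<Psi> v)" .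
    also have "\<dots> \<le> e / 4 * (2 * norm (w - v))" using lip[OF vw1(1,2)] e by (intro mult_left_mono) auto
    finally have 1: "\<bar>f (\<Psi> w) - f (\<Psi> v) - inner (g z) (\<Psi> w - \<Psi> v)\<bar> \<le> e / 2 * norm (w - v)" by simp
    have "\<bar>inner (g z) (\<Psi> w - \<Psi> v - (w - v))\<bar> \<le> norm (g z) * norm (\<Psi> w - \<Psi> v - (w - v))"
      by (rule Cauchy_Schwarz_ineq2)
    also have "\<dots> \<le> K * (e / (2 * K) * norm (w - v))"
    proof (intro mult_mono)
      show "norm (\<Psi> w - \<Psi> v - (w - v)) \<le> e / (2 * K) * norm (w - v)"
        by (rule order_trans[OF d1(2)[OF vw1(1,2)]]) (intro mult_right_mono, auto)
    qed (use K in \<open>auto simp: K_def\<close>)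
    also have "\<dots> = e / 2 * norm (w - v)" using K by simp
    finally have 2: "\<bar>inner (g z) (\<Psi> w - \<Psi> v - (w - v))\<bar> \<le> e / 2 * norm (w - v)" .
    have "f (\<Psi> w) - f (\<Psi> v) - inner (g z) (w - v) =
        (f (\<Psi> w) - f (\<Psi> v) - inner (g z) (\<Psi> w - \<Psi> v)) + inner (g z) (\<Psi> w - \<Psi> v - (w - v))"
      by (simp add: inner_diff_right)
    then show ?thesis using 1 2 by linarith
  qed
  moreover have "d > 0" unfolding d_def using d1 d2 by simp
  ultimately show ?thesis by blast
qed

text \<open>Replacing \<open>\<Psi> v - z\<close> by \<open>v\<close> in the quadratic form costs
  only a small multiple of the error that the expansion allows anyway.\<close>

lemma strict_expansion_second_order_compose:
  fixes f :: "'a::real_inner \<Rightarrow> real"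
  assumes f: "\<And>x. (f has_derivative (\<lambda>v. inner (g x) v)) (at x)"
    and g: "(g has_derivative A) (at z)" "g z = 0" and \<Psi>: "strictly_near_id \<Psi>" "\<Psi> 0 = z" and e: "e > 0"
  shows "\<exists>d>0. \<forall>v w. norm v < d \<longrightarrow> norm w < d \<longrightarrow>
     \<bar>f (\<Psi> w) - f (\<Psi> v) - inner (A (w + v)) (w - v) / 2\<bar> \<le> e * (norm v + norm w) * norm (w - v)"
proof -
  have A: "bounded_linear A" using g has_derivative_bounded_linear by blast
  then have lA: "linear A" by (rule bounded_linear.linear)
  obtain K where K: "K > 0" "\<And>x. norm (A x) \<le> norm x * K"
    using bounded_linear.pos_bounded[OF A] by blast
  define e1 where "e1 = min 1 (e / (6 * K))"
  have e1: "e1 > 0" "e1 \<le> 1" "K * e1 \<le> e / 6"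
    unfolding e1_def using e K by (auto simp: min_def field_simps)
  obtain d1 where d1: "d1 > 0" "\<And>v w. norm v < d1 \<Longrightarrow> norm w < d1 \<Longrightarrow>
      norm (\<Psi> w - \<Psi> v - (w - v)) \<le> e1 * norm (w - v)"
    using \<Psi>(1) e1(1) unfolding strictly_near_id_def by metis
  obtain d2 where d2: "d2 > 0" "\<And>x y. norm x < d2 \<Longrightarrow> norm y < d2 \<Longrightarrow>
     \<bar>f (z + y) - f (z + x) - inner (A (y + x)) (y - x) / 2\<bar> \<le> e / 8 * (norm x + norm y) * norm (y - x)"
    using strict_second_order_expansion[OF f g, of "e/8"] e by auto
  define d where "d = min d1 (d2 / 2)"
  have "\<bar>f (\<Psi> w) - f (\<Psi> v) - inner (A (w + v)) (w - v) / 2\<bar> \<le> e * (norm v + norm w) * norm (w - v)"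
    if vw: "norm v < d" "norm w < d" for v w
  proof -
    have vw1: "norm v < d1" "norm w < d1" "norm v < d2/2" "norm w < d2/2" using vw unfolding d_def by auto
    have lip: "norm (\<Psi> w - \<Psi> v) \<le> 2 * norm (w - v)" if "norm v < d1" "norm w < d1" for v w
    proof -
      have "e1 * norm (w - v) \<le> 1 * norm (w - v)" using e1 by (intro mult_right_mono) auto
      then show ?thesis using d1(2)[OF that] norm_triangle_sub[of "\<Psi> w - \<Psi> v" "w - v"] by linarith
    qed
    define x where "x = \<Psi> v - z"
    define y where "y = \<Psi> w - z"
    define N where "N = norm v + norm w"
    have xy: "norm x \<le> 2 * norm v" "norm y \<le> 2 * norm w" "norm (y - x) \<le> 2 * norm (w - v)"
      "norm (x - v) \<le> e1 * norm v" "norm (y - w) \<le> e1 * norm w" "norm ((y - x) - (w - v)) \<le> e1 * norm (w - v)"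
      using lip[of 0 v] lip[of 0 w] lip[of v w] d1(2)[of 0 v] d1(2)[of 0 w] d1(2)[of v w] vw1 d1(1) \<Psi>(2)
      unfolding x_def y_def by auto
    have "\<bar>f (z + y) - f (z + x) - inner (A (y + x)) (y - x) / 2\<bar> \<le> e / 8 * (norm x + norm y) * norm (y - x)"
      using xy vw1 by (intro d2(2)) auto
    also have "\<dots> \<le> e / 8 * (2 * N) * (2 * norm (w - v))"
      using xy e unfolding N_def by (intro mult_mono mult_left_mono) auto
    finally have 1: "\<bar>f (\<Psi> w) - f (\<Psi> v) - inner (A (y + x)) (y - x) / 2\<bar> \<le> e / 2 * N * norm (w - v)"
      unfolding x_def y_def by (simp add: mult_ac)
    have "norm (y + x - (w + v)) \<le> e1 * N"
      using norm_triangle_ineq[of "y - w" "x - v"] xy unfolding N_def by (simp add: algebra_simps)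
    then have a: "norm (A (y + x - (w + v))) \<le> e1 * N * K"
      using K(2)[of "y + x - (w + v)"] K(1) by (meson mult_right_mono order_trans less_imp_le)
    have "norm (w + v) \<le> N" unfolding N_def using norm_triangle_ineq[of w v] by simp
    then have b: "norm (A (w + v)) \<le> N * K"
      using K(2)[of "w + v"] K(1) by (meson mult_right_mono order_trans less_imp_le)
    have N0: "N \<ge> 0" unfolding N_def by simp
    have "\<bar>inner (A (y + x - (w + v))) (y - x)\<bar> \<le> (e1 * N * K) * (2 * norm (w - v))"
      by (rule order_trans[OF Cauchy_Schwarz_ineq2]) (use a xy e1 K N0 in \<open>intro mult_mono; auto\<close>)
    moreover have "\<bar>inner (A (w + v)) ((y - x) - (w - v))\<bar> \<le> (N * K) * (e1 * norm (w - v))"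
      by (rule order_trans[OF Cauchy_Schwarz_ineq2]) (use b xy K N0 in \<open>intro mult_mono; auto\<close>)
    moreover have "inner (A (y + x)) (y - x) - inner (A (w + v)) (w - v) =
        inner (A (y + x - (w + v))) (y - x) + inner (A (w + v)) ((y - x) - (w - v))"
      by (simp add: linear_diff[OF lA] inner_diff_left inner_diff_right)
    ultimately have "\<bar>inner (A (y + x)) (y - x) - inner (A (w + v)) (w - v)\<bar> \<le> 3 * (K * e1) * (N * norm (w - v))"
      by (simp add: algebra_simps)
    also have "\<dots> \<le> 3 * (e / 6) * (N * norm (w - v))"
      using e1 N0 by (intro mult_right_mono mult_left_mono) auto
    finally have 2: "\<bar>inner (A (y + x)) (y - x) - inner (A (w + v)) (w - v)\<bar> \<le> e / 2 * N * norm (w - v)" by simp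
    have "0 \<le> e / 2 * N * norm (w - v)" using e N0 by simp
    then show ?thesis using 1 2 unfolding N_def[symmetric] by linarith
  qed
  moreover have "d > 0" unfolding d_def using d1 d2 by simp
  ultimately show ?thesis by blast
qed

section \<open>Descent in normal coordinates\<close>

text \<open>A coordinate system adapted to a function that is modelled by \<open>(\<Sum>c\<in>C. w c
  * \<xi> c v) + (\<Sum>b\<in>B. \<kappa> b * (\<xi> b v)\<^sup>2) / 2\<close>: linear in the
  coordinates \<open>C\<close>, quadratic and diagonal in the coordinates \<open>B\<close>.\<close>

locale normal_coordinates =
  fixes C B :: "'k set" and e :: "'k \<Rightarrow> 'a::euclidean_space" and \<xi> :: "'k \<Rightarrow> 'a \<Rightarrow> real"
    and w :: "'k \<Rightarrow> real" and A :: "'a \<Rightarrow> 'a"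
  assumes fin: "finite C" "finite B" and disj: "C \<inter> B = {}"
    and \<xi>_linear: "k \<in> C \<union> B \<Longrightarrow> linear (\<xi> k)"
    and dual: "k \<in> C \<union> B \<Longrightarrow> l \<in> C \<union> B \<Longrightarrow> \<xi> k (e l) = (if k = l then 1 else 0)"
    and rep: "v = (\<Sum>k\<in>C \<union> B. \<xi> k v *\<^sub>R e k)"
    and A_linear: "linear A"
    and A_diag: "b \<in> B \<Longrightarrow> c \<in> B \<Longrightarrow> b \<noteq> c \<Longrightarrow> inner (A (e b)) (e c) = 0"
    and A_nondeg: "b \<in> B \<Longrightarrow> inner (A (e b)) (e b) \<noteq> 0"
begin

definition \<kappa> :: "'k \<Rightarrow> real" where "\<kappa> b = inner (A (e b)) (e b)"

text \<open>Whether stretching the \<open>k\<close>-th coordinate of \<open>v\<close> lowers the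
  model. A coordinate in \<open>C\<close> with \<open>w k * \<xi> k v = 0\<close> counts as down,
  which makes \<open>flip\<close> act as the identity on it.\<close>

definition down :: "'k \<Rightarrow> 'a \<Rightarrow> bool" where
  "down k v \<longleftrightarrow> (if k \<in> C then w k * \<xi> k v \<le> 0 else \<kappa> k < 0)"

text \<open>Moving from \<open>v\<close> to \<open>v + flip v\<close> doubles the down coordinates
  and shrinks the others to 0.\<close>

definition flip :: "'a \<Rightarrow> 'a" where
  "flip v = (\<Sum>k\<in>C \<union> B. (if down k v then \<xi> k v else - \<xi> k v) *\<^sub>R e k)"

lemma coord_comb: "\<xi> k (\<Sum>l\<in>C \<union> B. a l *\<^sub>R e l) = a k" if k: "k \<in> C \<union> B"
proof -
  have "\<xi> k (\<Sum>l\<in>C \<union> B. a l *\<^sub>R e l) = (\<Sum>l\<in>C \<union> B. a l * \<xi> k (e l))"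
    using \<xi>_linear[OF k] by (simp add: linear_sum linear_scale)
  also have "\<dots> = (\<Sum>l\<in>C \<union> B. if l = k then a k else 0)"
    by (intro sum.cong refl) (simp add: dual[OF k])
  finally show ?thesis using k fin by simp
qed

lemma coord_flip: "k \<in> C \<union> B \<Longrightarrow> \<xi> k (flip v) = (if down k v then \<xi> k v else - \<xi> k v)"
  unfolding flip_def by (rule coord_comb)

lemma coord_add: "k \<in> C \<union> B \<Longrightarrow> \<xi> k (v + s *\<^sub>R v') = \<xi> k v + s * \<xi> k v'"
  using \<xi>_linear by (simp add: linear_add linear_scale)

lemma coord_eqI: "(\<And>k. k \<in> C \<union> B \<Longrightarrow> \<xi> k v = \<xi> k v') \<Longrightarrow> v = v'"
  by (subst rep[of v], subst rep[of v']) simp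

lemma coord_zero: "k \<in> C \<union> B \<Longrightarrow> \<xi> k 0 = 0"
  using \<xi>_linear linear_0 by blast

lemma coord_bound: "\<exists>K>0. \<forall>v. (\<Sum>k\<in>C \<union> B. \<bar>\<xi> k v\<bar>) \<le> K * norm v"
proof -
  have "\<forall>k\<in>C \<union> B. \<exists>b. \<forall>v. \<bar>\<xi> k v\<bar> \<le> b * norm v"
    using \<xi>_linear linear_bounded by (metis real_norm_def)
  then obtain b where b: "\<And>k v. k \<in> C \<union> B \<Longrightarrow> \<bar>\<xi> k v\<bar> \<le> b k * norm v" by metis
  have "(\<Sum>k\<in>C \<union> B. \<bar>\<xi> k v\<bar>) \<le> (1 + \<bar>\<Sum>k\<in>C \<union> B. b k\<bar>) * norm v" for v
  proof -
    have "(\<Sum>k\<in>C \<union> B. \<bar>\<xi> k v\<bar>) \<le> (\<Sum>k\<in>C \<union> B. b k) * norm v"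
      unfolding sum_distrib_right by (intro sum_mono b)
    also have "\<dots> \<le> (1 + \<bar>\<Sum>k\<in>C \<union> B. b k\<bar>) * norm v" by (intro mult_right_mono) auto
    finally show ?thesis .
  qed
  then show ?thesis by (intro exI[of _ "1 + \<bar>\<Sum>k\<in>C \<union> B. b k\<bar>"]) auto
qed

text \<open>The size of \<open>v\<close> on the scale of the model, which is of first order in
  \<open>C\<close> and of second order in \<open>B\<close>.\<close>

definition mass :: "'a \<Rightarrow> real" where
  "mass v = (\<Sum>c\<in>C. \<bar>\<xi> c v\<bar>) + (\<Sum>b\<in>B. (\<xi> b v)\<^sup>2)"

lemma mass_nonneg: "mass v \<ge> 0"
  unfolding mass_def by (intro add_nonneg_nonneg sum_nonneg) auto

lemma mass_eq_0: "mass v = 0 \<Longrightarrow> v = 0"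
proof (rule coord_eqI)
  fix k assume v: "mass v = 0" and k: "k \<in> C \<union> B"
  have "(\<Sum>c\<in>C. \<bar>\<xi> c v\<bar>) \<ge> 0" "(\<Sum>b\<in>B. (\<xi> b v)\<^sup>2) \<ge> 0" by (auto intro: sum_nonneg)
  then have "(\<Sum>c\<in>C. \<bar>\<xi> c v\<bar>) = 0" "(\<Sum>b\<in>B. (\<xi> b v)\<^sup>2) = 0"
    using v unfolding mass_def by linarith+
  then show "\<xi> k v = \<xi> k 0" using k fin coord_zero[OF k] by (auto simp: sum_nonneg_eq_0_iff)
qed

text \<open>The model describes the increments of \<open>F\<close> near 0 strictly. The quadratic
  form is taken on the whole space, so it also contains products of \<open>C\<close> and
  \<open>B\<close> coordinates; these turn out to be negligible.\<close>

definition expands :: "('a \<Rightarrow> real) \<Rightarrow> bool" where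
  "expands F \<longleftrightarrow> (\<forall>\<epsilon>>0. \<exists>d>0. \<forall>v v'. norm v < d \<longrightarrow> norm v' < d \<longrightarrow>
     \<bar>F v' - F v - (\<Sum>c\<in>C. w c * (\<xi> c v' - \<xi> c v)) - inner (A (v' + v)) (v' - v) / 2\<bar>
       \<le> \<epsilon> * (norm v + norm v') * norm (v' - v))"

lemma quadratic_part_descends:
  assumes s: "0 \<le> s" "s \<le> 1" and k0: "\<And>b. b \<in> B \<Longrightarrow> k0 \<le> \<bar>\<kappa> b\<bar>"
  shows "inner (A (\<Sum>b\<in>B. (2 * \<xi> b v + s * \<xi> b (flip v)) *\<^sub>R e b)) (\<Sum>b\<in>B. \<xi> b (flip v) *\<^sub>R e b)
    \<le> - k0 * (\<Sum>b\<in>B. (\<xi> b v)\<^sup>2)"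
proof -
  let ?a = "\<lambda>b. 2 * \<xi> b v + s * \<xi> b (flip v)"
  have "inner (A (\<Sum>b\<in>B. ?a b *\<^sub>R e b)) (\<Sum>b\<in>B. \<xi> b (flip v) *\<^sub>R e b)
      = (\<Sum>b\<in>B. \<Sum>c\<in>B. ?a b * \<xi> c (flip v) * inner (A (e b)) (e c))"
  proof -
    have "A (\<Sum>b\<in>B. ?a b *\<^sub>R e b) = (\<Sum>b\<in>B. ?a b *\<^sub>R A (e b))"
      using A_linear by (simp add: linear_sum linear_scale)
    then show ?thesis
      by (simp only: inner_sum_left)
        (intro sum.cong refl, simp add: inner_sum_right sum_distrib_left mult_ac)
  qed
  also have "\<dots> = (\<Sum>b\<in>B. \<Sum>c\<in>B. if c = b then ?a b * \<xi> b (flip v) * \<kappa> b else 0)"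
    by (intro sum.cong refl) (auto simp: A_diag \<kappa>_def)
  also have "\<dots> = (\<Sum>b\<in>B. ?a b * \<xi> b (flip v) * \<kappa> b)" using fin(2) by simp
  also have "\<dots> \<le> (\<Sum>b\<in>B. - k0 * (\<xi> b v)\<^sup>2)"
  proof (rule sum_mono)
    fix b assume b: "b \<in> B"
    then have bC: "b \<notin> C" using disj by auto
    have sq: "(\<xi> b v)\<^sup>2 \<ge> 0" by simp
    show "?a b * \<xi> b (flip v) * \<kappa> b \<le> - k0 * (\<xi> b v)\<^sup>2"
    proof (cases "\<kappa> b < 0")
      case True
      then have "?a b * \<xi> b (flip v) * \<kappa> b = (2 + s) * (\<xi> b v)\<^sup>2 * \<kappa> b"
        using coord_flip[of b v] b bC by (simp add: down_def power2_eq_square algebra_simps)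
      also have "\<dots> \<le> 1 * (\<xi> b v)\<^sup>2 * \<kappa> b"
        using True s sq by (intro mult_right_mono_neg mult_right_mono) auto
      also have "\<dots> \<le> - k0 * (\<xi> b v)\<^sup>2"
        using k0[OF b] True mult_right_mono[OF _ sq, of "k0" "- \<kappa> b"] by (simp add: mult.commute)
      finally show ?thesis .
    next
      case False
      then have "?a b * \<xi> b (flip v) * \<kappa> b = - ((2 - s) * (\<xi> b v)\<^sup>2 * \<kappa> b)"
        using coord_flip[of b v] b bC by (simp add: down_def power2_eq_square algebra_simps)
      also have "\<dots> \<le> - (1 * (\<xi> b v)\<^sup>2 * \<kappa> b)"
        unfolding neg_le_iff_le using False s sq by (intro mult_right_mono) auto
      also have "\<dots> \<le> - k0 * (\<xi> b v)\<^sup>2"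
        using k0[OF b] False mult_right_mono[OF _ sq, of "k0" "\<kappa> b"] by (simp add: mult.commute)
      finally show ?thesis .
    qed
  qed
  finally show ?thesis by (simp add: sum_distrib_left)
qed

text \<open>Along the segment every linear term decreases at the rate \<open>\<bar>w c * \<xi> c
  v\<bar>\<close> and every quadratic term at a rate comparable with \<open>\<bar>\<kappa> b\<bar> *
  (\<xi> b v)\<^sup>2\<close>. The errors are products of two coordinates: those with a factor from
  \<open>C\<close> are dominated by the linear terms since the other factor is small, and the
  remaining ones carry the small constant of the strict expansion.\<close>

lemma flip_descent:
  assumes F: "expands F"
  shows "\<exists>\<delta>>0. \<exists>\<eta>>0. \<forall>v. norm v < \<delta> \<longrightarrow> (\<forall>c\<in>C. w c = 0 \<longrightarrow> \<xi> c v = 0) \<longrightarrow>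
    (\<forall>s\<in>{0..1}. F (v + s *\<^sub>R flip v) \<le> F v - s * \<eta> * mass v)"
proof -
  define E where "E = (\<Sum>k\<in>C \<union> B. norm (e k)) + 1"
  define w0 where "w0 = Min (insert 1 ((\<lambda>c. \<bar>w c\<bar>) ` {c\<in>C. w c \<noteq> 0}))"
  define k0 where "k0 = Min (insert 1 ((\<lambda>b. \<bar>\<kappa> b\<bar>) ` B))"
  have E: "E \<ge> 1" unfolding E_def by (simp add: sum_nonneg)
  have eE: "(\<Sum>k\<in>S. a k * norm (e k)) \<le> m * E"
    if "S \<subseteq> C \<union> B" "\<And>k. k \<in> S \<Longrightarrow> a k \<le> m" "m \<ge> 0" for S a m
  proof -
    have "(\<Sum>k\<in>S. a k * norm (e k)) \<le> (\<Sum>k\<in>S. m * norm (e k))"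
      using that(2) by (intro sum_mono mult_right_mono) auto
    also have "\<dots> = m * (\<Sum>k\<in>S. norm (e k))" by (simp add: sum_distrib_left)
    also have "\<dots> \<le> m * (\<Sum>k\<in>C \<union> B. norm (e k))"
      using that fin by (intro mult_left_mono sum_mono2) auto
    also have "\<dots> \<le> m * E" using that(3) unfolding E_def by (intro mult_left_mono) auto
    finally show ?thesis .
  qed
  have w0: "w0 > 0" "\<And>c. c \<in> C \<Longrightarrow> w c \<noteq> 0 \<Longrightarrow> w0 \<le> \<bar>w c\<bar>" unfolding w0_def using fin by auto
  have k0: "k0 > 0" "\<And>b. b \<in> B \<Longrightarrow> k0 \<le> \<bar>\<kappa> b\<bar>"
    unfolding k0_def using fin A_nondeg by (auto simp: \<kappa>_def)
  obtain Kh where Kh: "Kh > 0" "\<And>x. norm (A x) \<le> norm x * Kh"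
    using bounded_linear.pos_bounded[OF linear_conv_bounded_linear[THEN iffD1, OF A_linear]] by blast
  obtain K where K: "K > 0" "\<And>v. (\<Sum>k\<in>C \<union> B. \<bar>\<xi> k v\<bar>) \<le> K * norm v" using coord_bound by blast
  \<comment> \<open>The strict expansion costs at most \<open>3 * \<epsilon> * E\<^sup>2 * R\<^sup>2\<close> with \<open>R\<^sup>2 \<le> 2 * (R * X) + 2 * Y\<close>; this \<open>\<epsilon>\<close> leaves half of the
    quadratic gain \<open>k0 * Y / 2\<close>.\<close>
  define \<epsilon> where "\<epsilon> = k0 / (24 * E\<^sup>2)"
  have E2: "E\<^sup>2 > 0" using E by simp
  have \<epsilon>: "\<epsilon> > 0" "6 * \<epsilon> * E\<^sup>2 = k0 / 4" unfolding \<epsilon>_def using k0 E2 by auto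
  obtain d where d: "d > 0" "\<And>v v'. norm v < d \<Longrightarrow> norm v' < d \<Longrightarrow>
     \<bar>F v' - F v - (\<Sum>c\<in>C. w c * (\<xi> c v' - \<xi> c v)) - inner (A (v' + v)) (v' - v) / 2\<bar>
       \<le> \<epsilon> * (norm v + norm v') * norm (v' - v)"
    using F \<epsilon>(1) unfolding expands_def by blast
  \<comment> \<open>All terms containing \<open>R * X\<close> are at most \<open>Q * norm v * X\<close>; for \<open>norm v < w0 / (2 * Q)\<close> they use up half of the linear
    gain \<open>w0 * X\<close>. The other bound on \<open>\<delta>\<close> keeps \<open>v + flip v\<close> within the range of the expansion.\<close>
  define Q where "Q = (3 * Kh * E\<^sup>2 + k0 / 4) * K"
  have Q: "Q > 0" unfolding Q_def using Kh k0 E2 K by (intro mult_pos_pos add_pos_pos) auto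
  define \<delta> where "\<delta> = min (d / (1 + E * K)) (w0 / (2 * Q))"
  have EK: "1 + E * K > 0" using E K by (simp add: add_pos_pos)
  have \<delta>: "\<delta> > 0" unfolding \<delta>_def using d w0 Q EK by simp
  define \<eta> where "\<eta> = min (w0 / 2) (k0 / 4)"
  have \<eta>: "\<eta> > 0" unfolding \<eta>_def using w0 k0 by simp
  have "F (v + s *\<^sub>R flip v) \<le> F v - s * \<eta> * mass v"
    if v: "norm v < \<delta>" and v0: "\<And>c. c \<in> C \<Longrightarrow> w c = 0 \<Longrightarrow> \<xi> c v = 0" and s: "0 \<le> s" "s \<le> 1" for v s
  proof -
    define y where "y = flip v"
    define X where "X = (\<Sum>c\<in>C. \<bar>\<xi> c v\<bar>)"
    define Y where "Y = (\<Sum>b\<in>B. (\<xi> b v)\<^sup>2)"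
    define R where "R = X + sqrt Y"
    have Y0: "Y \<ge> 0" "X \<ge> 0" unfolding X_def Y_def by (auto intro: sum_nonneg)
    have absy: "\<bar>\<xi> k y\<bar> = \<bar>\<xi> k v\<bar>" if "k \<in> C \<union> B" for k
      unfolding y_def coord_flip[OF that] by simp
    have coordX: "\<bar>\<xi> c v\<bar> \<le> X" if "c \<in> C" for c
      unfolding X_def using fin that by (intro member_le_sum) auto
    have coordY: "\<bar>\<xi> b v\<bar> \<le> sqrt Y" if "b \<in> B" for b
    proof -
      have "(\<xi> b v)\<^sup>2 \<le> Y" unfolding Y_def using fin that by (intro member_le_sum) auto
      then have "sqrt ((\<xi> b v)\<^sup>2) \<le> sqrt Y" by (rule real_sqrt_le_mono)
      then show ?thesis by simp
    qed
    define uC where "uC x = (\<Sum>c\<in>C. \<xi> c x *\<^sub>R e c)" for x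
    define tB where "tB x = (\<Sum>b\<in>B. \<xi> b x *\<^sub>R e b)" for x
    have split: "x = uC x + tB x" for x
      using rep[of x] unfolding uC_def tB_def sum.union_disjoint[OF fin disj] .
    have nu: "norm (uC x) \<le> X * E" if "\<And>c. c \<in> C \<Longrightarrow> \<bar>\<xi> c x\<bar> = \<bar>\<xi> c v\<bar>" for x
    proof -
      have "norm (uC x) \<le> (\<Sum>c\<in>C. \<bar>\<xi> c x\<bar> * norm (e c))"
        unfolding uC_def using norm_sum[of "\<lambda>c. \<xi> c x *\<^sub>R e c" C] by simp
      also have "\<dots> \<le> X * E" by (rule eE) (use that coordX Y0 in auto)
      finally show ?thesis .
    qed
    note nu = nu[of v, OF refl] nu[of y, OF absy[OF UnI1]]
    have nt: "norm (tB x) \<le> sqrt Y * E" if "\<And>b. b \<in> B \<Longrightarrow> \<bar>\<xi> b x\<bar> = \<bar>\<xi> b v\<bar>" for x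
    proof -
      have "norm (tB x) \<le> (\<Sum>b\<in>B. \<bar>\<xi> b x\<bar> * norm (e b))"
        unfolding tB_def using norm_sum[of "\<lambda>b. \<xi> b x *\<^sub>R e b" B] by simp
      also have "\<dots> \<le> sqrt Y * E" by (rule eE) (use that coordY Y0 in auto)
      finally show ?thesis .
    qed
    note nt = nt[of v, OF refl] nt[of y, OF absy[OF UnI2]]
    have nv: "norm v \<le> R * E" "norm y \<le> R * E"
      using norm_triangle_ineq[of "uC v" "tB v"] norm_triangle_ineq[of "uC y" "tB y"] nu nt
        split[of v] split[of y] unfolding R_def by (simp_all add: distrib_right)
    have "sqrt Y \<le> (\<Sum>b\<in>B. \<bar>\<xi> b v\<bar>)"
      using L2_set_le_sum_abs[of "\<lambda>b. \<xi> b v" B] unfolding L2_set_def Y_def by simp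
    then have "R \<le> (\<Sum>k\<in>C \<union> B. \<bar>\<xi> k v\<bar>)"
      unfolding R_def X_def sum.union_disjoint[OF fin disj] by simp
    then have R: "R \<le> K * norm v" using K(2)[of v] by linarith
    have R0: "R \<ge> 0" "X \<le> R" "sqrt Y \<le> R" unfolding R_def using Y0 by auto
    have RR: "R\<^sup>2 \<le> 2 * (R * X) + 2 * Y"
    proof -
      have "R\<^sup>2 = R * X + R * sqrt Y" unfolding R_def by (simp add: power2_eq_square algebra_simps)
      moreover have "R * sqrt Y = X * sqrt Y + Y" unfolding R_def using Y0 by (simp add: algebra_simps)
      moreover have "X * sqrt Y \<le> X * R" using R0 Y0 by (intro mult_left_mono) auto
      ultimately show ?thesis using Y0 by (simp add: mult.commute)
    qed
    have ny: "norm y \<le> E * K * norm v"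
    proof -
      have "R * E \<le> (K * norm v) * E" using R E by (intro mult_right_mono) auto
      then show ?thesis using nv(2) by (simp add: mult_ac)
    qed
    define v' where "v' = v + s *\<^sub>R y"
    have sy: "norm (s *\<^sub>R y) \<le> norm y" using s by (simp add: mult_left_le_one_le)
    have v'n: "norm v' \<le> norm v + norm y"
      unfolding v'_def using norm_triangle_ineq[of v "s *\<^sub>R y"] sy by linarith
    have vd: "norm v * (1 + E * K) < d"
    proof -
      have "norm v < d / (1 + E * K)" using v unfolding \<delta>_def by simp
      then show ?thesis using EK by (simp add: pos_less_divide_eq)
    qed
    have "norm v * 1 \<le> norm v * (1 + E * K)" using E K by (intro mult_left_mono) auto
    then have vd1: "norm v < d" using vd by linarith
    have "norm v' \<le> norm v * (1 + E * K)" using v'n ny by (simp add: algebra_simps)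
    then have vd2: "norm v' < d" using vd by linarith
    have err: "\<epsilon> * (norm v + norm v') * norm (v' - v) \<le> s * (\<epsilon> * 3 * E\<^sup>2 * R\<^sup>2)"
    proof -
      have "norm v + norm v' \<le> 3 * (R * E)" using v'n nv by linarith
      then have "\<epsilon> * (norm v + norm v') * norm (s *\<^sub>R y) \<le> \<epsilon> * (3 * (R * E)) * (s * (R * E))"
        using \<epsilon> nv(2) s R0 E by (intro mult_mono mult_left_mono) (auto intro!: mult_left_mono)
      then show ?thesis unfolding v'_def by (simp add: power2_eq_square algebra_simps)
    qed
    have lin: "(\<Sum>c\<in>C. w c * (\<xi> c v' - \<xi> c v)) \<le> s * (- w0 * X)"
    proof -
      have "w c * (\<xi> c v' - \<xi> c v) \<le> s * (- w0 * \<bar>\<xi> c v\<bar>)" if c: "c \<in> C" for c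
      proof -
        have "w c * \<xi> c y = - (\<bar>w c\<bar> * \<bar>\<xi> c v\<bar>)"
          unfolding y_def using coord_flip[of c v] c
          by (auto simp: down_def abs_mult[symmetric])
        moreover have "w0 * \<bar>\<xi> c v\<bar> \<le> \<bar>w c\<bar> * \<bar>\<xi> c v\<bar>"
          using w0(2)[OF c] v0[OF c] by (cases "w c = 0") (auto intro: mult_right_mono)
        moreover have "\<xi> c v' - \<xi> c v = s * \<xi> c y" unfolding v'_def using coord_add[of c] c by simp
        ultimately show ?thesis using s(1) mult_left_mono[of "w c * \<xi> c y" "- w0 * \<bar>\<xi> c v\<bar>" s]
          by (simp add: mult.left_commute)
      qed
      then have "(\<Sum>c\<in>C. w c * (\<xi> c v' - \<xi> c v)) \<le> (\<Sum>c\<in>C. s * (- w0 * \<bar>\<xi> c v\<bar>))" by (rule sum_mono)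
      then show ?thesis unfolding X_def by (simp add: sum_distrib_left)
    qed
    have quad: "inner (A (v' + v)) (v' - v) / 2 \<le> s * (- k0 * Y / 2 + 3 * Kh * E\<^sup>2 * (R * X))"
    proof -
      define aT where "aT = 2 *\<^sub>R tB v + s *\<^sub>R tB y"
      define aU where "aU = 2 *\<^sub>R uC v + s *\<^sub>R uC y"
      have "v' + v = 2 *\<^sub>R v + s *\<^sub>R y" unfolding v'_def by (simp add: scaleR_2)
      also have "\<dots> = aT + aU" unfolding aT_def aU_def
        by (subst (1) split[of v], subst (1) split[of y]) (simp add: scaleR_add_right)
      finally have "inner (A (v' + v)) y = inner (A aT) y + inner (A aU) y"
        by (simp add: linear_add[OF A_linear] inner_add_left)
      also have "inner (A aT) y = inner (A aT) (tB y) + inner (A aT) (uC y)"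
        by (subst (1) split[of y]) (simp add: inner_add_right)
      finally have eq: "inner (A (v' + v)) y = inner (A aT) (tB y) + (inner (A aT) (uC y) + inner (A aU) y)"
        by simp
      have "aT = (\<Sum>b\<in>B. (2 * \<xi> b v + s * \<xi> b y) *\<^sub>R e b)"
        unfolding aT_def tB_def by (simp add: scaleR_sum_right scaleR_add_left sum.distrib)
      then have 1: "inner (A aT) (tB y) \<le> - k0 * Y"
        using quadratic_part_descends[OF s k0(2), of v] unfolding tB_def y_def Y_def by simp
      have sle: "s * norm x \<le> norm x" for x :: 'a using s by (simp add: mult_left_le_one_le)
      have naT: "norm aT \<le> 3 * (R * E)"
      proof -
        have "norm aT \<le> 2 * norm (tB v) + norm (tB y)"
          unfolding aT_def using norm_triangle_ineq[of "2 *\<^sub>R tB v" "s *\<^sub>R tB y"] sle[of "tB y"] s by simp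
        moreover have "sqrt Y * E \<le> R * E" using R0 E by (intro mult_right_mono) auto
        ultimately show ?thesis using nt by linarith
      qed
      have naU: "norm aU \<le> 3 * (X * E)"
      proof -
        have "norm aU \<le> 2 * norm (uC v) + norm (uC y)"
          unfolding aU_def using norm_triangle_ineq[of "2 *\<^sub>R uC v" "s *\<^sub>R uC y"] sle[of "uC y"] s by simp
        then show ?thesis using nu by linarith
      qed
      have AB: "inner (A a) b \<le> (x * Kh) * z" if "norm a \<le> x" "norm b \<le> z" for a b x z
      proof -
        have "norm (A a) \<le> x * Kh" using Kh that(1) by (meson mult_right_mono order_trans less_imp_le)
        moreover have "inner (A a) b \<le> norm (A a) * norm b" by (rule norm_cauchy_schwarz)
        ultimately show ?thesis
          using that(2) by (meson mult_mono norm_ge_zero order_trans)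
      qed
      have "inner (A aT) (uC y) \<le> (3 * (R * E) * Kh) * (X * E)" by (rule AB[OF naT nu(2)])
      moreover have "inner (A aU) y \<le> (3 * (X * E) * Kh) * (R * E)" by (rule AB[OF naU nv(2)])
      ultimately have "inner (A (v' + v)) y \<le> - k0 * Y + 6 * Kh * E\<^sup>2 * (R * X)"
        using eq 1 by (simp add: power2_eq_square algebra_simps)
      from mult_left_mono[OF this s(1)] show ?thesis unfolding v'_def by (simp add: algebra_simps)
    qed
    have "F v' - F v \<le> (\<Sum>c\<in>C. w c * (\<xi> c v' - \<xi> c v)) + inner (A (v' + v)) (v' - v) / 2
        + \<epsilon> * (norm v + norm v') * norm (v' - v)"
      using d(2)[OF vd1 vd2] by linarith
    also have "\<dots> \<le> s * (- w0 * X) + s * (- k0 * Y / 2 + 3 * Kh * E\<^sup>2 * (R * X)) + s * (\<epsilon> * 3 * E\<^sup>2 * R\<^sup>2)"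
      using lin quad err by linarith
    also have "\<dots> = s * (- w0 * X - k0 * Y / 2 + 3 * Kh * E\<^sup>2 * (R * X) + (k0 / 8) * R\<^sup>2)"
    proof -
      have "\<epsilon> * 3 * E\<^sup>2 = k0 / 8" using \<epsilon>(2) by simp
      then show ?thesis by (simp add: algebra_simps)
    qed
    also have "\<dots> \<le> s * (- \<eta> * (X + Y))"
    proof (rule mult_left_mono[OF _ s(1)])
      have "(k0 / 8) * R\<^sup>2 \<le> (k0 / 8) * (2 * (R * X) + 2 * Y)"
        using RR k0(1) by (intro mult_left_mono) auto
      moreover have "(3 * Kh * E\<^sup>2 + k0 / 4) * (R * X) \<le> w0 / 2 * X"
      proof -
        have "(3 * Kh * E\<^sup>2 + k0 / 4) * R \<le> (3 * Kh * E\<^sup>2 + k0 / 4) * (K * norm v)"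
          using R Kh k0 E2 by (intro mult_left_mono) auto
        also have "\<dots> = Q * norm v" unfolding Q_def by simp
        also have "\<dots> \<le> Q * (w0 / (2 * Q))" using v Q unfolding \<delta>_def by (intro mult_left_mono) auto
        also have "\<dots> = w0 / 2" using Q by simp
        finally have "(3 * Kh * E\<^sup>2 + k0 / 4) * R * X \<le> w0 / 2 * X" using Y0 by (intro mult_right_mono)
        then show ?thesis by (simp add: mult.assoc)
      qed
      moreover have "\<eta> * X \<le> w0 / 2 * X" "\<eta> * Y \<le> k0 / 4 * Y"
        unfolding \<eta>_def using Y0 by (intro mult_right_mono; simp)+
      ultimately show "- w0 * X - k0 * Y / 2 + 3 * Kh * E\<^sup>2 * (R * X) + (k0 / 8) * R\<^sup>2 \<le> - \<eta> * (X + Y)"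
        by (simp add: algebra_simps)
    qed
    finally show ?thesis unfolding v'_def y_def X_def Y_def mass_def by (simp add: algebra_simps)
  qed
  then show ?thesis using \<delta> \<eta> by (intro exI[of _ \<delta>] conjI exI[of _ \<eta>]) auto
qed

lemma flip_scale: "a > 0 \<Longrightarrow> flip (a *\<^sub>R v) = a *\<^sub>R flip v"
proof (rule coord_eqI)
  fix k assume a: "a > 0" and k: "k \<in> C \<union> B"
  have [simp]: "\<xi> k (a *\<^sub>R x) = a * \<xi> k x" for x using \<xi>_linear[OF k] by (simp add: linear_scale)
  have "down k (a *\<^sub>R v) = down k v"
    unfolding down_def using a by (simp add: mult.left_commute mult_le_0_iff)
  then show "\<xi> k (flip (a *\<^sub>R v)) = \<xi> k (a *\<^sub>R flip v)" by (simp add: coord_flip[OF k])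
qed

lemma flip_bound: "\<exists>K>0. \<forall>v. norm (flip v) \<le> K * norm v"
proof -
  obtain K where K: "K > 0" "\<And>v. (\<Sum>k\<in>C \<union> B. \<bar>\<xi> k v\<bar>) \<le> K * norm v" using coord_bound by blast
  define E where "E = (\<Sum>k\<in>C \<union> B. norm (e k)) + 1"
  have E: "E > 0" unfolding E_def by (simp add: sum_nonneg add_nonneg_pos)
  have "norm (flip v) \<le> (E * K) * norm v" for v
  proof -
    have "norm (flip v) \<le> (\<Sum>k\<in>C \<union> B. \<bar>\<xi> k v\<bar> * norm (e k))"
      unfolding flip_def by (rule order_trans[OF norm_sum]) (auto intro!: sum_mono)
    also have "\<dots> \<le> (\<Sum>k\<in>C \<union> B. \<bar>\<xi> k v\<bar> * E)"
    proof (intro sum_mono mult_left_mono)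
      fix k assume "k \<in> C \<union> B"
      then have "norm (e k) \<le> (\<Sum>k\<in>C \<union> B. norm (e k))"
        using fin by (intro member_le_sum) auto
      then show "norm (e k) \<le> E" unfolding E_def by simp
    qed simp
    also have "\<dots> = E * (\<Sum>k\<in>C \<union> B. \<bar>\<xi> k v\<bar>)" by (simp add: sum_distrib_left mult.commute)
    also have "\<dots> \<le> E * (K * norm v)" using K(2) E by (intro mult_left_mono) auto
    finally show ?thesis by (simp add: mult_ac)
  qed
  then show ?thesis using E K(1) by (intro exI[of _ "E * K"]) auto
qed

end

text \<open>Indices in \<open>Eq\<close> carry equations, those in \<open>In\<close> inequalities,
  and \<open>s1 m\<close>, \<open>s2 m\<close> are the two axes of a cross.\<close>

locale normal_cone = normal_coordinates C B e \<xi> w A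
  for C B :: "'k set" and e :: "'k \<Rightarrow> 'a::euclidean_space" and \<xi> w A +
  fixes Eq In :: "'k set" and P :: "'m set" and s1 s2 :: "'m \<Rightarrow> 'k"
  assumes C_eq: "C = Eq \<union> In \<union> s1 ` P \<union> s2 ` P"
    and finP: "finite P"
    and s_inj: "inj_on s1 P" "inj_on s2 P"
    and s_disj: "s1 ` P \<inter> s2 ` P = {}" "(Eq \<union> In) \<inter> (s1 ` P \<union> s2 ` P) = {}"
    and w_In: "c \<in> In \<Longrightarrow> w c > 0"
    and w_pair: "m \<in> P \<Longrightarrow> w (s1 m) \<noteq> 0" "m \<in> P \<Longrightarrow> w (s2 m) \<noteq> 0"
begin

definition cone :: "'a set" where
  "cone = {v. (\<forall>c\<in>Eq. \<xi> c v = 0) \<and> (\<forall>c\<in>In. \<xi> c v \<ge> 0) \<and> (\<forall>m\<in>P. \<xi> (s1 m) v * \<xi> (s2 m) v = 0)}"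

definition Bneg :: "'k set" where "Bneg = {b\<in>B. \<kappa> b < 0}"

definition Z :: "'a set" where "Z = span (e ` (s1 ` P \<union> Bneg))"

text \<open>On each cross one ray of each axis lowers the model. The map \<open>\<theta>\<close>
  folds a line onto these two rays, the positive half onto the axis \<open>s1 m\<close> and the
  negative half onto the axis \<open>s2 m\<close>, and keeps the negative directions of the
  quadratic form. It identifies the linear space \<open>Z\<close> with the vectors of the cone that
  have only down coordinates, which are the fixed points of \<open>flip\<close>; the inverse is
  \<open>\<zeta>\<close>.\<close>

definition \<theta> :: "'a \<Rightarrow> 'a" where
  "\<theta> x = (\<Sum>m\<in>P. (- sgn (w (s1 m)) * max (\<xi> (s1 m) x) 0) *\<^sub>R e (s1 m)
                + (- sgn (w (s2 m)) * max (- \<xi> (s1 m) x) 0) *\<^sub>R e (s2 m))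
        + (\<Sum>b\<in>Bneg. \<xi> b x *\<^sub>R e b)"

definition \<zeta> :: "'a \<Rightarrow> 'a" where
  "\<zeta> v = (\<Sum>m\<in>P. (\<bar>\<xi> (s1 m) v\<bar> - \<bar>\<xi> (s2 m) v\<bar>) *\<^sub>R e (s1 m)) + (\<Sum>b\<in>Bneg. \<xi> b v *\<^sub>R e b)"

lemma index_sets:
  "c \<in> Eq \<Longrightarrow> c \<in> C \<union> B" "c \<in> In \<Longrightarrow> c \<in> C \<union> B" "m \<in> P \<Longrightarrow> s1 m \<in> C \<union> B" "m \<in> P \<Longrightarrow> s2 m \<in> C \<union> B"
  "b \<in> Bneg \<Longrightarrow> b \<in> C \<union> B"
  "c \<in> Eq \<Longrightarrow> c \<in> C" "c \<in> In \<Longrightarrow> c \<in> C" "m \<in> P \<Longrightarrow> s1 m \<in> C" "m \<in> P \<Longrightarrow> s2 m \<in> C" "b \<in> Bneg \<Longrightarrow> b \<in> B"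
  unfolding C_eq Bneg_def by auto

lemma fin_Bneg: "finite Bneg" unfolding Bneg_def using fin by simp

lemma coord_two_sums:
  assumes k: "k \<in> C \<union> B"
  shows "\<xi> k ((\<Sum>m\<in>P. a m *\<^sub>R e (s1 m) + b m *\<^sub>R e (s2 m)) + (\<Sum>l\<in>Bneg. c l *\<^sub>R e l))
    = (\<Sum>m\<in>P. a m * (if k = s1 m then 1 else 0) + b m * (if k = s2 m then 1 else 0))
      + (\<Sum>l\<in>Bneg. c l * (if k = l then 1 else 0))"
  using \<xi>_linear[OF k] dual[OF k] index_sets
  by (simp add: linear_add linear_sum linear_scale)

lemma coord_two_sums_cases:
  fixes a b :: "'m \<Rightarrow> real" and c :: "'k \<Rightarrow> real"
  defines "x \<equiv> (\<Sum>m\<in>P. a m *\<^sub>R e (s1 m) + b m *\<^sub>R e (s2 m)) + (\<Sum>l\<in>Bneg. c l *\<^sub>R e l)"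
  shows "m \<in> P \<Longrightarrow> \<xi> (s1 m) x = a m" "m \<in> P \<Longrightarrow> \<xi> (s2 m) x = b m"
    "l \<in> Bneg \<Longrightarrow> \<xi> l x = c l"
    "k \<in> C \<union> B \<Longrightarrow> k \<notin> s1 ` P \<union> s2 ` P \<union> Bneg \<Longrightarrow> \<xi> k x = 0"
proof -
  have CB: "Bneg \<inter> C = {}" using disj index_sets by blast
  show "\<xi> (s1 m) x = a m" if m: "m \<in> P"
  proof -
    have "(\<Sum>m'\<in>P. a m' * (if s1 m = s1 m' then 1 else 0) + b m' * (if s1 m = s2 m' then 1 else 0))
        = (\<Sum>m'\<in>P. if m' = m then a m else 0)"
      using s_inj(1) s_disj(1) m by (intro sum.cong refl) (auto simp: inj_on_eq_iff)
    moreover have "(\<Sum>l\<in>Bneg. c l * (if s1 m = l then 1 else 0)) = 0"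
      using CB index_sets(8)[OF m] by (intro sum.neutral) auto
    ultimately show ?thesis unfolding x_def coord_two_sums[OF index_sets(3)[OF m]] using m finP by simp
  qed
  show "\<xi> (s2 m) x = b m" if m: "m \<in> P"
  proof -
    have "(\<Sum>m'\<in>P. a m' * (if s2 m = s1 m' then 1 else 0) + b m' * (if s2 m = s2 m' then 1 else 0))
        = (\<Sum>m'\<in>P. if m' = m then b m else 0)"
      using s_inj(2) s_disj(1) m by (intro sum.cong refl) (auto simp: inj_on_eq_iff)
    moreover have "(\<Sum>l\<in>Bneg. c l * (if s2 m = l then 1 else 0)) = 0"
      using CB index_sets(9)[OF m] by (intro sum.neutral) auto
    ultimately show ?thesis unfolding x_def coord_two_sums[OF index_sets(4)[OF m]] using m finP by simp
  qed
  show "\<xi> l x = c l" if l: "l \<in> Bneg"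
  proof -
    have "(\<Sum>m'\<in>P. a m' * (if l = s1 m' then 1 else 0) + b m' * (if l = s2 m' then 1 else 0)) = 0"
      using CB index_sets(8,9) l by (intro sum.neutral) auto
    moreover have "(\<Sum>l'\<in>Bneg. c l' * (if l = l' then 1 else 0)) = (\<Sum>l'\<in>Bneg. if l' = l then c l else 0)"
      by (intro sum.cong refl) auto
    ultimately show ?thesis unfolding x_def coord_two_sums[OF index_sets(5)[OF l]] using l fin_Bneg by simp
  qed
  show "\<xi> k x = 0" if k: "k \<in> C \<union> B" "k \<notin> s1 ` P \<union> s2 ` P \<union> Bneg"
  proof -
    have "(\<Sum>m'\<in>P. a m' * (if k = s1 m' then 1 else 0) + b m' * (if k = s2 m' then 1 else 0)) = 0"
      using k by (intro sum.neutral) auto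
    moreover have "(\<Sum>l\<in>Bneg. c l * (if k = l then 1 else 0)) = 0"
      using k by (intro sum.neutral) auto
    ultimately show ?thesis unfolding x_def coord_two_sums[OF k(1)] by simp
  qed
qed

lemmas coord_\<theta> = coord_two_sums_cases[where a = "\<lambda>m. - sgn (w (s1 m)) * max (\<xi> (s1 m) x) 0"
    and b = "\<lambda>m. - sgn (w (s2 m)) * max (- \<xi> (s1 m) x) 0" and c = "\<lambda>b. \<xi> b x" for x, folded \<theta>_def]

lemma \<zeta>_eq: "\<zeta> v = (\<Sum>m\<in>P. (\<bar>\<xi> (s1 m) v\<bar> - \<bar>\<xi> (s2 m) v\<bar>) *\<^sub>R e (s1 m) + 0 *\<^sub>R e (s2 m)) + (\<Sum>b\<in>Bneg. \<xi> b v *\<^sub>R e b)"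
  unfolding \<zeta>_def by simp

lemmas coord_\<zeta> = coord_two_sums_cases[where a = "\<lambda>m. \<bar>\<xi> (s1 m) v\<bar> - \<bar>\<xi> (s2 m) v\<bar>"
    and b = "\<lambda>m. 0" and c = "\<lambda>b. \<xi> b v" for v, folded \<zeta>_eq]

lemma C_cases:
  assumes "k \<in> C \<union> B"
  obtains "k \<in> Eq" | "k \<in> In" | m where "m \<in> P" "k = s1 m" | m where "m \<in> P" "k = s2 m"
    | "k \<in> Bneg" | "k \<in> B" "k \<notin> Bneg" "\<kappa> k > 0" "k \<notin> C"
proof -
  have "\<kappa> k > 0" if "k \<in> B" "k \<notin> Bneg"
    using that A_nondeg[of k] unfolding Bneg_def \<kappa>_def by force
  then show ?thesis using assms that disj unfolding C_eq by blast
qed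

lemma cone_w0: "v \<in> cone \<Longrightarrow> c \<in> C \<Longrightarrow> w c = 0 \<Longrightarrow> \<xi> c v = 0"
  unfolding cone_def C_eq using w_In w_pair by force

text \<open>Every condition that defines the cone survives independent nonnegative rescaling of the
  coordinates, and \<open>v + s *\<^sub>R flip v\<close> is such a rescaling of
  \<open>v\<close>.\<close>

lemma cone_rescale:
  assumes v: "v \<in> cone" and a: "\<And>k. k \<in> C \<Longrightarrow> \<exists>t\<ge>0. \<xi> k v' = t * \<xi> k v"
  shows "v' \<in> cone"
  unfolding cone_def
proof (intro CollectI conjI ballI)
  fix c assume "c \<in> Eq" then show "\<xi> c v' = 0"
    using v a[of c] index_sets(6) unfolding cone_def by force
next
  fix c assume "c \<in> In" then show "\<xi> c v' \<ge> 0"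
    using v a[of c] index_sets(7) unfolding cone_def by force
next
  fix m assume m: "m \<in> P"
  then have "\<xi> (s1 m) v * \<xi> (s2 m) v = 0" using v unfolding cone_def by blast
  then show "\<xi> (s1 m) v' * \<xi> (s2 m) v' = 0"
    using a[OF index_sets(8)[OF m]] a[OF index_sets(9)[OF m]] by auto
qed

lemma cone_flip_path:
  assumes "v \<in> cone" "0 \<le> s" "s \<le> 1"
  shows "v + s *\<^sub>R flip v \<in> cone"
proof (rule cone_rescale[OF assms(1)])
  fix k assume "k \<in> C"
  then have k: "k \<in> C \<union> B" by simp
  have "\<xi> k (v + s *\<^sub>R flip v) = (if down k v then 1 + s else 1 - s) * \<xi> k v"
    unfolding coord_add[OF k] coord_flip[OF k] by (simp add: algebra_simps)
  then show "\<exists>t\<ge>0. \<xi> k (v + s *\<^sub>R flip v) = t * \<xi> k v"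
    using assms by (intro exI[of _ "if down k v then 1 + s else 1 - s"]) auto
qed

lemma cone_flip_descent:
  assumes "expands F"
  obtains \<delta> \<eta> where "\<delta> > 0" "\<eta> > 0" "\<And>v s. v \<in> cone \<Longrightarrow> norm v < \<delta> \<Longrightarrow> 0 \<le> s \<Longrightarrow> s \<le> 1 \<Longrightarrow>
      F (v + s *\<^sub>R flip v) \<le> F v - s * \<eta> * mass v"
proof -
  obtain \<delta> \<eta> where "\<delta> > 0" "\<eta> > 0" "\<And>v s. norm v < \<delta> \<Longrightarrow> (\<forall>c\<in>C. w c = 0 \<longrightarrow> \<xi> c v = 0) \<Longrightarrow> s \<in> {0..1} \<Longrightarrow>
      F (v + s *\<^sub>R flip v) \<le> F v - s * \<eta> * mass v"
    using flip_descent[OF assms] by blast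
  then show ?thesis using cone_w0 by (intro that[of \<delta> \<eta>]) auto
qed

lemma cone_scale:
  assumes "v \<in> cone" "0 \<le> s"
  shows "s *\<^sub>R v \<in> cone"
proof (rule cone_rescale[OF assms(1)])
  fix k assume "k \<in> C"
  then show "\<exists>t\<ge>0. \<xi> k (s *\<^sub>R v) = t * \<xi> k v"
    using \<xi>_linear[of k] assms(2) by (intro exI[of _ s]) (simp add: linear_scale)
qed

lemma flip_add_flip: "flip (v + flip v) = v + flip v"
proof (rule coord_eqI)
  fix k assume k: "k \<in> C \<union> B"
  have a: "\<xi> k (v + flip v) = (if down k v then 2 * \<xi> k v else 0)"
    using coord_add[OF k, of v 1 "flip v"] coord_flip[OF k, of v] by simp
  show "\<xi> k (flip (v + flip v)) = \<xi> k (v + flip v)"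
  proof (cases "down k v")
    case True
    then have "down k (v + flip v)" unfolding down_def a by (auto simp: mult.left_commute)
    then show ?thesis by (simp add: coord_flip[OF k])
  qed (simp add: coord_flip[OF k] a)
qed

lemma \<theta>_in_cone: "\<theta> x \<in> cone"
  unfolding cone_def
proof (intro CollectI conjI ballI)
  have out: "c \<notin> s1 ` P \<union> s2 ` P \<union> Bneg" if "c \<in> Eq \<union> In" for c
    using that s_disj(2) disj index_sets(6,7,10) by blast
  fix c assume "c \<in> Eq" then show "\<xi> c (\<theta> x) = 0" using coord_\<theta>(4) out index_sets(1) by blast
next
  have out: "c \<notin> s1 ` P \<union> s2 ` P \<union> Bneg" if "c \<in> Eq \<union> In" for c
    using that s_disj(2) disj index_sets(6,7,10) by blast
  fix c assume "c \<in> In" then show "\<xi> c (\<theta> x) \<ge> 0" using coord_\<theta>(4) out index_sets(2) by (metis UnI2 order_refl)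
next
  fix m assume "m \<in> P" then show "\<xi> (s1 m) (\<theta> x) * \<xi> (s2 m) (\<theta> x) = 0"
    by (simp add: coord_\<theta> max_def)
qed

lemma flip_\<theta>: "flip (\<theta> x) = \<theta> x"
proof (rule coord_eqI)
  fix k assume k: "k \<in> C \<union> B"
  have sgn: "y * (sgn y * max z 0) \<ge> 0" for y z :: real
    by (auto simp: mult.assoc[symmetric] mult_sgn_abs abs_sgn[symmetric] max_def)
  have "down k (\<theta> x) \<or> \<xi> k (\<theta> x) = 0"
  proof (cases "k \<in> s1 ` P \<union> s2 ` P \<union> Bneg")
    case True
    then consider m where "m \<in> P" "k = s1 m" | m where "m \<in> P" "k = s2 m" | "k \<in> Bneg" by blast
    then show ?thesis
    proof cases
      case (1 m) then show ?thesis using sgn index_sets(8) by (simp add: down_def coord_\<theta>)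
    next
      case (2 m) then show ?thesis using sgn index_sets(9) by (simp add: down_def coord_\<theta>)
    next
      case 3
      then have "k \<notin> C" using disj index_sets(10) by blast
      then show ?thesis using 3 by (simp add: down_def Bneg_def)
    qed
  qed (use coord_\<theta>(4)[OF k] in auto)
  then show "\<xi> k (flip (\<theta> x)) = \<xi> k (\<theta> x)" by (auto simp: coord_flip[OF k])
qed

text \<open>On a fixed point of \<open>flip\<close> a coordinate that is not down vanishes. For an
  inequality the signs of the coordinate and of its weight leave only 0, and on a cross the signs
  leave only the two lowering rays.\<close>

lemma \<theta>_\<zeta>:
  assumes v: "v \<in> cone" "flip v = v"
  shows "\<theta> (\<zeta> v) = v"
proof (rule coord_eqI)
  have fixed: "down k v \<or> \<xi> k v = 0" if "k \<in> C \<union> B" for k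
    using coord_flip[OF that, of v] v(2) by (auto split: if_splits)
  have le: "w k * \<xi> k v \<le> 0" if "k \<in> C" for k using fixed[of k] that by (auto simp: down_def)
  fix k assume k: "k \<in> C \<union> B"
  then show "\<xi> k (\<theta> (\<zeta> v)) = \<xi> k v"
  proof (cases rule: C_cases)
    case 1
    then have "k \<notin> s1 ` P \<union> s2 ` P \<union> Bneg" using s_disj(2) disj index_sets(6,10) by blast
    then show ?thesis using coord_\<theta>(4)[OF k] 1 v(1) unfolding cone_def by simp
  next
    case 2
    then have "k \<notin> s1 ` P \<union> s2 ` P \<union> Bneg" using s_disj(2) disj index_sets(7,10) by blast
    moreover have "\<xi> k v \<ge> 0" using v(1) 2 unfolding cone_def by blast
    then have "\<xi> k v = 0" using le[OF index_sets(7)[OF 2]] w_In[OF 2] by (simp add: mult_le_0_iff)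
    ultimately show ?thesis using coord_\<theta>(4)[OF k] by simp
  next
    case (3 m)
    have "\<xi> (s1 m) v * \<xi> (s2 m) v = 0" using v(1) 3(1) unfolding cone_def by blast
    then show ?thesis using le[of "s1 m"] w_pair(1)[OF 3(1)] index_sets(8)[OF 3(1)]
      by (auto simp: 3 coord_\<theta> coord_\<zeta> max_def sgn_if mult_le_0_iff)
  next
    case (4 m)
    have "\<xi> (s1 m) v * \<xi> (s2 m) v = 0" using v(1) 4(1) unfolding cone_def by blast
    then show ?thesis using le[of "s2 m"] w_pair(2)[OF 4(1)] index_sets(9)[OF 4(1)]
      by (auto simp: 4 coord_\<theta> coord_\<zeta> max_def sgn_if mult_le_0_iff)
  next
    case 5 then show ?thesis by (simp add: coord_\<theta> coord_\<zeta>)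
  next
    case 6
    then have "k \<notin> s1 ` P \<union> s2 ` P \<union> Bneg" using index_sets(8,9) by blast
    moreover have "\<not> down k v" using 6 by (simp add: down_def)
    ultimately show ?thesis using coord_\<theta>(4)[OF k] fixed[OF k] by simp
  qed
qed

lemma \<zeta>_in_Z: "\<zeta> v \<in> Z"
  unfolding \<zeta>_def Z_def by (intro span_add span_sum span_scale span_base) auto

lemma \<theta>_eq_0:
  assumes x: "x \<in> Z" "\<theta> x = 0"
  shows "x = 0"
proof (rule coord_eqI)
  fix k assume k: "k \<in> C \<union> B"
  have "\<xi> k x = 0"
  proof (cases "k \<in> s1 ` P \<union> Bneg")
    case False
    have "\<forall>y\<in>e ` (s1 ` P \<union> Bneg). \<xi> k y = 0" using False dual[OF k] index_sets(3,5) by auto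
    then show ?thesis using linear_eq_0_on_span[OF \<xi>_linear[OF k]] x(1) unfolding Z_def by blast
  next
    case True
    then consider m where "m \<in> P" "k = s1 m" | "k \<in> Bneg" by blast
    then show ?thesis
    proof cases
      case (1 m)
      have "- sgn (w (s1 m)) * max (\<xi> (s1 m) x) 0 = 0" "- sgn (w (s2 m)) * max (- \<xi> (s1 m) x) 0 = 0"
        using coord_\<theta>(1,2)[OF 1(1), of x] x(2) coord_zero index_sets(3,4)[OF 1(1)] by auto
      then show ?thesis using w_pair[OF 1(1)] unfolding 1(2) by (auto simp: sgn_zero_iff max_def split: if_splits)
    next
      case 2
      then show ?thesis using coord_\<theta>(3)[OF 2, of x] x(2) coord_zero[OF k] by simp
    qed
  qed
  then show "\<xi> k x = \<xi> k 0" using coord_zero[OF k] by simp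
qed

lemma coord_continuous: "k \<in> C \<union> B \<Longrightarrow> continuous_on S (\<xi> k)"
  using \<xi>_linear by (simp add: linear_continuous_on linear_conv_bounded_linear)

lemma \<theta>_continuous: "continuous_on S \<theta>"
  unfolding \<theta>_def[abs_def] by (intro continuous_intros coord_continuous index_sets)

lemma \<zeta>_continuous: "continuous_on S \<zeta>"
  unfolding \<zeta>_def[abs_def] by (intro continuous_intros coord_continuous index_sets)

lemma \<theta>_0: "\<theta> 0 = 0" and \<zeta>_0: "\<zeta> 0 = 0"
proof -
  have "\<xi> (s1 m) 0 = 0" "\<xi> (s2 m) 0 = 0" if "m \<in> P" for m using coord_zero index_sets(3,4) that by auto
  moreover have "\<xi> b 0 = 0" if "b \<in> Bneg" for b using coord_zero index_sets(5) that by auto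
  ultimately show "\<theta> 0 = 0" "\<zeta> 0 = 0" unfolding \<theta>_def \<zeta>_def by auto
qed

lemma dim_Z: "dim Z = card P + card Bneg"
proof -
  define J where "J = s1 ` P \<union> Bneg"
  have J: "J \<subseteq> C \<union> B" "finite J" unfolding J_def using index_sets finP fin_Bneg by auto
  have inj: "inj_on e J"
  proof (rule inj_onI)
    fix k l assume kl: "k \<in> J" "l \<in> J" "e k = e l"
    then have "k \<in> C \<union> B" "l \<in> C \<union> B" using J(1) by blast+
    then show "k = l" using dual[of k k] dual[of k l] kl(3) by (auto split: if_splits)
  qed
  have "independent (e ` J)"
    unfolding independent_explicit
  proof (intro conjI allI impI ballI)
    fix u y assume u: "(\<Sum>v\<in>e ` J. u v *\<^sub>R v) = 0" and "y \<in> e ` J"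
    then obtain k where k: "k \<in> J" "y = e k" by blast
    have kCB: "k \<in> C \<union> B" using k J by blast
    have "0 = \<xi> k (\<Sum>l\<in>J. u (e l) *\<^sub>R e l)" using u coord_zero[OF kCB] by (simp add: sum.reindex[OF inj])
    also have "\<dots> = (\<Sum>l\<in>J. u (e l) * \<xi> k (e l))"
      using \<xi>_linear[OF kCB] by (simp add: linear_sum linear_scale)
    also have "\<dots> = (\<Sum>l\<in>J. if l = k then u (e k) else 0)"
      using J(1) by (intro sum.cong refl) (auto simp: dual[OF kCB] subset_iff)
    finally show "u y = 0" using k J(2) by simp
  qed (use J in simp)
  then have "dim (e ` J) = card (e ` J)" by (rule dim_eq_card_independent)
  also have "\<dots> = card J" by (rule card_image[OF inj])
  also have "\<dots> = card (s1 ` P) + card Bneg"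
    unfolding J_def using finP fin_Bneg disj index_sets(8,10) by (intro card_Un_disjoint) auto
  finally show ?thesis unfolding Z_def J_def dim_span using card_image[OF s_inj(1)] by simp
qed

text \<open>For a fixed point \<open>v\<close> of \<open>flip\<close> the descent from \<open>v /
  2\<close> ends at \<open>v\<close>. Halving repeatedly, the values of \<open>F\<close> increase to
  \<open>F 0\<close>, with a strict first step.\<close>

lemma down_directions_lower:
  assumes F: "expands F" "isCont F 0"
  shows "\<exists>\<delta>>0. \<forall>v\<in>cone. norm v < \<delta> \<longrightarrow> flip v = v \<longrightarrow> v \<noteq> 0 \<longrightarrow> F v < F 0"
proof -
  obtain \<delta> \<eta> where d: "\<delta> > 0" "\<eta> > 0" "\<And>v s. v \<in> cone \<Longrightarrow> norm v < \<delta> \<Longrightarrow> 0 \<le> s \<Longrightarrow> s \<le> 1 \<Longrightarrow>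
      F (v + s *\<^sub>R flip v) \<le> F v - s * \<eta> * mass v"
    by (rule cone_flip_descent[OF F(1)]) (rule that)
  have "F v < F 0" if v: "v \<in> cone" "norm v < \<delta>" "flip v = v" "v \<noteq> 0" for v
  proof -
    define u where "u n = (1 / 2 ^ n) *\<^sub>R v" for n :: nat
    have step: "F (u n) \<le> F (u (Suc n)) - \<eta> * mass (u (Suc n))" for n
    proof -
      have "flip (u (Suc n)) = u (Suc n)" unfolding u_def using flip_scale v(3) by simp
      moreover have "u (Suc n) + u (Suc n) = u n"
        unfolding u_def by (simp flip: scaleR_add_left)
      moreover have "u (Suc n) \<in> cone" unfolding u_def by (intro cone_scale v) simp
      moreover have "norm (u (Suc n)) < \<delta>"
      proof -
        have "norm (u (Suc n)) = norm v / 2 ^ Suc n" unfolding u_def by simp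
        also have "\<dots> \<le> norm v / 1" by (intro divide_left_mono) (auto intro: one_le_power simp del: power_Suc)
        finally show ?thesis using v(2) by simp
      qed
      ultimately show ?thesis using d(3)[of "u (Suc n)" 1] by simp
    qed
    have mono: "F (u 1) \<le> F (u (Suc n))" for n
    proof (induction n)
      case (Suc n)
      have "0 \<le> \<eta> * mass (u (Suc (Suc n)))" using mass_nonneg d(2) by simp
      then show ?case using Suc step[of "Suc n"] by linarith
    qed simp
    have "u \<longlonglongrightarrow> 0 *\<^sub>R v"
      unfolding u_def[abs_def] by (intro tendsto_intros LIMSEQ_divide_realpow_zero) simp
    then have "(\<lambda>n. F (u (Suc n))) \<longlonglongrightarrow> F 0"
      using isCont_tendsto_compose[OF F(2), of u sequentially] LIMSEQ_Suc by simp
    then have "F (u 1) \<le> F 0" using mono by (intro LIMSEQ_le_const) auto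
    moreover have "mass (u 1) > 0"
      using mass_nonneg[of "u 1"] mass_eq_0[of "u 1"] v(4) unfolding u_def by fastforce
    then have "0 < \<eta> * mass (u 1)" using d(2) by (rule mult_pos_pos[rotated])
    moreover have "F (u 0) \<le> F (u 1) - \<eta> * mass (u 1)" using step[of 0] by simp
    ultimately have "F (u 0) < F 0" by linarith
    then show ?thesis unfolding u_def by simp
  qed
  then show ?thesis using d(1) by blast
qed

text \<open>A lower point \<open>v\<close> descends along the segment to \<open>v + flip v\<close>.
  This endpoint is nonzero because it is still lower, and it lies in the image of
  \<open>\<theta>\<close>.\<close>

lemma lower_points_reach_Z:
  assumes F: "expands F" "isCont F 0" and r: "r > 0"
  obtains \<delta> \<epsilon> where "\<delta> > 0" "\<epsilon> > 0"
    "\<And>x. x \<in> Z \<Longrightarrow> norm x < \<epsilon> \<Longrightarrow> x \<noteq> 0 \<Longrightarrow> \<theta> x \<in> {v\<in>cone. norm v < r \<and> F v < F 0}"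
    "\<And>v. v \<in> cone \<Longrightarrow> norm v < \<delta> \<Longrightarrow> F v < F 0 \<Longrightarrow>
       \<exists>x\<in>Z. norm x < \<epsilon> \<and> x \<noteq> 0 \<and> path_component {v\<in>cone. norm v < r \<and> F v < F 0} v (\<theta> x)"
proof -
  let ?L = "{v\<in>cone. norm v < r \<and> F v < F 0}"
  obtain \<delta>1 \<eta> where d1: "\<delta>1 > 0" "\<eta> > 0" "\<And>v s. v \<in> cone \<Longrightarrow> norm v < \<delta>1 \<Longrightarrow> 0 \<le> s \<Longrightarrow> s \<le> 1 \<Longrightarrow>
      F (v + s *\<^sub>R flip v) \<le> F v - s * \<eta> * mass v"
    by (rule cone_flip_descent[OF F(1)]) (rule that)
  obtain \<delta>2 where d2: "\<delta>2 > 0" "\<And>v. v \<in> cone \<Longrightarrow> norm v < \<delta>2 \<Longrightarrow> flip v = v \<Longrightarrow> v \<noteq> 0 \<Longrightarrow> F v < F 0"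
    using down_directions_lower[OF F] by blast
  obtain K where K: "K > 0" "\<And>v. norm (flip v) \<le> K * norm v" using flip_bound by blast
  have "isCont \<theta> 0" "isCont \<zeta> 0"
    using \<theta>_continuous[of UNIV] \<zeta>_continuous[of UNIV] by (auto simp: continuous_on_eq_continuous_at)
  then have c: "\<And>\<epsilon>. \<epsilon> > 0 \<Longrightarrow> \<exists>d>0. \<forall>x. norm x < d \<longrightarrow> norm (\<theta> x) < \<epsilon>"
    "\<And>\<epsilon>. \<epsilon> > 0 \<Longrightarrow> \<exists>d>0. \<forall>x. norm x < d \<longrightarrow> norm (\<zeta> x) < \<epsilon>"
    unfolding continuous_at_eps_delta by (auto simp: \<theta>_0 \<zeta>_0)
  define m where "m = min r \<delta>2"
  have m: "m > 0" "m \<le> r" "m \<le> \<delta>2" unfolding m_def using r d2 by auto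
  obtain \<epsilon> where e: "\<epsilon> > 0" "\<And>x. norm x < \<epsilon> \<Longrightarrow> norm (\<theta> x) < m" using c(1)[OF m(1)] by blast
  obtain \<delta>3 where d3: "\<delta>3 > 0" "\<And>x. norm x < \<delta>3 \<Longrightarrow> norm (\<zeta> x) < \<epsilon>" using c(2)[OF e(1)] by blast
  define \<delta> where "\<delta> = min \<delta>1 (min r \<delta>3 / (1 + K))"
  have "\<delta> > 0" unfolding \<delta>_def using d1 d3 r K by simp
  moreover have "\<theta> x \<in> ?L" if x: "x \<in> Z" "norm x < \<epsilon>" "x \<noteq> 0" for x
  proof -
    have "\<theta> x \<noteq> 0" using \<theta>_eq_0 x by blast
    then show ?thesis using d2(2)[OF \<theta>_in_cone _ flip_\<theta>, of x] e(2)[OF x(2)] m \<theta>_in_cone[of x] by auto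
  qed
  moreover have "\<exists>x\<in>Z. norm x < \<epsilon> \<and> x \<noteq> 0 \<and> path_component ?L v (\<theta> x)"
    if v: "v \<in> cone" "norm v < \<delta>" "F v < F 0" for v
  proof -
    have vd: "norm v < \<delta>1" "norm v * (1 + K) < min r \<delta>3"
      using v(2) K(1) unfolding \<delta>_def by (simp_all add: pos_less_divide_eq)
    have small: "norm (v + s *\<^sub>R flip v) < min r \<delta>3" "v + s *\<^sub>R flip v \<in> cone" "F (v + s *\<^sub>R flip v) \<le> F v"
      if s: "0 \<le> s" "s \<le> 1" for s
    proof -
      have "norm (s *\<^sub>R flip v) \<le> norm (flip v)" using s by (simp add: mult_left_le_one_le)
      then have "norm (v + s *\<^sub>R flip v) \<le> norm v + K * norm v"
        using norm_triangle_ineq[of v "s *\<^sub>R flip v"] K(2)[of v] by linarith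
      then show "norm (v + s *\<^sub>R flip v) < min r \<delta>3" using vd(2) by (simp add: algebra_simps)
      show "v + s *\<^sub>R flip v \<in> cone" using cone_flip_path[OF v(1) s] .
      have "0 \<le> s * \<eta> * mass v" using s d1(2) mass_nonneg by simp
      then show "F (v + s *\<^sub>R flip v) \<le> F v" using d1(3)[OF v(1) vd(1) s] by linarith
    qed
    define q where "q = v + flip v"
    have q: "norm q < \<delta>3" "q \<in> cone" "F q \<le> F v" using small[of 1] unfolding q_def by auto
    have fq: "flip q = q" unfolding q_def by (rule flip_add_flip)
    have q0: "q \<noteq> 0" using q(3) v(3) by auto
    have \<theta>q: "\<theta> (\<zeta> q) = q" by (rule \<theta>_\<zeta>[OF q(2) fq])
    have "closed_segment v q \<subseteq> ?L"
    proof
      fix y assume "y \<in> closed_segment v q"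
      then obtain s where s: "0 \<le> s" "s \<le> 1" "y = (1 - s) *\<^sub>R v + s *\<^sub>R q" unfolding closed_segment_def by blast
      have "y = v + s *\<^sub>R flip v" unfolding s(3) q_def by (simp add: algebra_simps)
      then show "y \<in> ?L" using small[OF s(1,2)] v(3) by auto
    qed
    then have "path_component ?L v (\<theta> (\<zeta> q))" unfolding \<theta>q by (rule path_component_linepath)
    moreover have "\<zeta> q \<noteq> 0" using \<theta>q q0 \<theta>_0 by force
    ultimately show ?thesis using \<zeta>_in_Z[of q] d3(2)[OF q(1)] by blast
  qed
  ultimately show ?thesis using that e(1) by blast
qed

text \<open>A ball of the linear space \<open>Z\<close> stays path connected after removal of 0,
  unless its dimension is one.\<close>

theorem lower_points_joined:
  assumes F: "expands F" "isCont F 0" and r: "r > 0" and index: "card P + card Bneg \<noteq> 1"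
  shows "\<exists>\<delta>>0. \<forall>v\<in>cone. \<forall>v'\<in>cone. norm v < \<delta> \<longrightarrow> norm v' < \<delta> \<longrightarrow> F v < F 0 \<longrightarrow> F v' < F 0 \<longrightarrow>
           path_component {v\<in>cone. norm v < r \<and> F v < F 0} v v'"
proof -
  let ?L = "{v\<in>cone. norm v < r \<and> F v < F 0}"
  obtain \<delta> \<epsilon> where d: "\<delta> > 0" "\<epsilon> > 0"
    "\<And>x. x \<in> Z \<Longrightarrow> norm x < \<epsilon> \<Longrightarrow> x \<noteq> 0 \<Longrightarrow> \<theta> x \<in> ?L"
    "\<And>v. v \<in> cone \<Longrightarrow> norm v < \<delta> \<Longrightarrow> F v < F 0 \<Longrightarrow> \<exists>x\<in>Z. norm x < \<epsilon> \<and> x \<noteq> 0 \<and> path_component ?L v (\<theta> x)"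
    by (rule lower_points_reach_Z[OF F r]) (rule that)
  have sub: "subspace Z" unfolding Z_def by simp
  define U where "U = Z \<inter> ball 0 \<epsilon>"
  have "0 \<in> U" unfolding U_def using sub d(2) by (simp add: subspace_0)
  then have "aff_dim U = aff_dim Z"
    unfolding U_def using sub by (intro aff_dim_convex_Int_open) (auto simp: subspace_imp_convex)
  also have "\<dots> = int (card P + card Bneg)" using aff_dim_subspace[OF sub] dim_Z by simp
  finally have "aff_dim U \<noteq> 1" using index by simp
  moreover have "convex U" unfolding U_def by (intro convex_Int subspace_imp_convex[OF sub] convex_ball)
  ultimately have "path_connected (U - {0})" by (intro path_connected_punctured_convex)
  then have pc: "path_connected (\<theta> ` (U - {0}))"
    by (intro path_connected_continuous_image \<theta>_continuous)
  have UL: "\<theta> ` (U - {0}) \<subseteq> ?L" unfolding U_def using d(3) by auto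
  have "path_component ?L v v'"
    if v: "v \<in> cone" "v' \<in> cone" "norm v < \<delta>" "norm v' < \<delta>" "F v < F 0" "F v' < F 0" for v v'
  proof -
    obtain x x' where x: "x \<in> Z" "norm x < \<epsilon>" "x \<noteq> 0" "path_component ?L v (\<theta> x)"
      and x': "x' \<in> Z" "norm x' < \<epsilon>" "x' \<noteq> 0" "path_component ?L v' (\<theta> x')"
      using d(4)[OF v(1,3,5)] d(4)[OF v(2,4,6)] by blast
    have "path_component (\<theta> ` (U - {0})) (\<theta> x) (\<theta> x')"
      using pc x x' unfolding path_connected_component U_def by auto
    then have "path_component ?L (\<theta> x) (\<theta> x')" by (rule path_component_of_subset[OF UL])
    then show ?thesis using path_component_trans[OF x(4) path_component_trans[OF _ path_component_sym[OF x'(4)]]] by blast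
  qed
  then show ?thesis using d(1) by blast
qed

text \<open>In dimension one \<open>Z\<close> minus 0 is the union of two open rays.\<close>

theorem lower_points_two_classes:
  assumes F: "expands F" "isCont F 0" and r: "r > 0" and index: "card P + card Bneg = 1"
  shows "\<exists>p q. p \<in> {v\<in>cone. norm v < r \<and> F v < F 0} \<and> q \<in> {v\<in>cone. norm v < r \<and> F v < F 0} \<and>
     (\<exists>\<delta>>0. \<forall>v\<in>cone. norm v < \<delta> \<longrightarrow> F v < F 0 \<longrightarrow>
        path_component {v\<in>cone. norm v < r \<and> F v < F 0} p v \<or> path_component {v\<in>cone. norm v < r \<and> F v < F 0} q v)"
proof -
  let ?L = "{v\<in>cone. norm v < r \<and> F v < F 0}"
  obtain \<delta> \<epsilon> where d: "\<delta> > 0" "\<epsilon> > 0"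
    "\<And>x. x \<in> Z \<Longrightarrow> norm x < \<epsilon> \<Longrightarrow> x \<noteq> 0 \<Longrightarrow> \<theta> x \<in> ?L"
    "\<And>v. v \<in> cone \<Longrightarrow> norm v < \<delta> \<Longrightarrow> F v < F 0 \<Longrightarrow> \<exists>x\<in>Z. norm x < \<epsilon> \<and> x \<noteq> 0 \<and> path_component ?L v (\<theta> x)"
    by (rule lower_points_reach_Z[OF F r]) (rule that)
  have "dim Z = 1" using dim_Z index by simp
  then obtain a where a: "a \<in> Z" "a \<noteq> 0" "Z \<subseteq> span {a}"
  proof -
    obtain S where S: "S \<subseteq> Z" "independent S" "Z \<subseteq> span S" "card S = dim Z" by (rule basis_exists)
    then obtain a where "S = {a}" using \<open>dim Z = 1\<close> by (auto simp: card_1_singleton_iff)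
    then show ?thesis using S that[of a] dependent_zero[of S] by auto
  qed
  have sub: "subspace Z" unfolding Z_def by simp
  define ray where "ray b = {t *\<^sub>R b |t. 0 < t \<and> t * norm a < \<epsilon>}" for b :: 'a
  have rayZ: "ray b \<subseteq> Z - {0}" "x \<in> ray b \<Longrightarrow> norm x < \<epsilon>" if "b = a \<or> b = - a" for b x
    using that a sub unfolding ray_def by (auto simp: subspace_scale subspace_neg)
  have pcr: "path_connected (\<theta> ` ray b)" for b
  proof (intro path_connected_continuous_image \<theta>_continuous)
    have "ray b = (\<lambda>t. t *\<^sub>R b) ` {0<..<\<epsilon> / norm a}"
      unfolding ray_def using a(2) by (auto simp: pos_less_divide_eq)
    then show "path_connected (ray b)"
      by (simp only:) (intro path_connected_continuous_image continuous_intros convex_imp_path_connected, simp)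
  qed
  have rayL: "\<theta> ` ray b \<subseteq> ?L" if "b = a \<or> b = - a" for b
    using rayZ[OF that] d(3) by blast
  define t0 where "t0 = \<epsilon> / (2 * norm a)"
  have t0: "t0 *\<^sub>R b \<in> ray b" for b unfolding ray_def t0_def using a(2) d(2) by auto
  have inray: "x \<in> ray a \<or> x \<in> ray (- a)" if x: "x \<in> Z" "norm x < \<epsilon>" "x \<noteq> 0" for x
  proof -
    obtain t where t: "x = t *\<^sub>R a" using x(1) a(3) by (auto simp: span_singleton)
    then have "t \<noteq> 0" "\<bar>t\<bar> * norm a < \<epsilon>" using x by auto
    show ?thesis
    proof (cases "t > 0")
      case True
      then show ?thesis using \<open>\<bar>t\<bar> * norm a < \<epsilon>\<close> unfolding ray_def t by auto
    next
      case False
      then have "x = (- t) *\<^sub>R (- a) \<and> 0 < - t \<and> - t * norm a < \<epsilon>"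
        using \<open>t \<noteq> 0\<close> \<open>\<bar>t\<bar> * norm a < \<epsilon>\<close> t by simp
      then have "x \<in> ray (- a)" unfolding ray_def by blast
      then show ?thesis ..
    qed
  qed
  have join: "path_component ?L (\<theta> (t0 *\<^sub>R b)) v"
    if "b = a \<or> b = - a" "x \<in> ray b" "path_component ?L v (\<theta> x)" for b v x
  proof -
    have "path_component (\<theta> ` ray b) (\<theta> (t0 *\<^sub>R b)) (\<theta> x)"
      using pcr[of b] t0[of b] that(2) unfolding path_connected_component by blast
    then have "path_component ?L (\<theta> (t0 *\<^sub>R b)) (\<theta> x)" by (rule path_component_of_subset[OF rayL[OF that(1)]])
    then show ?thesis using path_component_trans path_component_sym[OF that(3)] by blast
  qed
  have "path_component ?L (\<theta> (t0 *\<^sub>R a)) v \<or> path_component ?L (\<theta> (t0 *\<^sub>R (- a))) v"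
    if v: "v \<in> cone" "norm v < \<delta>" "F v < F 0" for v
  proof -
    obtain x where x: "x \<in> Z" "norm x < \<epsilon>" "x \<noteq> 0" "path_component ?L v (\<theta> x)" using d(4)[OF v] by blast
    then show ?thesis using inray[OF x(1-3)] join[OF _ _ x(4)] by blast
  qed
  then have "\<exists>\<delta>>0. \<forall>v\<in>cone. norm v < \<delta> \<longrightarrow> F v < F 0 \<longrightarrow>
      path_component ?L (\<theta> (t0 *\<^sub>R a)) v \<or> path_component ?L (\<theta> (t0 *\<^sub>R (- a))) v"
    using d(1) by (intro exI[of _ \<delta>]) simp
  moreover have "\<theta> (t0 *\<^sub>R a) \<in> ?L"
    by (rule subsetD[OF rayL imageI[OF t0]]) simp
  moreover have "\<theta> (t0 *\<^sub>R (- a)) \<in> ?L"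
    by (rule subsetD[OF rayL imageI[OF t0]]) simp
  ultimately show ?thesis
    by (intro exI[of _ "\<theta> (t0 *\<^sub>R a)"] exI[of _ "\<theta> (t0 *\<^sub>R (- a))"] conjI)
qed

end

section \<open>Constraints, multipliers and charts of the feasible set\<close>

lemma has_derivative_grad:
  assumes "f differentiable (at x)"
  shows "(f has_derivative (\<lambda>v. inner (grad f x) v)) (at x)"
proof -
  define f' where "f' = frechet_derivative f (at x)"
  have f': "(f has_derivative f') (at x)" unfolding f'_def using assms frechet_derivative_works by blast
  have "f' v = inner (grad f x) v" for v
  proof -
    have "f' v = f' (\<Sum>i\<in>UNIV. (vec_nth v i) *\<^sub>R axis i 1)"
      using basis_expansion[of v] by (simp add: scalar_mult_eq_scaleR)
    also have "\<dots> = (\<Sum>i\<in>UNIV. vec_nth v i * f' (axis i 1))"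
      using has_derivative_linear[OF f'] by (simp add: linear_sum linear_scale)
    also have "\<dots> = inner (grad f x) v"
      unfolding grad_def inner_vec_def f'_def by (simp add: mult.commute)
    finally show ?thesis .
  qed
  then have "f' = (\<lambda>v. inner (grad f x) v)" by blast
  then show ?thesis using f' by simp
qed

lemma grad_eqI:
  assumes "(f has_derivative (\<lambda>v. inner a v)) (at x)"
  shows "grad f x = a"
  unfolding grad_def frechet_derivative_at[OF assms, symmetric]
  by (simp add: vec_eq_iff inner_axis)

lemma has_derivative_hessian:
  assumes "grad f differentiable (at x)"
  shows "(grad f has_derivative (\<lambda>v. hessian f x *v v)) (at x)"
  using assms unfolding hessian_def jacobian_works .

lemma C2D:
  assumes "C2 f"
  shows "(f has_derivative (\<lambda>v. inner (grad f x) v)) (at x)" "grad f differentiable (at x)" "isCont (grad f) x"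
  using assms has_derivative_grad differentiable_imp_continuous_within unfolding C2_def by blast+

text \<open>This is for Lagrange functions, where \<open>a\<close> are the multipliers.\<close>

lemma C2_linear_combination:
  fixes a :: "'c \<Rightarrow> real"
  assumes f: "C2 f" and \<phi>: "\<And>c. c \<in> S \<Longrightarrow> C2 (\<phi> c)"
  defines "L \<equiv> \<lambda>x. f x - (\<Sum>c\<in>S. a c * \<phi> c x)"
  shows "(L has_derivative (\<lambda>v. inner (grad L x) v)) (at x)"
    "grad L x = grad f x - (\<Sum>c\<in>S. a c *\<^sub>R grad (\<phi> c) x)"
    "grad L differentiable (at x)"
proof -
  have d: "(L has_derivative (\<lambda>v. inner (grad f x - (\<Sum>c\<in>S. a c *\<^sub>R grad (\<phi> c) x)) v)) (at x)" for x
  proof -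
    have "(L has_derivative (\<lambda>v. inner (grad f x) v - (\<Sum>c\<in>S. a c * inner (grad (\<phi> c) x) v))) (at x)"
      unfolding L_def
      by (intro has_derivative_diff C2D(1)[OF f] has_derivative_sum has_derivative_mult_right C2D(1)[OF \<phi>])
    then show ?thesis by (simp add: inner_diff_left inner_sum_left)
  qed
  have g: "grad L x = grad f x - (\<Sum>c\<in>S. a c *\<^sub>R grad (\<phi> c) x)" for x
    by (rule grad_eqI[OF d])
  show "(L has_derivative (\<lambda>v. inner (grad L x) v)) (at x)" unfolding g by (rule d)
  show "grad L x = grad f x - (\<Sum>c\<in>S. a c *\<^sub>R grad (\<phi> c) x)" by (rule g)
  have "grad L = (\<lambda>x. grad f x - (\<Sum>c\<in>S. a c *\<^sub>R grad (\<phi> c) x))" using g by blast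
  moreover have "(\<lambda>x. (\<Sum>c\<in>S. a c *\<^sub>R grad (\<phi> c) x)) differentiable (at x)"
  proof -
    have "\<forall>c\<in>S. \<exists>g'. (grad (\<phi> c) has_derivative g') (at x)"
      using C2D(2)[OF \<phi>] unfolding differentiable_def by blast
    then obtain g' where "\<And>c. c \<in> S \<Longrightarrow> (grad (\<phi> c) has_derivative g' c) (at x)" by metis
    then have "((\<lambda>x. (\<Sum>c\<in>S. a c *\<^sub>R grad (\<phi> c) x)) has_derivative (\<lambda>v. \<Sum>c\<in>S. a c *\<^sub>R g' c v)) (at x)"
      by (intro has_derivative_sum has_derivative_scaleR_right)
    then show ?thesis unfolding differentiable_def by blast
  qed
  ultimately show "grad L differentiable (at x)"
    using C2D(2)[OF f] by (simp add: differentiable_diff)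
qed

definition all_constr :: "('n::finite, 'i, 'j) mpsc \<Rightarrow> ('i, 'j) constr set" where
  "all_constr P = Eq_C ` eq_idx P \<union> Ineq_C ` ineq_idx P \<union> Sw1_C ` {1..sw_num P} \<union> Sw2_C ` {1..sw_num P}"

text \<open>The multipliers as one family over the labels of the constraints, so that sums over the
  four kinds of constraints become one sum.\<close>

fun multiplier :: "('i, 'j) multipliers \<Rightarrow> ('i, 'j) constr \<Rightarrow> real" where
  "multiplier w (Eq_C i) = lam w i"
| "multiplier w (Ineq_C j) = mu w j"
| "multiplier w (Sw1_C m) = sig1 w m"
| "multiplier w (Sw2_C m) = sig2 w m"

text \<open>At a feasible point at least one factor of each switching constraint vanishes, so the
  case distinction in the definition only selects the vanishing constraint functions.\<close>

lemma active_constr_eq: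
  "x \<in> feasible P \<Longrightarrow> active_constr P x = {c\<in>all_constr P. constr_fun P c x = 0}"
  unfolding active_constr_def all_constr_def feasible_def active_ineq_def alpha_idx_def beta_idx_def gamma_idx_def
  by auto

lemma sum_all_constr:
  assumes "finite (eq_idx P)" "finite (ineq_idx P)"
  shows "(\<Sum>c\<in>all_constr P. h c) = (\<Sum>i\<in>eq_idx P. h (Eq_C i)) + (\<Sum>j\<in>ineq_idx P. h (Ineq_C j))
    + (\<Sum>m\<in>{1..sw_num P}. h (Sw1_C m) + h (Sw2_C m))"
proof -
  have i: "inj_on Eq_C S" "inj_on Ineq_C S'" "inj_on Sw1_C S''" "inj_on Sw2_C S''"
    for S S' S'' by (auto simp: inj_on_def)
  show ?thesis
    unfolding all_constr_def sum.distrib using assms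
    by (subst sum.union_disjoint; (auto; fail)?)+
      (simp add: sum.reindex[OF i(1)] sum.reindex[OF i(2)] sum.reindex[OF i(3)] sum.reindex[OF i(4)] add.assoc)
qed

lemma finite_all_constr:
  "finite (eq_idx P) \<Longrightarrow> finite (ineq_idx P) \<Longrightarrow> finite (all_constr P)"
  unfolding all_constr_def by simp

lemma C2_constr: "C2_mpsc P \<Longrightarrow> c \<in> all_constr P \<Longrightarrow> C2 (constr_fun P c)"
  unfolding C2_mpsc_def all_constr_def by auto

lemma ball_all_constr:
  "(\<forall>c\<in>all_constr P. Q c) \<longleftrightarrow> (\<forall>i\<in>eq_idx P. Q (Eq_C i)) \<and> (\<forall>j\<in>ineq_idx P. Q (Ineq_C j))
     \<and> (\<forall>m\<in>{1..sw_num P}. Q (Sw1_C m) \<and> Q (Sw2_C m))"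
  unfolding all_constr_def by blast

lemma W_stationary_with_iff:
  assumes "finite (eq_idx P)" "finite (ineq_idx P)"
  shows "W_stationary_with P x w \<longleftrightarrow> x \<in> feasible P
     \<and> grad (objective P) x = (\<Sum>c\<in>all_constr P. multiplier w c *\<^sub>R grad (constr_fun P c) x)
     \<and> (\<forall>c\<in>all_constr P. multiplier w c * constr_fun P c x = 0)
     \<and> (\<forall>j\<in>ineq_idx P. multiplier w (Ineq_C j) \<ge> 0)"
  unfolding W_stationary_with_def sum_all_constr[OF assms] ball_all_constr
  by (auto simp: feasible_def)

lemma lagrangian_eq:
  assumes "finite (eq_idx P)" "finite (ineq_idx P)"
  shows "lagrangian P w = (\<lambda>x. objective P x - (\<Sum>c\<in>all_constr P. multiplier w c * constr_fun P c x))"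
  unfolding lagrangian_def sum_all_constr[OF assms] by (rule ext) simp

lemma lagrangian_gradient:
  assumes fin: "finite (eq_idx P)" "finite (ineq_idx P)" and C2: "C2_mpsc P"
  shows "(lagrangian P w has_derivative (\<lambda>v. inner (grad (lagrangian P w) x) v)) (at x)"
    "grad (lagrangian P w) x = grad (objective P) x - (\<Sum>c\<in>all_constr P. multiplier w c *\<^sub>R grad (constr_fun P c) x)"
    "grad (lagrangian P w) differentiable (at x)"
proof -
  have f: "C2 (objective P)" using C2 unfolding C2_mpsc_def by blast
  have c: "C2 (constr_fun P c)" if "c \<in> all_constr P" for c using C2_constr[OF C2 that] .
  show "(lagrangian P w has_derivative (\<lambda>v. inner (grad (lagrangian P w) x) v)) (at x)"
    "grad (lagrangian P w) x = grad (objective P) x - (\<Sum>c\<in>all_constr P. multiplier w c *\<^sub>R grad (constr_fun P c) x)"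
    "grad (lagrangian P w) differentiable (at x)"
    unfolding lagrangian_eq[OF fin] by (rule C2_linear_combination[OF f c]; assumption)+
qed

lemma multiplier_surj:
  "\<exists>w. \<forall>c. multiplier w c = a c"
proof -
  have "multiplier \<lparr>lam = \<lambda>i. a (Eq_C i), mu = \<lambda>j. a (Ineq_C j), sig1 = \<lambda>m. a (Sw1_C m), sig2 = \<lambda>m. a (Sw2_C m)\<rparr> c = a c" for c
    by (cases c) auto
  then show ?thesis by blast
qed

text \<open>\<open>D b\<close> is the component of \<open>G b\<close> orthogonal to the other
  vectors, suitably scaled; it is nonzero by independence.\<close>

lemma dual_vectors:
  fixes G :: "'c \<Rightarrow> 'a::euclidean_space"
  assumes inj: "inj_on G C" and ind: "independent (G ` C)"
  obtains D where "\<And>c b. c \<in> C \<Longrightarrow> b \<in> C \<Longrightarrow> inner (G c) (D b) = (if c = b then 1 else 0)"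
proof -
  have "\<exists>d. \<forall>c\<in>C. inner (G c) d = (if c = b then 1 else 0)" if b: "b \<in> C" for b
  proof -
    let ?S = "G ` C - {G b}"
    obtain y x where yx: "y \<in> span ?S" "\<And>s. s \<in> span ?S \<Longrightarrow> Linear_Algebra.orthogonal x s" "G b = y + x"
      using orthogonal_subspace_decomp_exists[of ?S "G b"] by metis
    have "G b \<notin> span ?S" using ind b unfolding dependent_def by blast
    then have x0: "x \<noteq> 0" using yx by auto
    have "inner (G b) x = inner x x"
      using yx(2)[OF yx(1)] yx(3) by (simp add: Linear_Algebra.orthogonal_def inner_add_left inner_add_right inner_commute)
    moreover have "inner (G c) x = 0" if "c \<in> C" "c \<noteq> b" for c
    proof -
      have "G c \<in> span ?S" using that inj b by (intro span_base) (auto simp: inj_on_eq_iff)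
      then show ?thesis using yx(2)[of "G c"] by (simp add: Linear_Algebra.orthogonal_def inner_commute)
    qed
    ultimately show ?thesis using x0
      by (intro exI[of _ "x /\<^sub>R (inner x x)"]) auto
  qed
  then obtain D where "\<And>b. b \<in> C \<Longrightarrow> \<forall>c\<in>C. inner (G c) (D b) = (if c = b then 1 else 0)"
    by metis
  then show ?thesis using that by blast
qed

text \<open>In the coordinates \<open>v\<close> of \<open>x = \<Psi> v\<close> the active
  constraints are their own linearizations at \<open>z\<close>, and the radius is so small that
  inactive constraints keep their signs.\<close>

locale chart =
  fixes P :: "('n::finite, 'i, 'j) mpsc" and z :: "real ^ 'n"
    and D :: "('i, 'j) constr \<Rightarrow> real ^ 'n" and \<Psi> :: "real ^ 'n \<Rightarrow> real ^ 'n" and r :: real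
  assumes fin: "finite (eq_idx P)" "finite (ineq_idx P)" and C2: "C2_mpsc P" and feas: "z \<in> feasible P"
    and dual: "c \<in> active_constr P z \<Longrightarrow> b \<in> active_constr P z \<Longrightarrow>
      inner (grad (constr_fun P c) z) (D b) = (if c = b then 1 else 0)"
    and r: "r > 0" and \<Psi>0: "\<Psi> 0 = z" and near_id: "strictly_near_id \<Psi>"
    and half: "norm v < r \<Longrightarrow> norm v' < r \<Longrightarrow> norm (\<Psi> v' - \<Psi> v - (v' - v)) \<le> norm (v' - v) / 2"
    and straight: "norm v < r \<Longrightarrow> c \<in> active_constr P z \<Longrightarrow>
      constr_fun P c (\<Psi> v) = inner (grad (constr_fun P c) z) v"
    and inactive: "norm v < r \<Longrightarrow> c \<in> all_constr P - active_constr P z \<Longrightarrow>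
      constr_fun P c (\<Psi> v) * constr_fun P c z > 0"
    and cover: "\<exists>\<rho>>0. \<forall>x. norm (x - z) < \<rho> \<longrightarrow> (\<exists>v. norm v < r \<and> \<Psi> v = x)"

lemma chart_exists:
  fixes P :: "('n::finite, 'i, 'j) mpsc"
  assumes fin: "finite (eq_idx P)" "finite (ineq_idx P)" and C2: "C2_mpsc P" and feas: "z \<in> feasible P"
    and licq: "LICQ P z"
  shows "\<exists>D \<Psi> r. chart P z D \<Psi> r"
proof -
  let ?G = "\<lambda>c. grad (constr_fun P c) z"
  have act: "active_constr P z = {c\<in>all_constr P. constr_fun P c z = 0}" by (rule active_constr_eq[OF feas])
  have finall: "finite (all_constr P)" using finite_all_constr[OF fin] .
  obtain D where D: "\<And>c b. c \<in> active_constr P z \<Longrightarrow> b \<in> active_constr P z \<Longrightarrow> inner (?G c) (D b) = (if c = b then 1 else 0)"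
    using dual_vectors[of ?G "active_constr P z"] licq unfolding LICQ_def by metis
  have fina: "finite (active_constr P z)" unfolding act using finall by simp
  have strict: "\<exists>d>0. \<forall>x y. norm (x - z) < d \<longrightarrow> norm (y - z) < d \<longrightarrow>
      \<bar>constr_fun P c y - constr_fun P c x - inner (?G c) (y - x)\<bar> \<le> e * norm (y - x)"
    if "c \<in> active_constr P z" "e > 0" for c e
  proof -
    have "C2 (constr_fun P c)" using that act C2_constr[OF C2] by blast
    then show ?thesis using strict_differentiability[OF C2D(1) C2D(3) that(2)] by blast
  qed
  have zero: "constr_fun P c z = 0" if "c \<in> active_constr P z" for c using that act by blast
  obtain \<Psi> r0 \<rho> where S: "r0 > 0" "\<rho> > 0" "\<Psi> 0 = z" "strictly_near_id \<Psi>"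
    "\<And>v w. norm v < r0 \<Longrightarrow> norm w < r0 \<Longrightarrow> norm (\<Psi> w - \<Psi> v - (w - v)) \<le> norm (w - v) / 2"
    "\<And>v c. norm v < r0 \<Longrightarrow> c \<in> active_constr P z \<Longrightarrow> constr_fun P c (\<Psi> v) = inner (?G c) v"
    "\<And>x. norm (x - z) < \<rho> \<Longrightarrow> \<exists>v. norm v < r0 \<and> \<Psi> v = x"
    by (rule straightening[OF fina D zero strict], assumption+, rule that)
  have "\<forall>c\<in>all_constr P - active_constr P z. \<exists>d>0. \<forall>x. dist x z < d \<longrightarrow> constr_fun P c x * constr_fun P c z > 0"
  proof
    fix c assume c: "c \<in> all_constr P - active_constr P z"
    then have nz: "constr_fun P c z \<noteq> 0" unfolding act by blast
    have "isCont (constr_fun P c) z"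
      using C2D(1)[OF C2_constr[OF C2]] c has_derivative_continuous by blast
    then obtain d where d: "d > 0" "\<And>x. dist x z < d \<Longrightarrow> dist (constr_fun P c x) (constr_fun P c z) < \<bar>constr_fun P c z\<bar>"
      using nz unfolding continuous_at_eps_delta by (metis zero_less_abs_iff)
    have "constr_fun P c x * constr_fun P c z > 0" if "dist x z < d" for x
      using d(2)[OF that] nz by (auto simp: dist_real_def zero_less_mult_iff abs_if split: if_splits)
    then show "\<exists>d>0. \<forall>x. dist x z < d \<longrightarrow> constr_fun P c x * constr_fun P c z > 0" using d(1) by blast
  qed
  then obtain d where d: "\<And>c. c \<in> all_constr P - active_constr P z \<Longrightarrow> d c > 0"
    "\<And>c x. c \<in> all_constr P - active_constr P z \<Longrightarrow> dist x z < d c \<Longrightarrow> constr_fun P c x * constr_fun P c z > 0"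
    by metis
  define m where "m = Min (insert 1 (d ` (all_constr P - active_constr P z)))"
  have m: "m > 0" "\<And>c. c \<in> all_constr P - active_constr P z \<Longrightarrow> m \<le> d c"
    unfolding m_def using d(1) finall by auto
  define r where "r = min r0 (m / 2)"
  have r: "r > 0" "r \<le> r0" "r \<le> m / 2" unfolding r_def using m S(1) by auto
  have lip: "norm (\<Psi> v - z) \<le> 3/2 * norm v" "norm v \<le> 2 * norm (\<Psi> v - z)" if "norm v < r0" for v :: "real ^ 'n"
  proof -
    have h: "norm (\<Psi> v - z - v) \<le> norm v / 2" using S(5)[of 0 v] S(1,3) that by simp
    show "norm (\<Psi> v - z) \<le> 3/2 * norm v"
      using h norm_triangle_sub[of "\<Psi> v - z" v] by linarith
    show "norm v \<le> 2 * norm (\<Psi> v - z)"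
      using h norm_triangle_sub[of v "\<Psi> v - z"] by (simp add: norm_minus_commute)
  qed
  have "chart P z D \<Psi> r"
  proof
    fix v :: "real ^ 'n" and c assume v: "norm v < r" and c: "c \<in> all_constr P - active_constr P z"
    have "dist (\<Psi> v) z \<le> 3/2 * norm v" using lip(1)[of v] v r by (simp add: dist_norm)
    also have "\<dots> < m" using v r norm_ge_zero[of v] by linarith
    also have "\<dots> \<le> d c" by (rule m(2)[OF c])
    finally show "constr_fun P c (\<Psi> v) * constr_fun P c z > 0" by (rule d(2)[OF c])
  next
    show "\<exists>\<rho>>0. \<forall>x. norm (x - z) < \<rho> \<longrightarrow> (\<exists>v. norm v < r \<and> \<Psi> v = x)"
    proof (intro exI[of _ "min \<rho> (r / 2)"] conjI allI impI)
      fix x assume x: "norm (x - z) < min \<rho> (r / 2)"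
      then obtain v where v: "norm v < r0" "\<Psi> v = x" using S(7)[of x] by auto
      then show "\<exists>v. norm v < r \<and> \<Psi> v = x" using lip(2)[OF v(1)] x by (intro exI[of _ v]) auto
    qed (use S r in auto)
  qed (use fin C2 feas D r S in auto)
  then show ?thesis by blast
qed

section \<open>The feasible set in a chart\<close>

context chart
begin

abbreviation "Act \<equiv> active_constr P z"
abbreviation "f \<equiv> objective P"
abbreviation "M \<equiv> feasible P"

definition G :: "('i, 'j) constr \<Rightarrow> real ^ 'n" where "G c = grad (constr_fun P c) z"

text \<open>The constraints that act as equations near \<open>z\<close>: a switching constraint of
  type \<open>\<alpha>\<close> or \<open>\<gamma>\<close> reduces to its vanishing factor.\<close>

definition eq_like :: "('i, 'j) constr set" where
  "eq_like = Eq_C ` eq_idx P \<union> Sw1_C ` alpha_idx P z \<union> Sw2_C ` gamma_idx P z"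

definition tcone :: "(real ^ 'n) set" where
  "tcone = {v. (\<forall>c\<in>eq_like. inner (G c) v = 0) \<and> (\<forall>j\<in>active_ineq P z. inner (G (Ineq_C j)) v \<ge> 0)
     \<and> (\<forall>m\<in>beta_idx P z. inner (G (Sw1_C m)) v * inner (G (Sw2_C m)) v = 0)}"

lemma Act_eq: "Act = {c\<in>all_constr P. constr_fun P c z = 0}"
  by (rule active_constr_eq[OF feas])

lemma Act_split: "Act = eq_like \<union> Ineq_C ` active_ineq P z \<union> Sw1_C ` beta_idx P z \<union> Sw2_C ` beta_idx P z"
  unfolding active_constr_def eq_like_def by blast

lemma Act_all: "Act \<subseteq> all_constr P"
  using Act_eq by blast

lemma fin_all: "finite (all_constr P)" by (rule finite_all_constr[OF fin])

lemma fin_Act: "finite Act" using Act_all fin_all finite_subset by blast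

lemma dualG: "c \<in> Act \<Longrightarrow> b \<in> Act \<Longrightarrow> inner (G c) (D b) = (if c = b then 1 else 0)"
  unfolding G_def by (rule dual)

lemma straightG: "norm v < r \<Longrightarrow> c \<in> Act \<Longrightarrow> constr_fun P c (\<Psi> v) = inner (G c) v"
  unfolding G_def by (rule straight)

text \<open>Inactive constraint functions keep their signs, so only the active ones matter, and
  these are linear in \<open>v\<close>.\<close>

lemma feasible_iff:
  assumes v: "norm v < r"
  shows "\<Psi> v \<in> M \<longleftrightarrow> v \<in> tcone"
proof -
  have eq: "constr_fun P (Eq_C i) (\<Psi> v) = inner (G (Eq_C i)) v" if "i \<in> eq_idx P" for i
    using that straightG[OF v, of "Eq_C i"] unfolding active_constr_def by blast
  have ineq: "ineq_con P j (\<Psi> v) \<ge> 0 \<longleftrightarrow> (j \<in> active_ineq P z \<longrightarrow> inner (G (Ineq_C j)) v \<ge> 0)"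
    if j: "j \<in> ineq_idx P" for j
  proof (cases "j \<in> active_ineq P z")
    case True
    then have "Ineq_C j \<in> Act" unfolding active_constr_def by blast
    then show ?thesis using straightG[OF v, of "Ineq_C j"] True by simp
  next
    case False
    then have "Ineq_C j \<in> all_constr P - Act" using j unfolding active_constr_def all_constr_def by blast
    then have "ineq_con P j (\<Psi> v) * ineq_con P j z > 0" using inactive[OF v, of "Ineq_C j"] by simp
    moreover have "ineq_con P j z \<ge> 0" using feas j unfolding feasible_def by blast
    ultimately show ?thesis using False by (auto simp: zero_less_mult_iff)
  qed
  have sw: "sw1 P m (\<Psi> v) * sw2 P m (\<Psi> v) = 0 \<longleftrightarrow>
      (m \<in> alpha_idx P z \<longrightarrow> inner (G (Sw1_C m)) v = 0) \<and> (m \<in> gamma_idx P z \<longrightarrow> inner (G (Sw2_C m)) v = 0)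
      \<and> (m \<in> beta_idx P z \<longrightarrow> inner (G (Sw1_C m)) v * inner (G (Sw2_C m)) v = 0)"
    if m: "m \<in> {1..sw_num P}" for m
  proof -
    have "sw1 P m z * sw2 P m z = 0" using feas m unfolding feasible_def by blast
    then consider "m \<in> alpha_idx P z" "m \<notin> beta_idx P z" "m \<notin> gamma_idx P z"
      | "m \<notin> alpha_idx P z" "m \<in> beta_idx P z" "m \<notin> gamma_idx P z"
      | "m \<notin> alpha_idx P z" "m \<notin> beta_idx P z" "m \<in> gamma_idx P z"
      using m unfolding alpha_idx_def beta_idx_def gamma_idx_def by auto
    then show ?thesis
    proof cases
      case 1
      then have "Sw1_C m \<in> Act" "Sw2_C m \<in> all_constr P - Act"
        using m unfolding active_constr_def all_constr_def by blast+
      then show ?thesis using 1 straightG[OF v, of "Sw1_C m"] inactive[OF v, of "Sw2_C m"] by auto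
    next
      case 2
      then have "Sw1_C m \<in> Act" "Sw2_C m \<in> Act" unfolding active_constr_def by blast+
      then show ?thesis using 2 straightG[OF v, of "Sw1_C m"] straightG[OF v, of "Sw2_C m"] by simp
    next
      case 3
      then have "Sw2_C m \<in> Act" "Sw1_C m \<in> all_constr P - Act"
        using m unfolding active_constr_def all_constr_def by blast+
      then show ?thesis using 3 straightG[OF v, of "Sw2_C m"] inactive[OF v, of "Sw1_C m"] by auto
    qed
  qed
  have idx: "alpha_idx P z \<subseteq> {1..sw_num P}" "beta_idx P z \<subseteq> {1..sw_num P}" "gamma_idx P z \<subseteq> {1..sw_num P}"
    "active_ineq P z \<subseteq> ineq_idx P"
    unfolding alpha_idx_def beta_idx_def gamma_idx_def active_ineq_def by auto
  have "\<Psi> v \<in> M \<longleftrightarrow> (\<forall>i\<in>eq_idx P. inner (G (Eq_C i)) v = 0)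
      \<and> (\<forall>j\<in>ineq_idx P. j \<in> active_ineq P z \<longrightarrow> inner (G (Ineq_C j)) v \<ge> 0)
      \<and> (\<forall>m\<in>{1..sw_num P}. (m \<in> alpha_idx P z \<longrightarrow> inner (G (Sw1_C m)) v = 0) \<and> (m \<in> gamma_idx P z \<longrightarrow> inner (G (Sw2_C m)) v = 0)
      \<and> (m \<in> beta_idx P z \<longrightarrow> inner (G (Sw1_C m)) v * inner (G (Sw2_C m)) v = 0))"
    unfolding feasible_def using eq ineq sw by simp
  also have "\<dots> \<longleftrightarrow> v \<in> tcone"
    unfolding tcone_def eq_like_def using idx by blast
  finally show ?thesis .
qed

lemma \<Psi>_lip: "norm v < r \<Longrightarrow> norm v' < r \<Longrightarrow> norm (\<Psi> v' - \<Psi> v) \<le> 2 * norm (v' - v)"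
  using half[of v v'] norm_triangle_sub[of "\<Psi> v' - \<Psi> v" "v' - v"] norm_ge_zero[of "v' - v"] by linarith

lemma \<Psi>_dist: "norm v < r \<Longrightarrow> dist (\<Psi> v) z \<le> 2 * norm v"
  using \<Psi>_lip[of 0 v] r \<Psi>0 by (simp add: dist_norm)

lemma \<Psi>_dist_lower: "norm v < r \<Longrightarrow> norm v \<le> 2 * dist (\<Psi> v) z"
  using half[of 0 v] r \<Psi>0 norm_triangle_sub[of v "\<Psi> v - z"] by (simp add: dist_norm norm_minus_commute)

lemma \<Psi>_continuous: "continuous_on (ball 0 r) \<Psi>"
proof (rule continuous_on_iff[THEN iffD2], intro ballI allI impI)
  fix v :: "real ^ 'n" and e :: real assume v: "v \<in> ball 0 r" "e > 0"
  show "\<exists>d>0. \<forall>x'\<in>ball 0 r. dist x' v < d \<longrightarrow> dist (\<Psi> x') (\<Psi> v) < e"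
    using v \<Psi>_lip[of v] by (intro exI[of _ "e/2"]) (force simp: dist_norm)
qed

lemma feasible_near:
  assumes "e > 0"
  shows "\<exists>\<rho>>0. \<forall>x\<in>M. dist x z < \<rho> \<longrightarrow> (\<exists>v\<in>tcone. norm v < e \<and> norm v < r \<and> \<Psi> v = x)"
proof -
  obtain \<rho> where \<rho>: "\<rho> > 0" "\<And>x. norm (x - z) < \<rho> \<Longrightarrow> \<exists>v. norm v < r \<and> \<Psi> v = x" using cover by blast
  show ?thesis
  proof (intro exI[of _ "min \<rho> (e / 2)"] conjI ballI impI)
    fix x assume x: "x \<in> M" "dist x z < min \<rho> (e / 2)"
    then obtain v where v: "norm v < r" "\<Psi> v = x" using \<rho>(2)[of x] by (auto simp: dist_norm)
    then have "norm v < e" using \<Psi>_dist_lower[OF v(1)] x(2) by simp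
    then show "\<exists>v\<in>tcone. norm v < e \<and> norm v < r \<and> \<Psi> v = x"
      using v x(1) feasible_iff[OF v(1)] by blast
  qed (use \<rho> assms in auto)
qed

lemma path_component_\<Psi>:
  assumes "path_component S v v'" "S \<subseteq> ball 0 r" "\<Psi> ` S \<subseteq> T"
  shows "path_component T (\<Psi> v) (\<Psi> v')"
proof -
  obtain g where g: "path g" "path_image g \<subseteq> S" "pathstart g = v" "pathfinish g = v'"
    using assms(1) unfolding path_component_def by blast
  have "path (\<Psi> \<circ> g)"
    by (rule path_continuous_image[OF g(1)]) (use continuous_on_subset[OF \<Psi>_continuous] g(2) assms(2) in blast)
  moreover have "path_image (\<Psi> \<circ> g) \<subseteq> T" using g(2) assms(3) by (auto simp: path_image_compose)
  ultimately show ?thesis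
    unfolding path_component_def using g(3,4) pathstart_compose pathfinish_compose by metis
qed

lemma path_component_lower:
  assumes "path_component {v\<in>tcone. norm v < r \<and> f (\<Psi> v) < f (\<Psi> 0)} v v'"
  shows "path_component {x\<in>M. f x < f z} (\<Psi> v) (\<Psi> v')"
  by (rule path_component_\<Psi>[OF assms]) (auto simp: feasible_iff \<Psi>0)

lemma tcone_scale:
  assumes "v \<in> tcone" "0 \<le> s" shows "s *\<^sub>R v \<in> tcone"
  using assms unfolding tcone_def by auto

lemma locally_path_connected_at:
  assumes "e > 0"
  shows "\<exists>d>0. \<forall>y\<in>M. dist y z < d \<longrightarrow> path_component (M \<inter> ball z e) z y"
proof -
  obtain \<rho> where \<rho>: "\<rho> > 0" "\<And>x. x \<in> M \<Longrightarrow> dist x z < \<rho> \<Longrightarrow> \<exists>v\<in>tcone. norm v < e / 2 \<and> norm v < r \<and> \<Psi> v = x"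
    using feasible_near[of "e/2"] assms by (metis half_gt_zero)
  have "path_component (M \<inter> ball z e) z y" if yM: "y \<in> M" "dist y z < \<rho>" for y
  proof -
    obtain v where v: "v \<in> tcone" "norm v < e / 2" "norm v < r" "\<Psi> v = y" using \<rho>(2)[OF yM] by blast
    have sub: "u \<in> tcone" "norm u \<le> norm v" if us: "u \<in> closed_segment 0 v" for u
    proof -
      obtain s where s: "0 \<le> s" "s \<le> 1" "u = s *\<^sub>R v" using us unfolding closed_segment_def by auto
      show "u \<in> tcone" unfolding s(3) by (rule tcone_scale[OF v(1) s(1)])
      show "norm u \<le> norm v" unfolding s(3) using s by (simp add: mult_left_le_one_le)
    qed
    have "path_component (closed_segment 0 v) 0 v" by (rule path_component_linepath) simp
    then have "path_component (M \<inter> ball z e) (\<Psi> 0) (\<Psi> v)"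
    proof (rule path_component_\<Psi>)
      show "closed_segment 0 v \<subseteq> ball 0 r" using sub(2) v(3) by fastforce
      show "\<Psi> ` closed_segment 0 v \<subseteq> M \<inter> ball z e"
      proof
        fix x assume "x \<in> \<Psi> ` closed_segment 0 v"
        then obtain u where u: "u \<in> closed_segment 0 v" "x = \<Psi> u" by blast
        then have ur: "norm u < r" "norm u < e / 2" using sub(2)[OF u(1)] v by auto
        then have "dist (\<Psi> u) z < e" using \<Psi>_dist[OF ur(1)] by linarith
        then show "x \<in> M \<inter> ball z e" using u feasible_iff[OF ur(1)] sub(1)[OF u(1)] by (simp add: dist_commute)
      qed
    qed
    then show ?thesis using \<Psi>0 v(4) by simp
  qed
  then show ?thesis using \<rho>(1) by blast
qed

text \<open>To first order the direction \<open>y\<close> keeps the constraints that are active at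
  \<open>\<Psi> v\<close>, apart from moving to the feasible side of inequalities.\<close>

definition pushes :: "real ^ 'n \<Rightarrow> real ^ 'n \<Rightarrow> bool" where
  "pushes v y \<longleftrightarrow> (\<forall>c\<in>Act. inner (G c) v = 0 \<longrightarrow>
     (if c \<in> range Ineq_C then inner (G c) y \<ge> 0 else inner (G c) y = 0))"

text \<open>The objective is the Lagrange function at \<open>\<Psi> v\<close>, whose gradient
  vanishes there, plus the multiplier-weighted constraints. None of the latter decreases in a
  direction that pushes, because the multipliers of inequalities are nonnegative and those of
  inactive constraints are 0.\<close>

lemma no_descent_at_W_stationary:
  assumes v: "norm v < r" and w: "W_stationary_with P (\<Psi> v) w" and y: "pushes v y" and k: "k > 0" "t0 > 0"
  shows "\<exists>t. 0 < t \<and> t < t0 \<and> f (\<Psi> (v + t *\<^sub>R y)) > f (\<Psi> v) - k * t"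
proof -
  define L where "L = lagrangian P w"
  have wd: "\<Psi> v \<in> M" "grad f (\<Psi> v) = (\<Sum>c\<in>all_constr P. multiplier w c *\<^sub>R grad (constr_fun P c) (\<Psi> v))"
    "\<And>c. c \<in> all_constr P \<Longrightarrow> multiplier w c * constr_fun P c (\<Psi> v) = 0"
    "\<And>j. j \<in> ineq_idx P \<Longrightarrow> multiplier w (Ineq_C j) \<ge> 0"
    using w unfolding W_stationary_with_iff[OF fin] by auto
  have "grad L (\<Psi> v) = 0" unfolding L_def lagrangian_gradient(2)[OF fin C2] using wd(2) by simp
  then have "(L has_derivative (\<lambda>_. 0)) (at (\<Psi> v))"
    using lagrangian_gradient(1)[OF fin C2, of w "\<Psi> v"] unfolding L_def[symmetric] by simp
  moreover define e where "e = k / (4 * (norm y + 1))"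
  have n1: "norm y + 1 > 0" by (simp add: add_nonneg_pos)
  have e: "e > 0" unfolding e_def using k n1 by simp
  ultimately obtain d where d: "d > 0" "\<And>x. norm (x - \<Psi> v) < d \<Longrightarrow> norm (L x - L (\<Psi> v)) \<le> e * norm (x - \<Psi> v)"
    unfolding has_derivative_at_alt by (metis diff_zero)
  define t where "t = min (t0 / 2) (min ((r - norm v) / (2 * (norm y + 1))) (d / (4 * (norm y + 1))))"
  have t: "t > 0" "t < t0" unfolding t_def using k v d n1 by (auto simp: min_less_iff_disj)
  have tn: "t * (norm y + 1) \<le> (r - norm v) / 2" "t * (norm y + 1) \<le> d / 4"
  proof -
    have "t \<le> (r - norm v) / (2 * (norm y + 1))" "t \<le> d / (4 * (norm y + 1))" unfolding t_def by auto
    then show "t * (norm y + 1) \<le> (r - norm v) / 2" "t * (norm y + 1) \<le> d / 4"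
      using n1 by (simp_all add: pos_le_divide_eq algebra_simps)
  qed
  have ty: "norm (t *\<^sub>R y) \<le> t * (norm y + 1)" using t by (simp add: algebra_simps)
  define x where "x = \<Psi> (v + t *\<^sub>R y)"
  have vr: "norm (v + t *\<^sub>R y) < r"
  proof -
    have "norm (v + t *\<^sub>R y) \<le> norm v + (r - norm v) / 2"
      by (rule order_trans[OF norm_triangle_ineq add_left_mono[OF order_trans[OF ty tn(1)]]])
    also have "\<dots> < r" using v by (simp add: field_simps)
    finally show ?thesis .
  qed
  have xd: "norm (x - \<Psi> v) \<le> 2 * norm (t *\<^sub>R y)" unfolding x_def using \<Psi>_lip[OF v vr] by simp
  then have "norm (x - \<Psi> v) < d" using order_trans[OF ty tn(2)] d(1) by linarith
  then have "L x \<ge> L (\<Psi> v) - e * norm (x - \<Psi> v)" using d(2)[of x] by (simp add: abs_le_iff)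
  moreover have "e * norm (x - \<Psi> v) \<le> e * (2 * (t * (norm y + 1)))"
    using xd ty e by (intro mult_left_mono) auto
  moreover have "e * (2 * (t * (norm y + 1))) = k * t / 2" unfolding e_def using n1 by (simp add: field_simps)
  moreover have "k * t / 2 < k * t" using k t by simp
  ultimately have Lx: "L x > L (\<Psi> v) - k * t" by linarith
  have "multiplier w c * constr_fun P c x \<ge> multiplier w c * constr_fun P c (\<Psi> v)" if c: "c \<in> all_constr P" for c
  proof (cases "c \<in> Act \<and> inner (G c) v = 0")
    case True
    have x: "constr_fun P c x = t * inner (G c) y" "constr_fun P c (\<Psi> v) = 0"
      unfolding x_def using straightG[OF vr, of c] straightG[OF v, of c] True by (auto simp: inner_add_right)
    show ?thesis
    proof (cases "c \<in> range Ineq_C")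
      case inq: True
      then obtain j where j: "c = Ineq_C j" by blast
      then have "j \<in> ineq_idx P" using c unfolding all_constr_def by blast
      then have "multiplier w c \<ge> 0" using wd(4) j by blast
      moreover have "inner (G c) y \<ge> 0" using y True inq unfolding pushes_def by auto
      ultimately show ?thesis using t x by simp
    next
      case False
      then have "inner (G c) y = 0" using y True unfolding pushes_def by auto
      then show ?thesis using x by simp
    qed
  next
    case False
    have "constr_fun P c (\<Psi> v) \<noteq> 0"
    proof (cases "c \<in> Act")
      case True then show ?thesis using False straightG[OF v] by simp
    next
      case False then show ?thesis using inactive[OF v, of c] c by auto
    qed
    then show ?thesis using wd(3)[OF c] by simp
  qed
  then have "(\<Sum>c\<in>all_constr P. multiplier w c * constr_fun P c (\<Psi> v)) \<le> (\<Sum>c\<in>all_constr P. multiplier w c * constr_fun P c x)"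
    by (rule sum_mono)
  then have "f x > f (\<Psi> v) - k * t" using Lx unfolding L_def lagrangian_eq[OF fin] by linarith
  then show ?thesis using t unfolding x_def by blast
qed

end

section \<open>Local structure of lower points and the count\<close>

context chart
begin

lemma C2f: "C2 f" using C2 unfolding C2_mpsc_def by blast

lemma isCont_f: "isCont f x"
  using C2D(1)[OF C2f] has_derivative_continuous by blast

lemma isCont_f_\<Psi>: "isCont (\<lambda>v. f (\<Psi> v)) 0"
proof -
  have "isCont \<Psi> 0" using \<Psi>_continuous r by (simp add: continuous_on_eq_continuous_at)
  then show ?thesis using isCont_f by (rule isCont_o2)
qed

text \<open>Let \<open>t\<close> be the component of the gradient of \<open>f\<close> orthogonal to
  the active gradients. If \<open>t \<noteq> 0\<close>, then \<open>- t\<close> works. Otherwise the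
  gradient is a combination of the active ones, and as \<open>z\<close> is not W-stationary, the
  coefficient of some active inequality \<open>j\<close> is negative. The dual vector of
  \<open>j\<close> then leads to the interior of this inequality and lowers
  \<open>f\<close>.\<close>

lemma descent_direction:
  assumes ns: "\<And>w. \<not> W_stationary_with P z w"
  obtains y where "\<And>c. c \<in> Act \<Longrightarrow> c \<in> range Ineq_C \<Longrightarrow> inner (G c) y \<ge> 0"
    "\<And>c. c \<in> Act \<Longrightarrow> c \<notin> range Ineq_C \<Longrightarrow> inner (G c) y = 0" "inner (grad f z) y < 0"
proof -
  have inj: "inj_on G Act"
  proof (rule inj_onI)
    fix c b assume cb: "c \<in> Act" "b \<in> Act" "G c = G b"
    have "inner (G b) (D c) = 1" unfolding cb(3)[symmetric] using dualG[OF cb(1,1)] by simp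
    then show "c = b" using dualG[OF cb(2,1)] by (simp split: if_splits)
  qed
  obtain x t where xt: "x \<in> span (G ` Act)" "\<And>s. s \<in> span (G ` Act) \<Longrightarrow> Linear_Algebra.orthogonal t s" "grad f z = x + t"
    using orthogonal_subspace_decomp_exists[of "G ` Act" "grad f z"] by metis
  show ?thesis
  proof (cases "t = 0")
    case False
    have "inner (G c) (- t) = 0" if "c \<in> Act" for c
      using xt(2)[of "G c"] that by (simp add: span_base Linear_Algebra.orthogonal_def inner_commute)
    moreover have "inner (grad f z) (- t) < 0"
      using xt(2)[OF xt(1)] False unfolding xt(3)
      by (simp add: Linear_Algebra.orthogonal_def inner_add_left inner_add_right inner_commute)
    ultimately show ?thesis using that[of "- t"] by simp
  next
    case True
    then have "grad f z \<in> span (G ` Act)" using xt by simp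
    then obtain u where "grad f z = (\<Sum>v\<in>G ` Act. u v *\<^sub>R v)"
      unfolding span_finite[OF finite_imageI[OF fin_Act]] by blast
    then have g: "grad f z = (\<Sum>c\<in>Act. u (G c) *\<^sub>R G c)" by (simp add: sum.reindex[OF inj])
    obtain w where w: "\<And>c. multiplier w c = (if c \<in> Act then u (G c) else 0)"
      using multiplier_surj[of "\<lambda>c. if c \<in> Act then u (G c) else 0"] by blast
    have "\<exists>j\<in>ineq_idx P. multiplier w (Ineq_C j) < 0"
    proof (rule ccontr)
      assume neg: "\<not> ?thesis"
      have "grad f z = (\<Sum>c\<in>all_constr P. multiplier w c *\<^sub>R G c)"
        unfolding g by (rule sum.mono_neutral_cong_left[OF fin_all Act_all]) (auto simp: w)
      moreover have "multiplier w c * constr_fun P c z = 0" if "c \<in> all_constr P" for c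
        using that by (simp add: w Act_eq)
      ultimately have "W_stationary_with P z w"
        unfolding W_stationary_with_iff[OF fin] G_def using feas neg by (auto simp: not_less)
      then show False using ns by blast
    qed
    then obtain j where j: "Ineq_C j \<in> Act" "u (G (Ineq_C j)) < 0" by (auto simp: w simp del: multiplier.simps split: if_splits)
    have "inner (grad f z) (D (Ineq_C j)) = (\<Sum>c\<in>Act. u (G c) * inner (G c) (D (Ineq_C j)))"
      unfolding g by (simp add: inner_sum_left)
    also have "\<dots> = (\<Sum>c\<in>Act. if c = Ineq_C j then u (G (Ineq_C j)) else 0)"
      by (intro sum.cong refl) (simp add: dualG j(1))
    also have "\<dots> = u (G (Ineq_C j))" using j(1) fin_Act by simp
    finally have "inner (grad f z) (D (Ineq_C j)) < 0" using j(2) by simp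
    then show ?thesis
      by (intro that[of "D (Ineq_C j)"]) (auto simp: dualG j(1))
  qed
qed

lemma tcone_add:
  assumes v: "v \<in> tcone" and t: "t \<ge> 0"
    and y: "\<And>c. c \<in> Act \<Longrightarrow> c \<in> range Ineq_C \<Longrightarrow> inner (G c) y \<ge> 0"
    "\<And>c. c \<in> Act \<Longrightarrow> c \<notin> range Ineq_C \<Longrightarrow> inner (G c) y = 0"
  shows "v + t *\<^sub>R y \<in> tcone"
proof -
  have "inner (G c) (v + t *\<^sub>R y) = inner (G c) v" if "c \<in> eq_like \<union> Sw1_C ` beta_idx P z \<union> Sw2_C ` beta_idx P z" for c
  proof -
    have "c \<in> Act" "c \<notin> range Ineq_C" using that Act_split unfolding eq_like_def by auto
    then show ?thesis using y(2) by (simp add: inner_add_right)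
  qed
  moreover have "inner (G (Ineq_C j)) (v + t *\<^sub>R y) \<ge> inner (G (Ineq_C j)) v" if "j \<in> active_ineq P z" for j
    using y(1)[of "Ineq_C j"] Act_split that t by (simp add: inner_add_right)
  ultimately show ?thesis using v unfolding tcone_def by (force simp: image_iff)
qed

definition descends :: "real ^ 'n \<Rightarrow> real \<Rightarrow> real \<Rightarrow> bool" where
  "descends y k d \<longleftrightarrow> 0 < k \<and> 0 < d \<and> d \<le> r \<and> (\<forall>v. pushes v y) \<and>
     (\<forall>v\<in>tcone. \<forall>t\<ge>0. v + t *\<^sub>R y \<in> tcone) \<and>
     (\<forall>v t. norm v < d \<longrightarrow> t \<ge> 0 \<longrightarrow> norm (v + t *\<^sub>R y) < d \<longrightarrow> f (\<Psi> (v + t *\<^sub>R y)) \<le> f (\<Psi> v) - k * t)"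

lemma descendsD:
  assumes "descends y k d"
  shows "k > 0" "d > 0" "d \<le> r" "\<And>v. pushes v y" "\<And>v t. v \<in> tcone \<Longrightarrow> t \<ge> 0 \<Longrightarrow> v + t *\<^sub>R y \<in> tcone"
    "\<And>v t. norm v < d \<Longrightarrow> t \<ge> 0 \<Longrightarrow> norm (v + t *\<^sub>R y) < d \<Longrightarrow> f (\<Psi> (v + t *\<^sub>R y)) \<le> f (\<Psi> v) - k * t"
  using assms unfolding descends_def by auto

text \<open>By strict differentiability the descent direction at \<open>z\<close> works with one
  rate at all nearby points.\<close>

lemma uniform_descent:
  assumes ns: "\<And>w. \<not> W_stationary_with P z w"
  obtains y k d where "descends y k d"
proof -
  obtain y where y: "\<And>c. c \<in> Act \<Longrightarrow> c \<in> range Ineq_C \<Longrightarrow> inner (G c) y \<ge> 0"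
    "\<And>c. c \<in> Act \<Longrightarrow> c \<notin> range Ineq_C \<Longrightarrow> inner (G c) y = 0" "inner (grad f z) y < 0"
    using descent_direction[OF ns] by blast
  define k where "k = - inner (grad f z) y / 2"
  have k: "k > 0" unfolding k_def using y(3) by simp
  define e where "e = k / (norm y + 1)"
  have n1: "norm y + 1 > 0" by (simp add: add_nonneg_pos)
  have e: "e > 0" "e * norm y \<le> k" unfolding e_def using k n1 by (auto simp: field_simps)
  obtain d where d: "d > 0" "\<And>v w. norm v < d \<Longrightarrow> norm w < d \<Longrightarrow>
     \<bar>f (\<Psi> w) - f (\<Psi> v) - inner (grad f z) (w - v)\<bar> \<le> e * norm (w - v)"
    using strict_expansion_first_order_compose[OF C2D(1)[OF C2f] C2D(3)[OF C2f] near_id \<Psi>0 e(1)] by blast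
  have "f (\<Psi> (v + t *\<^sub>R y)) \<le> f (\<Psi> v) - k * t" if "norm v < min d r" "t \<ge> 0" "norm (v + t *\<^sub>R y) < min d r" for v t
  proof -
    have "\<bar>f (\<Psi> (v + t *\<^sub>R y)) - f (\<Psi> v) - inner (grad f z) (t *\<^sub>R y)\<bar> \<le> e * norm (t *\<^sub>R y)"
      using d(2)[of v "v + t *\<^sub>R y"] that by simp
    moreover have "e * norm (t *\<^sub>R y) \<le> t * k" using mult_left_mono[OF e(2) that(2)] that(2) by (simp add: mult_ac)
    moreover have "inner (grad f z) (t *\<^sub>R y) = - (2 * (t * k))" unfolding k_def by simp
    ultimately show ?thesis by (simp add: abs_le_iff mult.commute)
  qed
  moreover have "pushes v y" for v unfolding pushes_def using y by auto
  moreover have "v + t *\<^sub>R y \<in> tcone" if "v \<in> tcone" "t \<ge> 0" for v t by (rule tcone_add[OF that y(1,2)])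
  ultimately have "descends y k (min d r)" unfolding descends_def using k d(1) r by auto
  then show ?thesis by (rule that)
qed

text \<open>A lower point \<open>v\<close> moves to \<open>v + t0 *\<^sub>R y\<close>, and then its
  part \<open>v\<close> is scaled down. The second motion may raise \<open>f\<close>, but by less
  than the drop \<open>k * t0\<close> gained from \<open>y\<close>. So all lower points reach
  \<open>t0 *\<^sub>R y\<close>.\<close>

lemma nonstationary_lower_joined:
  assumes ns: "\<And>w. \<not> W_stationary_with P z w"
  shows "lower_joined f M z"
proof -
  obtain y k d where "descends y k d" by (rule uniform_descent[OF ns])
  note y = descendsD[OF this]
  let ?L = "{v\<in>tcone. norm v < r \<and> f (\<Psi> v) < f (\<Psi> 0)}"
  define t0 where "t0 = d / (2 * (norm y + 1))"
  have n1: "norm y + 1 > 0" by (simp add: add_nonneg_pos)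
  have t0: "t0 > 0" "t0 * norm y \<le> d / 2" unfolding t0_def using y(2) n1 by (auto simp: field_simps)
  have "0 < k * t0" using y(1) t0(1) by simp
  then obtain d1 where d1: "d1 > 0" "\<And>v. norm v < d1 \<Longrightarrow> \<bar>f (\<Psi> v) - f (\<Psi> 0)\<bar> < k * t0"
    using isCont_f_\<Psi> unfolding continuous_at_eps_delta by (auto simp: dist_norm)
  define e where "e = min d1 (d / 2)"
  have e: "e > 0" unfolding e_def using d1 y(2) by simp
  obtain \<rho> where \<rho>: "\<rho> > 0" "\<And>x. x \<in> M \<Longrightarrow> dist x z < \<rho> \<Longrightarrow> \<exists>v\<in>tcone. norm v < e \<and> norm v < r \<and> \<Psi> v = x"
    using feasible_near[OF e] by blast
  have reach: "path_component ?L v (t0 *\<^sub>R y)" if v: "v \<in> tcone" "norm v < e" "f (\<Psi> v) < f (\<Psi> 0)" for v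
  proof -
    have nv: "norm v < d1" "norm v < d / 2" using v(2) unfolding e_def by auto
    have "closed_segment v (v + t0 *\<^sub>R y) \<subseteq> ?L"
    proof
      fix u assume "u \<in> closed_segment v (v + t0 *\<^sub>R y)"
      then obtain s where s: "0 \<le> s" "s \<le> 1" "u = (1 - s) *\<^sub>R v + s *\<^sub>R (v + t0 *\<^sub>R y)"
        unfolding closed_segment_def by blast
      have u: "u = v + (s * t0) *\<^sub>R y" unfolding s(3) by (simp add: algebra_simps)
      have st: "0 \<le> s * t0" using s t0 by simp
      have "norm ((s * t0) *\<^sub>R y) = s * (t0 * norm y)" using s(1) t0(1) by (simp add: abs_mult)
      also have "\<dots> \<le> 1 * (t0 * norm y)" using s t0 by (intro mult_right_mono) auto
      finally have "norm ((s * t0) *\<^sub>R y) \<le> d / 2" using t0(2) by linarith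
      then have ud: "norm u < d" unfolding u using norm_triangle_ineq[of v "(s * t0) *\<^sub>R y"] nv(2) by linarith
      have "f (\<Psi> u) \<le> f (\<Psi> v) - k * (s * t0)"
        unfolding u by (rule y(6)) (use nv y(2) st ud u in auto)
      moreover have "0 \<le> k * (s * t0)" using y(1) st by simp
      ultimately have "f (\<Psi> u) < f (\<Psi> 0)" using v(3) by linarith
      then show "u \<in> ?L" using ud y(3) y(5)[OF v(1) st] u by simp
    qed
    then have 1: "path_component ?L v (v + t0 *\<^sub>R y)" by (rule path_component_linepath)
    have "closed_segment (v + t0 *\<^sub>R y) (t0 *\<^sub>R y) \<subseteq> ?L"
    proof
      fix u assume "u \<in> closed_segment (v + t0 *\<^sub>R y) (t0 *\<^sub>R y)"
      then obtain s where s: "0 \<le> s" "s \<le> 1" "u = (1 - s) *\<^sub>R (v + t0 *\<^sub>R y) + s *\<^sub>R (t0 *\<^sub>R y)"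
        unfolding closed_segment_def by blast
      have u: "u = (1 - s) *\<^sub>R v + t0 *\<^sub>R y" unfolding s(3) by (simp add: algebra_simps)
      have sv: "norm ((1 - s) *\<^sub>R v) \<le> norm v" using s by (simp add: mult_left_le_one_le)
      have ud: "norm u < d"
        unfolding u using norm_triangle_ineq[of "(1 - s) *\<^sub>R v" "t0 *\<^sub>R y"] sv nv(2) t0 by simp
      have "f (\<Psi> u) \<le> f (\<Psi> ((1 - s) *\<^sub>R v)) - k * t0"
        unfolding u by (rule y(6)) (use sv nv(2) y(2) t0 ud u in auto)
      moreover have "\<bar>f (\<Psi> ((1 - s) *\<^sub>R v)) - f (\<Psi> 0)\<bar> < k * t0" using d1(2) sv nv(1) by simp
      ultimately have "f (\<Psi> u) < f (\<Psi> 0)" by linarith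
      moreover have "u \<in> tcone" unfolding u using s t0 by (intro y(5) tcone_scale v(1)) auto
      ultimately show "u \<in> ?L" using ud y(3) by simp
    qed
    then have "path_component ?L (v + t0 *\<^sub>R y) (t0 *\<^sub>R y)" by (rule path_component_linepath)
    then show ?thesis using 1 path_component_trans by blast
  qed
  have "path_component {x\<in>M. f x < f z} x x'"
    if x: "x \<in> M" "x' \<in> M" "dist x z < \<rho>" "dist x' z < \<rho>" "f x < f z" "f x' < f z" for x x'
  proof -
    obtain v where v: "v \<in> tcone" "norm v < e" "\<Psi> v = x" using \<rho>(2)[OF x(1,3)] by blast
    obtain v' where v': "v' \<in> tcone" "norm v' < e" "\<Psi> v' = x'" using \<rho>(2)[OF x(2,4)] by blast
    have "path_component ?L v (t0 *\<^sub>R y)" using reach[OF v(1,2)] v(3) x(5) \<Psi>0 by simp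
    moreover have "path_component ?L v' (t0 *\<^sub>R y)" using reach[OF v'(1,2)] v'(3) x(6) \<Psi>0 by simp
    ultimately have "path_component ?L v v'" using path_component_sym path_component_trans by blast
    then show ?thesis using path_component_lower v(3) v'(3) by blast
  qed
  then show ?thesis unfolding lower_joined_def using \<rho>(1) by blast
qed

lemma nonstationary_neighbourhood:
  assumes ns: "\<And>w. \<not> W_stationary_with P z w"
  shows "\<exists>\<rho>>0. \<forall>x. dist x z < \<rho> \<longrightarrow> (\<forall>w. \<not> W_stationary_with P x w)"
proof -
  obtain y k d where "descends y k d" by (rule uniform_descent[OF ns])
  note y = descendsD[OF this]
  obtain \<rho> where \<rho>: "\<rho> > 0" "\<And>x. x \<in> M \<Longrightarrow> dist x z < \<rho> \<Longrightarrow> \<exists>v\<in>tcone. norm v < d \<and> norm v < r \<and> \<Psi> v = x"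
    using feasible_near[OF y(2)] by blast
  have False if x: "dist x z < \<rho>" "W_stationary_with P x w" for x w
  proof -
    have "x \<in> M" using x(2) unfolding W_stationary_with_def by blast
    then obtain v where v: "norm v < d" "norm v < r" "\<Psi> v = x" using \<rho>(2) x(1) by blast
    define t0 where "t0 = (d - norm v) / (norm y + 1)"
    have n1: "norm y + 1 > 0" by (simp add: add_nonneg_pos)
    have t0: "t0 > 0" unfolding t0_def using v n1 by simp
    obtain t where t: "0 < t" "t < t0" "f (\<Psi> (v + t *\<^sub>R y)) > f (\<Psi> v) - k * t"
      using no_descent_at_W_stationary[OF v(2) _ y(4) y(1) t0] x(2) v(3) by blast
    have "t * (norm y + 1) < d - norm v" using t(2) n1 unfolding t0_def by (simp add: pos_less_divide_eq)
    then have "norm (v + t *\<^sub>R y) < d"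
      using norm_triangle_ineq[of v "t *\<^sub>R y"] t(1) by (simp add: algebra_simps)
    then show False using y(6)[OF v(1), of t] t by simp
  qed
  then show ?thesis using \<rho>(1) by blast
qed

lemma local_minimizer_W_stationary:
  assumes min: "local_minimizer P z"
  shows "\<exists>w. W_stationary_with P z w"
proof (rule ccontr)
  assume "\<not> ?thesis"
  then have ns: "\<And>w. \<not> W_stationary_with P z w" by blast
  obtain y k d where "descends y k d" by (rule uniform_descent[OF ns])
  note y = descendsD[OF this]
  obtain e where e: "e > 0" "\<And>x. x \<in> M \<Longrightarrow> dist x z < e \<Longrightarrow> f z \<le> f x"
    using min unfolding local_minimizer_def by blast
  define t where "t = min d (e / 2) / (2 * (norm y + 1))"
  have n1: "norm y + 1 > 0" by (simp add: add_nonneg_pos)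
  have m: "min d (e / 2) > 0" using y(2) e(1) by simp
  then have t: "t > 0" unfolding t_def using n1 by simp
  have "t * (norm y + 1) = min d (e / 2) / 2" unfolding t_def using n1 by (simp add: field_simps)
  then have "norm (t *\<^sub>R y) < min d (e / 2)" using t m by (simp add: distrib_left del: min_less_iff_conj)
  then have n: "norm (t *\<^sub>R y) < d" "norm (t *\<^sub>R y) < e / 2" by auto
  then have nr: "norm (t *\<^sub>R y) < r" using y(3) by linarith
  have "0 \<in> tcone" unfolding tcone_def by simp
  then have "t *\<^sub>R y \<in> tcone" using y(5)[of 0 t] t by simp
  then have "\<Psi> (t *\<^sub>R y) \<in> M" using feasible_iff[OF nr] by blast
  moreover have "dist (\<Psi> (t *\<^sub>R y)) z < e" using \<Psi>_dist[OF nr] n(2) by linarith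
  ultimately have "f z \<le> f (\<Psi> (t *\<^sub>R y))" by (rule e(2))
  moreover have "f (\<Psi> (t *\<^sub>R y)) \<le> f (\<Psi> 0) - k * t" using y(6)[of 0 t] y(2) n(1) t by simp
  moreover have "k * t > 0" using y(1) t by simp
  ultimately show False using \<Psi>0 by simp
qed

end

text \<open>A chart at a nondegenerate W-stationary point, with a basis \<open>B\<close> of the
  tangent space in which the Hessian of the Lagrange function is diagonal.\<close>

locale stationary_chart = chart P z D \<Psi> r
  for P :: "('n::finite, 'i, 'j) mpsc" and z D \<Psi> r +
  fixes w :: "('i, 'j) multipliers" and B :: "(real ^ 'n) set"
  assumes stat: "W_stationary_with P z w"
    and mu_pos: "j \<in> active_ineq P z \<Longrightarrow> mu w j > 0"
    and sig_nz: "m \<in> beta_idx P z \<Longrightarrow> sig1 w m \<noteq> 0" "m \<in> beta_idx P z \<Longrightarrow> sig2 w m \<noteq> 0"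
    and B_fin: "finite B" and B_span: "span B = tangent_space P z"
    and B_diag: "b \<in> B \<Longrightarrow> c \<in> B \<Longrightarrow> b \<noteq> c \<Longrightarrow> inner b (hessian (lagrangian P w) z *v c) = 0"
    and B_nondeg: "b \<in> B \<Longrightarrow> inner b (hessian (lagrangian P w) z *v b) \<noteq> 0"
begin

definition A :: "real ^ 'n \<Rightarrow> real ^ 'n" where "A v = hessian (lagrangian P w) z *v v"

text \<open>Coordinates of \<open>\<real>\<^sup>n\<close>: the values of the linearized active
  constraints, followed by the coordinates in \<open>B\<close> of the remaining tangent vector. The
  latter are read off from the Hessian form, for which \<open>B\<close> is orthogonal.\<close>

definition basis :: "('i, 'j) constr + real ^ 'n \<Rightarrow> real ^ 'n" where
  "basis k = (case k of Inl c \<Rightarrow> D c | Inr b \<Rightarrow> b)"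

definition tangent_part :: "real ^ 'n \<Rightarrow> real ^ 'n" where
  "tangent_part v = v - (\<Sum>c\<in>Act. inner (G c) v *\<^sub>R D c)"

definition coord :: "('i, 'j) constr + real ^ 'n \<Rightarrow> real ^ 'n \<Rightarrow> real" where
  "coord k v = (case k of Inl c \<Rightarrow> inner (G c) v | Inr b \<Rightarrow> inner (A b) (tangent_part v) / inner (A b) b)"

definition weight :: "('i, 'j) constr + real ^ 'n \<Rightarrow> real" where
  "weight k = (case k of Inl c \<Rightarrow> multiplier w c | Inr b \<Rightarrow> 0)"

lemma tangent_space_eq: "tangent_space P z = {v. \<forall>c\<in>Act. inner (G c) v = 0}"
proof -
  have "frechet_derivative (constr_fun P c) (at z) = (\<lambda>v. inner (G c) v)" if "c \<in> Act" for c
  proof -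
    have "C2 (constr_fun P c)" using that Act_all C2_constr[OF C2] by blast
    from C2D(1)[OF this] show ?thesis unfolding G_def by (rule frechet_derivative_at[symmetric])
  qed
  then show ?thesis unfolding tangent_space_def by auto
qed

lemma B_tangent: "b \<in> B \<Longrightarrow> c \<in> Act \<Longrightarrow> inner (G c) b = 0"
  using span_base[of b B] B_span tangent_space_eq by auto

lemma A_linear: "linear A"
  unfolding A_def[abs_def] by (rule matrix_vector_mul_linear)

lemma tangent_part_D: "b \<in> Act \<Longrightarrow> tangent_part (D b) = 0"
proof -
  assume b: "b \<in> Act"
  have "(\<Sum>c\<in>Act. inner (G c) (D b) *\<^sub>R D c) = (\<Sum>c\<in>Act. if c = b then D b else 0)"
    by (intro sum.cong refl) (simp add: dualG b)
  then show ?thesis unfolding tangent_part_def using b fin_Act by simp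
qed

lemma tangent_part_B: "b \<in> B \<Longrightarrow> tangent_part b = b"
  unfolding tangent_part_def using B_tangent by simp

lemma tangent_part_span: "tangent_part v \<in> span B"
proof -
  have "inner (G b) (tangent_part v) = 0" if b: "b \<in> Act" for b
  proof -
    have "inner (G b) (\<Sum>c\<in>Act. inner (G c) v *\<^sub>R D c) = (\<Sum>c\<in>Act. if c = b then inner (G b) v else 0)"
      unfolding inner_sum_right by (intro sum.cong refl) (simp add: dualG b)
    also have "\<dots> = inner (G b) v" using b fin_Act by simp
    finally show ?thesis unfolding tangent_part_def by (simp add: inner_diff_right)
  qed
  then show ?thesis unfolding B_span tangent_space_eq by blast
qed

lemma A_sym: "inner (A u) v = inner u (A v)"
  unfolding A_def
  by (rule gradient_derivative_symmetric[OF lagrangian_gradient(1)[OF fin C2]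
        has_derivative_hessian[OF lagrangian_gradient(3)[OF fin C2]]])

lemma tangent_part_expand: "tangent_part v = (\<Sum>b\<in>B. (inner (A b) (tangent_part v) / inner (A b) b) *\<^sub>R b)"
proof -
  obtain u where u: "tangent_part v = (\<Sum>b\<in>B. u b *\<^sub>R b)"
    using tangent_part_span[of v] unfolding span_finite[OF B_fin] by blast
  have "inner (A b) (tangent_part v) / inner (A b) b = u b" if b: "b \<in> B" for b
  proof -
    have "inner (A b) (tangent_part v) = (\<Sum>c\<in>B. if c = b then u b * inner (A b) b else 0)"
      unfolding u inner_sum_right
      by (intro sum.cong refl) (use B_diag[OF b] A_sym in \<open>auto simp: A_def\<close>)
    then have "inner (A b) (tangent_part v) = u b * inner (A b) b" using b B_fin by simp
    moreover have "inner (A b) b \<noteq> 0" using B_nondeg[OF b] A_sym[of b b] unfolding A_def by simp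
    ultimately show ?thesis by simp
  qed
  then have "(\<Sum>b\<in>B. (inner (A b) (tangent_part v) / inner (A b) b) *\<^sub>R b) = (\<Sum>b\<in>B. u b *\<^sub>R b)"
    by (intro sum.cong refl) simp
  then show ?thesis using u by simp
qed

sublocale nc: normal_cone "Inl ` Act" "Inr ` B" basis coord weight A
  "Inl ` eq_like" "Inl ` Ineq_C ` active_ineq P z" "beta_idx P z" "\<lambda>m. Inl (Sw1_C m)" "\<lambda>m. Inl (Sw2_C m)"
proof
  show "finite (Inl ` Act)" "finite (Inr ` B)" "Inl ` Act \<inter> Inr ` B = {}" using fin_Act B_fin by auto
  have lt: "linear tangent_part"
    unfolding tangent_part_def[abs_def]
    by (auto intro!: linearI simp: inner_add_right scaleR_add_left sum.distrib scaleR_sum_right algebra_simps)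
  have lc: "linear (coord k)" for k
    unfolding coord_def[abs_def]
    by (cases k) (auto intro!: linearI simp: inner_add_right linear_add[OF lt] linear_scale[OF lt] add_divide_distrib)
  fix k l :: "('i, 'j) constr + real ^ 'n" and x y :: "real ^ 'n" and a :: real
  show "A (x + y) = A x + A y" "A (a *\<^sub>R x) = a *\<^sub>R A x"
    by (rule linear_add[OF A_linear], rule linear_scale[OF A_linear])
  show "coord k (x + y) = coord k x + coord k y" "coord k (a *\<^sub>R x) = a *\<^sub>R coord k x"
    using linear_add[OF lc] linear_scale[OF lc] by simp_all
  assume k: "k \<in> Inl ` Act \<union> Inr ` B" and l: "l \<in> Inl ` Act \<union> Inr ` B"
  have nd: "inner (A b) b \<noteq> 0" if "b \<in> B" for b using B_nondeg[OF that] A_sym[of b b] unfolding A_def by simp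
  have dg: "inner (A b) c = 0" if "b \<in> B" "c \<in> B" "b \<noteq> c" for b c
    using B_diag[OF that] A_sym[of b c] unfolding A_def by simp
  show "coord k (basis l) = (if k = l then 1 else 0)"
  proof (cases "k = l")
    case True
    then show ?thesis using k by (auto simp: coord_def basis_def dualG tangent_part_B nd)
  next
    case False
    then show ?thesis
      using k l
      by (elim UnE imageE) (simp_all add: coord_def basis_def dualG B_tangent tangent_part_D tangent_part_B dg)
  qed
next
  fix v :: "real ^ 'n"
  have "(\<Sum>k\<in>Inl ` Act \<union> Inr ` B. coord k v *\<^sub>R basis k) = (\<Sum>k\<in>Inl ` Act. coord k v *\<^sub>R basis k) + (\<Sum>k\<in>Inr ` B. coord k v *\<^sub>R basis k)"
    using fin_Act B_fin by (intro sum.union_disjoint) auto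
  also have "(\<Sum>k\<in>Inl ` Act. coord k v *\<^sub>R basis k) = v - tangent_part v"
    by (simp add: sum.reindex coord_def basis_def tangent_part_def)
  also have "(\<Sum>k\<in>Inr ` B. coord k v *\<^sub>R basis k) = tangent_part v"
    by (simp add: sum.reindex coord_def basis_def flip: tangent_part_expand)
  finally show "v = (\<Sum>k\<in>Inl ` Act \<union> Inr ` B. coord k v *\<^sub>R basis k)" by simp
next
  fix b c :: "('i, 'j) constr + real ^ 'n" assume b: "b \<in> Inr ` B" and c: "c \<in> Inr ` B"
  show "inner (A (basis b)) (basis b) \<noteq> 0"
    using b B_nondeg A_sym unfolding basis_def A_def by auto
  assume "b \<noteq> c"
  then show "inner (A (basis b)) (basis c) = 0"
    using b c by (elim imageE) (simp add: basis_def A_sym, simp add: A_def B_diag)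
next
  show "Inl ` Act = Inl ` eq_like \<union> Inl ` Ineq_C ` active_ineq P z \<union> (\<lambda>m. Inl (Sw1_C m)) ` beta_idx P z \<union> (\<lambda>m. Inl (Sw2_C m)) ` beta_idx P z"
    unfolding Act_split by (auto simp: image_image)
  show "finite (beta_idx P z)" unfolding beta_idx_def by simp
  show "inj_on (\<lambda>m. Inl (Sw1_C m)) (beta_idx P z)" "inj_on (\<lambda>m. Inl (Sw2_C m)) (beta_idx P z)"
    by (auto simp: inj_on_def)
  show "(\<lambda>m. Inl (Sw1_C m)) ` beta_idx P z \<inter> (\<lambda>m. Inl (Sw2_C m)) ` beta_idx P z = {}" by auto
  show "(Inl ` eq_like \<union> Inl ` Ineq_C ` active_ineq P z) \<inter> ((\<lambda>m. Inl (Sw1_C m)) ` beta_idx P z \<union> (\<lambda>m. Inl (Sw2_C m)) ` beta_idx P z) = {}"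
    unfolding eq_like_def alpha_idx_def beta_idx_def gamma_idx_def by auto
qed (use mu_pos sig_nz in \<open>auto simp: weight_def\<close>)

lemma cone_eq: "nc.cone = tcone"
  unfolding nc.cone_def tcone_def by (simp add: coord_def)

text \<open>In the chart the active constraints are linear, so \<open>f\<close> is the Lagrange
  function plus the linear form of the multipliers, and the Lagrange function has gradient zero at
  \<open>z\<close>.\<close>

lemma expands: "nc.expands (\<lambda>v. f (\<Psi> v))"
  unfolding nc.expands_def
proof (intro allI impI)
  fix \<epsilon> :: real assume \<epsilon>: "\<epsilon> > 0"
  define L where "L = lagrangian P w"
  have st: "grad f z = (\<Sum>c\<in>all_constr P. multiplier w c *\<^sub>R grad (constr_fun P c) z)"
    "\<And>c. c \<in> all_constr P \<Longrightarrow> multiplier w c * constr_fun P c z = 0"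
    using stat unfolding W_stationary_with_iff[OF fin] by auto
  have L0: "grad L z = 0" unfolding L_def lagrangian_gradient(2)[OF fin C2] using st(1) by simp
  have "(grad L has_derivative A) (at z)"
    using has_derivative_hessian[OF lagrangian_gradient(3)[OF fin C2]] unfolding L_def A_def[abs_def] .
  from strict_expansion_second_order_compose[OF _ this L0 near_id \<Psi>0 \<epsilon>] lagrangian_gradient(1)[OF fin C2]
  obtain d where d: "d > 0" "\<And>v w. norm v < d \<Longrightarrow> norm w < d \<Longrightarrow>
     \<bar>L (\<Psi> w) - L (\<Psi> v) - inner (A (w + v)) (w - v) / 2\<bar> \<le> \<epsilon> * (norm v + norm w) * norm (w - v)"
    unfolding L_def by blast
  have fL: "f (\<Psi> v) = L (\<Psi> v) + (\<Sum>c\<in>Act. multiplier w c * inner (G c) v)" if v: "norm v < r" for v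
  proof -
    have "(\<Sum>c\<in>Act. multiplier w c * inner (G c) v) = (\<Sum>c\<in>all_constr P. multiplier w c * constr_fun P c (\<Psi> v))"
    proof (rule sum.mono_neutral_cong_left[OF fin_all Act_all])
      show "\<forall>c\<in>all_constr P - Act. multiplier w c * constr_fun P c (\<Psi> v) = 0"
        using st(2) Act_eq by auto
    qed (simp add: straightG[OF v])
    then show ?thesis unfolding L_def lagrangian_eq[OF fin] by simp
  qed
  show "\<exists>d>0. \<forall>v v'. norm v < d \<longrightarrow> norm v' < d \<longrightarrow>
     \<bar>f (\<Psi> v') - f (\<Psi> v) - (\<Sum>c\<in>Inl ` Act. weight c * (coord c v' - coord c v)) - inner (A (v' + v)) (v' - v) / 2\<bar>
       \<le> \<epsilon> * (norm v + norm v') * norm (v' - v)"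
  proof (intro exI[of _ "min d r"] conjI allI impI)
    fix v v' :: "real ^ 'n" assume v: "norm v < min d r" "norm v' < min d r"
    have "(\<Sum>c\<in>Inl ` Act. weight c * (coord c v' - coord c v))
        = (\<Sum>c\<in>Act. multiplier w c * inner (G c) v') - (\<Sum>c\<in>Act. multiplier w c * inner (G c) v)"
      by (simp add: sum.reindex weight_def coord_def right_diff_distrib sum_subtractf)
    then show "\<bar>f (\<Psi> v') - f (\<Psi> v) - (\<Sum>c\<in>Inl ` Act. weight c * (coord c v' - coord c v)) - inner (A (v' + v)) (v' - v) / 2\<bar>
       \<le> \<epsilon> * (norm v + norm v') * norm (v' - v)"
      using d(2)[of v v'] fL[of v] fL[of v'] v by simp
  qed (use d r in auto)
qed

lemma card_Bneg: "card nc.Bneg = card {b\<in>B. inner b (hessian (lagrangian P w) z *v b) < 0}"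
proof -
  have "nc.Bneg = Inr ` {b\<in>B. inner b (hessian (lagrangian P w) z *v b) < 0}"
    unfolding nc.Bneg_def nc.\<kappa>_def by (auto simp: basis_def A_def inner_commute)
  then show ?thesis by (simp add: card_image)
qed

text \<open>The direction \<open>flip v\<close> does not change the constraints that are active at
  \<open>\<Psi> v\<close>, because they are coordinates of value 0. It lowers \<open>f\<close> at
  the rate \<open>\<eta> * mass v\<close>, which at a W-stationary point has to be 0.\<close>

lemma isolated:
  "\<exists>\<rho>>0. \<forall>x w'. dist x z < \<rho> \<longrightarrow> W_stationary_with P x w' \<longrightarrow> x = z"
proof -
  obtain \<delta> \<eta> where d: "\<delta> > 0" "\<eta> > 0" "\<And>v s. v \<in> tcone \<Longrightarrow> norm v < \<delta> \<Longrightarrow> 0 \<le> s \<Longrightarrow> s \<le> 1 \<Longrightarrow>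
      f (\<Psi> (v + s *\<^sub>R nc.flip v)) \<le> f (\<Psi> v) - s * \<eta> * nc.mass v"
    by (rule nc.cone_flip_descent[OF expands, unfolded cone_eq]) (rule that)
  obtain \<rho> where \<rho>: "\<rho> > 0" "\<And>x. x \<in> M \<Longrightarrow> dist x z < \<rho> \<Longrightarrow> \<exists>v\<in>tcone. norm v < \<delta> \<and> norm v < r \<and> \<Psi> v = x"
    using feasible_near[OF d(1)] by blast
  have "x = z" if x: "dist x z < \<rho>" "W_stationary_with P x w'" for x w'
  proof -
    have "x \<in> M" using x(2) unfolding W_stationary_with_def by blast
    then obtain v where v: "v \<in> tcone" "norm v < \<delta>" "norm v < r" "\<Psi> v = x" using \<rho>(2) x(1) by blast
    have "nc.mass v = 0"
    proof (rule ccontr)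
      assume "nc.mass v \<noteq> 0"
      then have k: "\<eta> * nc.mass v > 0" using nc.mass_nonneg[of v] d(2) by simp
      have "pushes v (nc.flip v)"
        unfolding pushes_def
      proof (intro ballI impI)
        fix c assume c: "c \<in> Act" "inner (G c) v = 0"
        then have "coord (Inl c) (nc.flip v) = 0"
          using nc.coord_flip[of "Inl c" v] by (simp add: coord_def split: if_splits)
        then show "if c \<in> range Ineq_C then 0 \<le> inner (G c) (nc.flip v) else inner (G c) (nc.flip v) = 0"
          by (simp add: coord_def)
      qed
      then obtain t where t: "0 < t" "t < 1" "f (\<Psi> (v + t *\<^sub>R nc.flip v)) > f (\<Psi> v) - (\<eta> * nc.mass v) * t"
        using no_descent_at_W_stationary[OF v(3) _ _ k, of w' "nc.flip v" 1] x(2) v(4) by auto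
      have "f (\<Psi> (v + t *\<^sub>R nc.flip v)) \<le> f (\<Psi> v) - t * \<eta> * nc.mass v"
        using d(3)[OF v(1,2), of t] t by simp
      then show False using t(3) by (simp add: mult_ac)
    qed
    then have "v = 0" by (rule nc.mass_eq_0)
    then show "x = z" using v(4) \<Psi>0 by simp
  qed
  then show ?thesis using \<rho>(1) by blast
qed

lemma stationary_lower_joined:
  assumes index: "card (beta_idx P z) + card nc.Bneg \<noteq> 1"
  shows "lower_joined f M z"
proof -
  let ?L = "{v\<in>tcone. norm v < r \<and> f (\<Psi> v) < f (\<Psi> 0)}"
  obtain \<delta> where d: "\<delta> > 0" "\<And>v v'. v \<in> tcone \<Longrightarrow> v' \<in> tcone \<Longrightarrow> norm v < \<delta> \<Longrightarrow> norm v' < \<delta> \<Longrightarrow>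
     f (\<Psi> v) < f (\<Psi> 0) \<Longrightarrow> f (\<Psi> v') < f (\<Psi> 0) \<Longrightarrow> path_component ?L v v'"
    using nc.lower_points_joined[OF expands isCont_f_\<Psi> r index] unfolding cone_eq by blast
  obtain \<rho> where \<rho>: "\<rho> > 0" "\<And>x. x \<in> M \<Longrightarrow> dist x z < \<rho> \<Longrightarrow> \<exists>v\<in>tcone. norm v < \<delta> \<and> norm v < r \<and> \<Psi> v = x"
    using feasible_near[OF d(1)] by blast
  have "path_component {x\<in>M. f x < f z} x x'"
    if x: "x \<in> M" "x' \<in> M" "dist x z < \<rho>" "dist x' z < \<rho>" "f x < f z" "f x' < f z" for x x'
  proof -
    obtain v where v: "v \<in> tcone" "norm v < \<delta>" "\<Psi> v = x" using \<rho>(2)[OF x(1,3)] by blast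
    obtain v' where v': "v' \<in> tcone" "norm v' < \<delta>" "\<Psi> v' = x'" using \<rho>(2)[OF x(2,4)] by blast
    have "path_component ?L v v'" using v v' x \<Psi>0 by (intro d(2)) auto
    from path_component_lower[OF this] show ?thesis using v(3) v'(3) by simp
  qed
  then show ?thesis unfolding lower_joined_def using \<rho>(1) by blast
qed

lemma stationary_lower_two_classes:
  assumes index: "card (beta_idx P z) + card nc.Bneg = 1"
  shows "\<exists>p q. p \<in> M \<and> f p < f z \<and> q \<in> M \<and> f q < f z \<and> lower_reached_from f M z p q"
proof -
  let ?L = "{v\<in>tcone. norm v < r \<and> f (\<Psi> v) < f (\<Psi> 0)}"
  obtain p q \<delta> where pq: "p \<in> ?L" "q \<in> ?L" and d: "\<delta> > 0" "\<And>v. v \<in> tcone \<Longrightarrow> norm v < \<delta> \<Longrightarrow>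
     f (\<Psi> v) < f (\<Psi> 0) \<Longrightarrow> path_component ?L p v \<or> path_component ?L q v"
    using nc.lower_points_two_classes[OF expands isCont_f_\<Psi> r index] unfolding cone_eq by (elim exE conjE) (metis (no_types, lifting))
  obtain \<rho> where \<rho>: "\<rho> > 0" "\<And>x. x \<in> M \<Longrightarrow> dist x z < \<rho> \<Longrightarrow> \<exists>v\<in>tcone. norm v < \<delta> \<and> norm v < r \<and> \<Psi> v = x"
    using feasible_near[OF d(1)] by blast
  have "path_component {x\<in>M. f x < f z} (\<Psi> p) x \<or> path_component {x\<in>M. f x < f z} (\<Psi> q) x"
    if x: "x \<in> M" "dist x z < \<rho>" "f x < f z" for x
  proof -
    obtain v where v: "v \<in> tcone" "norm v < \<delta>" "\<Psi> v = x" using \<rho>(2)[OF x(1,2)] by blast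
    have "path_component ?L p v \<or> path_component ?L q v" using v x \<Psi>0 by (intro d(2)) auto
    then show ?thesis using path_component_lower v(3) by blast
  qed
  moreover have "\<Psi> p \<in> M" "f (\<Psi> p) < f z" "\<Psi> q \<in> M" "f (\<Psi> q) < f z"
    using pq feasible_iff \<Psi>0 by auto
  ultimately show ?thesis
    unfolding lower_reached_from_def using \<rho>(1) by (intro exI[of _ "\<Psi> p"] exI[of _ "\<Psi> q"]) auto
qed

end

lemma (in chart) stationary_chart_exists:
  assumes stat: "W_stationary_with P z w" and nd: "nondegenerate P z w"
  shows "\<exists>B. stationary_chart P z D \<Psi> r w B \<and>
    W_index P z w = card (beta_idx P z) + card {b\<in>B. inner b (hessian (lagrangian P w) z *v b) < 0}"
proof -
  let ?H = "hessian (lagrangian P w) z"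
  have sym: "inner x (?H *v y) = inner (?H *v x) y" for x y
    by (rule gradient_derivative_symmetric[OF lagrangian_gradient(1)[OF fin C2]
        has_derivative_hessian[OF lagrangian_gradient(3)[OF fin C2]], symmetric])
  have sub: "subspace (tangent_space P z)"
  proof -
    have "tangent_space P z = (\<Inter>c\<in>Act. {v. frechet_derivative (constr_fun P c) (at z) v = 0})"
      unfolding tangent_space_def by blast
    moreover have "subspace {v. frechet_derivative (constr_fun P c) (at z) v = 0}" if "c \<in> Act" for c
    proof -
      have "C2 (constr_fun P c)" using that Act_all C2_constr[OF C2] by blast
      then have "linear (frechet_derivative (constr_fun P c) (at z))"
        using linear_frechet_derivative unfolding C2_def by blast
      then show ?thesis by (rule linear_subspace_kernel)
    qed
    ultimately show ?thesis by (auto intro: subspace_Inter)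
  qed
  have nd': "\<forall>j\<in>active_ineq P z. mu w j > 0" "\<forall>m\<in>beta_idx P z. sig1 w m * sig2 w m \<noteq> 0"
    "invertible_mat (restrict_mat ?H (tangent_space P z))"
    using nd unfolding nondegenerate_def restricted_hessian_def by auto
  obtain B where B: "finite B" "independent B" "span B = tangent_space P z"
    "\<And>b c. b \<in> B \<Longrightarrow> c \<in> B \<Longrightarrow> b \<noteq> c \<Longrightarrow> inner b (?H *v c) = 0"
    "\<And>b. b \<in> B \<Longrightarrow> inner b (?H *v b) \<noteq> 0"
    "num_neg_eigenvalues (restrict_mat ?H (tangent_space P z)) = card {b\<in>B. inner b (?H *v b) < 0}"
    by (rule restrict_mat_signature[OF sym sub nd'(3)]) (rule that; assumption)+
  have "stationary_chart P z D \<Psi> r w B"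
    by unfold_locales (use stat nd' B in auto)
  moreover have "W_index P z w = card (beta_idx P z) + card {b\<in>B. inner b (?H *v b) < 0}"
    unfolding W_index_def quadratic_index_def restricted_hessian_def B(6) by simp
  ultimately show ?thesis by blast
qed

lemma finite_of_isolated:
  fixes S :: "'a::euclidean_space set"
  assumes "compact M" "S \<subseteq> M" "\<And>z. z \<in> M \<Longrightarrow> \<exists>\<rho>>0. \<forall>x\<in>S. dist x z < \<rho> \<longrightarrow> x = z"
  shows "finite S"
proof (rule ccontr)
  assume "infinite S"
  then obtain z where z: "z \<in> M" "z islimpt S"
    using Heine_Borel_imp_Bolzano_Weierstrass[OF assms(1) _ assms(2)] by blast
  then show False using assms(3)[OF z(1)] unfolding islimpt_approachable by blast
qed

theorem theorem3p5:
  fixes P :: "('n::finite, 'i, 'j) mpsc"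
  assumes "finite (eq_idx P)" and "finite (ineq_idx P)"
    and "C2_mpsc P"
    and "compact (feasible P)" and "connected (feasible P)"
    and "\<forall>x\<in>feasible P. LICQ P x"
    and "\<forall>x w. W_stationary_with P x w \<longrightarrow> nondegenerate P x w"
  shows "finite {x. local_minimizer P x} \<and> finite (W_saddles P)
    \<and> int (card (W_saddles P)) \<ge> int (card {x. local_minimizer P x}) - 1"
proof -
  let ?M = "feasible P" and ?f = "objective P"
  define W where "W = {x. \<exists>w. W_stationary_with P x w}"
  have WM: "W \<subseteq> ?M" unfolding W_def W_stationary_with_def by blast
  have chart: "\<exists>D \<Psi> r. chart P z D \<Psi> r" if "z \<in> ?M" for z
    using chart_exists[OF assms(1-3) that] assms(6) that by blast
  have stat: "\<exists>D \<Psi> r B. stationary_chart P z D \<Psi> r w B \<and>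
      W_index P z w = card (beta_idx P z) + card {b\<in>B. inner b (hessian (lagrangian P w) z *v b) < 0}"
    if w: "W_stationary_with P z w" for z w
  proof -
    have "z \<in> ?M" using w unfolding W_stationary_with_def by blast
    then obtain D \<Psi> r where "chart P z D \<Psi> r" using chart by blast
    from chart.stationary_chart_exists[OF this w] assms(7) w show ?thesis by blast
  qed
  have "finite W"
  proof (rule finite_of_isolated[OF assms(4) WM])
    fix z assume z: "z \<in> ?M"
    show "\<exists>\<rho>>0. \<forall>x\<in>W. dist x z < \<rho> \<longrightarrow> x = z"
    proof (cases "z \<in> W")
      case True
      then obtain w where "W_stationary_with P z w" unfolding W_def by blast
      then obtain D \<Psi> r B where "stationary_chart P z D \<Psi> r w B" using stat by blast
      from stationary_chart.isolated[OF this] show ?thesis unfolding W_def by blast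
    next
      case False
      then have ns: "\<And>w. \<not> W_stationary_with P z w" unfolding W_def by blast
      obtain D \<Psi> r where "chart P z D \<Psi> r" using chart[OF z] by blast
      from chart.nonstationary_neighbourhood[OF this ns] show ?thesis unfolding W_def by blast
    qed
  qed
  have mins: "local_mins ?f ?M = {x. local_minimizer P x}"
    unfolding local_mins_def local_minimizer_def by blast
  have "{x. local_minimizer P x} \<subseteq> W"
  proof
    fix z assume "z \<in> {x. local_minimizer P x}"
    then have z: "local_minimizer P z" "z \<in> ?M" unfolding local_minimizer_def by auto
    obtain D \<Psi> r where "chart P z D \<Psi> r" using chart[OF z(2)] by blast
    from chart.local_minimizer_W_stationary[OF this z(1)] show "z \<in> W" unfolding W_def by blast
  qed
  then have fin: "finite {x. local_minimizer P x}" using \<open>finite W\<close> finite_subset by blast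
  have "W_saddles P \<subseteq> W" unfolding W_saddles_def W_def by blast
  then have finS: "finite (W_saddles P)" using \<open>finite W\<close> finite_subset by blast
  have lpc: "locally path_connected ?M"
    unfolding locally_path_connected_im_kleinen
  proof (intro allI impI, elim conjE)
    fix V z assume V: "openin (top_of_set ?M) V" "z \<in> V"
    then obtain e where e: "e > 0" "ball z e \<inter> ?M \<subseteq> V" and z: "z \<in> ?M"
      unfolding openin_contains_ball by blast
    obtain D \<Psi> r where "chart P z D \<Psi> r" using chart[OF z] by blast
    from chart.locally_path_connected_at[OF this e(1)] obtain d where d: "d > 0"
      "\<And>y. y \<in> ?M \<Longrightarrow> dist y z < d \<Longrightarrow> path_component (?M \<inter> ball z e) z y" by blast
    show "\<exists>u. openin (top_of_set ?M) u \<and> z \<in> u \<and> u \<subseteq> V \<and>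
        (\<forall>y. y \<in> u \<longrightarrow> (\<exists>p. path p \<and> path_image p \<subseteq> V \<and> pathstart p = z \<and> pathfinish p = y))"
    proof (intro exI[of _ "?M \<inter> ball z (min d e)"] conjI allI impI)
      fix y assume "y \<in> ?M \<inter> ball z (min d e)"
      then have "path_component (?M \<inter> ball z e) z y" by (intro d(2)) (auto simp: dist_commute)
      then have "path_component V z y" by (rule path_component_of_subset[rotated]) (use e(2) in blast)
      then show "\<exists>p. path p \<and> path_image p \<subseteq> V \<and> pathstart p = z \<and> pathfinish p = y"
        unfolding path_component_def .
    qed (use d e z in \<open>auto simp: openin_open_Int\<close>)
  qed
  have cont: "continuous_on ?M ?f"
  proof -
    have "C2 ?f" using assms(3) unfolding C2_mpsc_def by blast
    then have "isCont ?f x" for x using C2D(1) has_derivative_continuous by blast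
    then show ?thesis by (simp add: continuous_at_imp_continuous_on)
  qed
  have "card (local_mins ?f ?M) \<le> card (W_saddles P) + 1"
  proof (rule mountain_pass_count[OF assms(4,5) lpc cont _ finS])
    show "finite (local_mins ?f ?M)" unfolding mins by (rule fin)
  next
    fix z assume z: "z \<in> ?M - W_saddles P"
    show "lower_joined ?f ?M z"
    proof (cases "z \<in> W")
      case True
      then obtain w where w: "W_stationary_with P z w" unfolding W_def by blast
      then obtain D \<Psi> r B where B: "stationary_chart P z D \<Psi> r w B"
        "W_index P z w = card (beta_idx P z) + card {b\<in>B. inner b (hessian (lagrangian P w) z *v b) < 0}"
        using stat by blast
      interpret stationary_chart P z D \<Psi> r w B by (rule B(1))
      have "W_index P z w \<noteq> 1" using z w unfolding W_saddles_def by blast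
      then have "card (beta_idx P z) + card nc.Bneg \<noteq> 1" using B(2) card_Bneg by simp
      then show ?thesis by (rule stationary_lower_joined)
    next
      case False
      then have ns: "\<And>w. \<not> W_stationary_with P z w" unfolding W_def by blast
      obtain D \<Psi> r where "chart P z D \<Psi> r" using chart z by blast
      then show ?thesis using chart.nonstationary_lower_joined ns by blast
    qed
  next
    fix z assume "z \<in> W_saddles P"
    then obtain w where w: "W_stationary_with P z w" "W_index P z w = 1" unfolding W_saddles_def by blast
    then obtain D \<Psi> r B where B: "stationary_chart P z D \<Psi> r w B"
        "W_index P z w = card (beta_idx P z) + card {b\<in>B. inner b (hessian (lagrangian P w) z *v b) < 0}"
      using stat by blast
    interpret stationary_chart P z D \<Psi> r w B by (rule B(1))
    have "card (beta_idx P z) + card nc.Bneg = 1" using B(2) w(2) card_Bneg by simp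
    then show "\<exists>p q. p \<in> ?M \<and> ?f p < ?f z \<and> q \<in> ?M \<and> ?f q < ?f z \<and>
        lower_reached_from ?f ?M z p q"
      by (rule stationary_lower_two_classes)
  qed
  then show ?thesis using fin finS unfolding mins by linarith
qed

end
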